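(* Let $\Sigma\subset\mathbb P^3$ be a projective surface with asymptotic coordinates $(x,y)$ and canonical system $z_{xx}=b z_y+\mu z$, $z_{yy}=c z_x+\nu z$. On $M^6$ (coordinates $(x,y,z,p,q,s)$, $(z,p,q,s)\ne0$), for each constant $s_0$, let $$X_{s_0}=\partial_x+p\partial_z+(bq+\mu z)\partial_p+s_0\partial_q,\quad Y_{s_0}=\partial_y+q\partial_z+s_0\partial_p+(cp+\nu z)\partial_q,\quad Z=\partial_s.$$ Then for every constant local section $s_0$ of $L^*$: (1) $\hat\Delta_{s_0}=\mathrm{span}\{X_{s_0},Y_{s_0},Z\}$ is a 3-plane distribution on $M^6$, with growth vector generically $(3,4,6)$, and $Z$ is a Cauchy characteristic of $\hat\Delta_{s_0}$. (2) The Cauchy reduced distribution $\bar\Delta_{s_0}$ is a generic bracket generating 2-plane distribution on the 5-dimensional submanifold $M^5_{s_0}=\{s=s_0\}\subset M^6$, so that the growth vector of $\bar\Delta_{s_0}$ is $(2,3,5)$ when no additional constraints are imposed on the geometry of $\Sigma$. (3) The following sufficient conditions for growth vector restrictions on $\bar\Delta_{s_0}$ hold independently of the choice of $s_0$: if $\bar{\mathbf R}=0$ then $\bar\Delta_{s_0}$ is integrable; if $\bar{\mathbf R}\ne0$ and $\bar\nabla\bar{\mathbf R}=0$ then the growth vector is $(2,3)$; if $\bar\nabla\bar{\mathbf R}\neq0$ and $\bar\nabla_W\bar{\mathbf R}=0$ for some nonzero local vector field $W$ on $\Sigma$, then the growth vector is $(2,3,4)$.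
   Context: $\mathbb K$ is $\mathbb R$ or $\mathbb C$; all data are smooth (resp. holomorphic) and local, with bundles trivialized. $\Sigma\subset\mathbb P^3$ is an immersed surface with nondegenerate projective second fundamental form (signature $(1,1)$ if $\mathbb K=\mathbb R$). Asymptotic coordinates are those whose coordinate curves are null for it. In them the components of a suitably scaled lift of the immersion form a basis of the 4-dimensional solution space of the canonical system. Thus the functions $b,c,\mu,\nu$ of $(x,y)$ satisfy $-2b_y\nu-b\nu_y-\mu_{yy}+\mu_x c+2\mu c_x+\nu_{xx}=0$, $-2b_yc-bc_y+c_{xx}+2\nu_x=0$, $-2\mu_y-b_{yy}+b_xc+2bc_x=0$. $M^6$ is the complement of the zero section in the total space of the rank-4 bundle $E\cong L\oplus T\Sigma\oplus L^*$ with fibre coordinates $(z,p,q,s)$ corresponding to $(z,z_x,z_y,z_{xy})$; $L^*$ is the normal line ($s$-direction). A vector field $V$ in a distribution $\Delta$ is a Cauchy characteristic if $[V,\Delta]\subseteq\Delta$. $\bar\Delta_{s_0}:=\bar\pi_*(\mathrm{span}\{X_{s_0},Y_{s_0}\})$, where $\bar\pi:M^6\to M^5_{s_0}$ is the projection to the level set forgetting $s$. $\bar{\mathbf R}$ is the curvature of the connection $\bar\nabla$ on $B=E/L^*$ (fibre coordinates $(z,p,q)$) with connection matrix $$\bar\omega=\begin{pmatrix}0&dx&dy\\ \mu\,dx&0&b\,dx\\ \nu\,dy&c\,dy&0\end{pmatrix}=\Gamma_1dx+\Gamma_2dy,$$ namely $\bar{\mathbf R}=d\bar\omega-\bar\omega\wedge\bar\omega=\hat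 R\,dx\wedge dy$. Covariant derivatives are taken on coefficient matrices: $\bar\nabla_{\partial_{x^k}}\bar{\mathbf R}$ has coefficient $\partial_{x^k}\hat R-[\Gamma_k,\hat R]$, with $(x^1,x^2)=(x,y)$, extended linearly over functions. Growth vector: $\Delta'=\Delta+[\Delta,\Delta]$, $\Delta^{(k+1)}=(\Delta^{(k)})'$, and the growth vector is $(\mathrm{rank}\,\Delta,\mathrm{rank}\,\Delta',\dots,\mathrm{rank}\,\Delta^{(\infty)})$, ranks understood where the derived distributions have constant rank. Integrable means $\Delta=\Delta'$. "Generically" means without imposing special conditions on the canonical system. *)

theory Defs
  imports "HOL-Analysis.Analysis"
begin

text \<open>
  The ground field is a type \<open>'k\<close> of sort \<open>{real_normed_field, euclidean_space}\<close>. Both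
  \<^typ>\<open>real\<close> and \<^typ>\<open>complex\<close> are of this sort, and up to isomorphism they are the only
  fields that are. All derivatives are taken over \<open>'k\<close>, so that smooth means \<open>C\<^sup>\<infinity>\<close> over the reals
  and holomorphic over the complex numbers.
\<close>

section \<open>Calculus on open subsets of a coordinate space\<close>

definition pd :: "'n::finite \<Rightarrow> ('k::{real_normed_field, euclidean_space}^'n \<Rightarrow> 'k) \<Rightarrow> 'k^'n \<Rightarrow> 'k" where
  "pd i f p = deriv (\<lambda>t. f (p + axis i t)) 0"

primrec Ck_on :: "nat \<Rightarrow> ('k::{real_normed_field, euclidean_space}^'n::finite) set \<Rightarrow> ('k^'n \<Rightarrow> 'k) \<Rightarrow> bool" where
  "Ck_on 0 U f \<longleftrightarrow> continuous_on U f"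
| "Ck_on (Suc k) U f \<longleftrightarrow> continuous_on U f \<and>
     (\<forall>i. (\<forall>p\<in>U. (\<lambda>t. f (p + axis i t)) field_differentiable at 0) \<and> Ck_on k U (pd i f))"

definition smooth_on :: "('k::{real_normed_field, euclidean_space}^'n::finite) set \<Rightarrow> ('k^'n \<Rightarrow> 'k) \<Rightarrow> bool" where
  "smooth_on U f \<longleftrightarrow> (\<forall>k. Ck_on k U f)"

definition pd_vec :: "'n::finite \<Rightarrow> ('k::{real_normed_field, euclidean_space}^'n \<Rightarrow> 'k^'m) \<Rightarrow> 'k^'n \<Rightarrow> 'k^'m" where
  "pd_vec i f p = (\<chi> j. pd i (\<lambda>q. f q $ j) p)"

definition smooth_vec_on :: "('k::{real_normed_field, euclidean_space}^'n::finite) set \<Rightarrow> ('k^'n \<Rightarrow> 'k^'m) \<Rightarrow> bool" where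
  "smooth_vec_on U f \<longleftrightarrow> (\<forall>j. smooth_on U (\<lambda>q. f q $ j))"

text \<open>
  The reading of \<open>f \<noteq> 0\<close> for a local section \<open>f\<close>: it is not the zero section on any nonempty open
  piece of \<open>U\<close>. Nowhere vanishing sections qualify; for a holomorphic section on a connected domain
  the condition says that it is not identically zero.
\<close>

definition nonzero_section_on :: "'a::topological_space set \<Rightarrow> ('a \<Rightarrow> 'b::zero) \<Rightarrow> bool" where
  "nonzero_section_on U f \<longleftrightarrow> (\<forall>N. open N \<and> N \<subseteq> U \<and> N \<noteq> {} \<longrightarrow> (\<exists>m\<in>N. f m \<noteq> 0))"

section \<open>Distributions\<close>

text \<open>
  A distribution is given by its field of subspaces \<open>D p\<close> of the tangent spaces; vector fields in it
  are its local smooth sections.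
\<close>

definition bracket :: "('k::{real_normed_field, euclidean_space}^'n::finite \<Rightarrow> 'k^'n) \<Rightarrow> ('k^'n \<Rightarrow> 'k^'n) \<Rightarrow> 'k^'n \<Rightarrow> 'k^'n" where
  "bracket V W p = (\<Sum>j\<in>UNIV. (V p $ j) *s pd_vec j W p - (W p $ j) *s pd_vec j V p)"

definition section_on :: "('k::{real_normed_field, euclidean_space}^'n::finite) set \<Rightarrow> ('k^'n \<Rightarrow> ('k^'n) set) \<Rightarrow> ('k^'n \<Rightarrow> 'k^'n) \<Rightarrow> bool" where
  "section_on N D V \<longleftrightarrow> smooth_vec_on N V \<and> (\<forall>p\<in>N. V p \<in> D p)"

definition distribution_on :: "nat \<Rightarrow> ('k::{real_normed_field, euclidean_space}^'n::finite) set \<Rightarrow> ('k^'n \<Rightarrow> ('k^'n) set) \<Rightarrow> bool" where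
  "distribution_on r M D \<longleftrightarrow> (\<forall>p\<in>M. \<exists>N Vs. open N \<and> p \<in> N \<and> N \<subseteq> M \<and> length Vs = r \<and>
     (\<forall>V\<in>set Vs. smooth_vec_on N V) \<and>
     (\<forall>q\<in>N. D q = vec.span ((\<lambda>V. V q) ` set Vs) \<and> vec.dim (D q) = r))"

definition derived :: "('k::{real_normed_field, euclidean_space}^'n::finite \<Rightarrow> ('k^'n) set) \<Rightarrow> 'k^'n \<Rightarrow> ('k^'n) set" where
  "derived D p = vec.span (D p \<union>
     {bracket V W p | N V W. open N \<and> p \<in> N \<and> section_on N D V \<and> section_on N D W})"

definition integrable_dist_on :: "('k::{real_normed_field, euclidean_space}^'n::finite) set \<Rightarrow> ('k^'n \<Rightarrow> ('k^'n) set) \<Rightarrow> bool" where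
  "integrable_dist_on M D \<longleftrightarrow> (\<forall>p\<in>M. derived D p = D p)"

text \<open>The points near which all derived distributions have constant rank.\<close>

definition regular_points :: "('k::{real_normed_field, euclidean_space}^'n::finite) set \<Rightarrow> ('k^'n \<Rightarrow> ('k^'n) set) \<Rightarrow> ('k^'n) set" where
  "regular_points M D = {p\<in>M. \<exists>N. open N \<and> p \<in> N \<and> N \<subseteq> M \<and>
     (\<forall>k. \<forall>q\<in>N. vec.dim ((derived ^^ k) D q) = vec.dim ((derived ^^ k) D p))}"

text \<open>
  The growth vector is evaluated at the regular points, which have to be dense in \<open>M\<close>. Beyond the
  end of the list \<open>g\<close> the ranks stay equal to its last entry, which is thus the rank of
  the limit of the derived flag.
\<close>

definition has_growth_vector :: "('k::{real_normed_field, euclidean_space}^'n::finite) set \<Rightarrow> ('k^'n \<Rightarrow> ('k^'n) set) \<Rightarrow> nat list \<Rightarrow> bool" where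
  "has_growth_vector M D g \<longleftrightarrow> g \<noteq> [] \<and> sorted_wrt (<) g \<and>
     M \<subseteq> closure (regular_points M D) \<and>
     (\<forall>p\<in>regular_points M D. \<forall>k. vec.dim ((derived ^^ k) D p) = g ! min k (length g - 1))"

definition cauchy_characteristic :: "('k::{real_normed_field, euclidean_space}^'n::finite) set \<Rightarrow> ('k^'n \<Rightarrow> ('k^'n) set) \<Rightarrow> ('k^'n \<Rightarrow> 'k^'n) \<Rightarrow> bool" where
  "cauchy_characteristic M D V \<longleftrightarrow> section_on M D V \<and>
     (\<forall>N W. open N \<and> N \<subseteq> M \<and> section_on N D W \<longrightarrow> (\<forall>p\<in>N. bracket V W p \<in> D p))"

section \<open>Projective surfaces with their canonical system\<close>

text \<open>
  A surface is given by a lift \<open>\<sigma>\<close> to the vector space over projective 3-space, with the asymptotic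
  coordinates \<open>(x, y)\<close> as first and second coordinate of \<open>'k^2\<close>. The projective second fundamental
  form is the Hessian of \<open>\<sigma>\<close> modulo the affine tangent space, spanned by \<open>\<sigma>\<close>, \<open>\<sigma>\<^sub>x\<close> and \<open>\<sigma>\<^sub>y\<close>; its
  values in the normal line are measured by the determinant with these three vectors.
\<close>

definition second_form :: "('k::{real_normed_field, euclidean_space}^2 \<Rightarrow> 'k^4) \<Rightarrow> 'k^2 \<Rightarrow> 'k^2^2" where
  "second_form \<sigma> m = (\<chi> i j. det (vector [\<sigma> m, pd_vec 1 \<sigma> m, pd_vec 2 \<sigma> m, pd_vec i (pd_vec j \<sigma>) m] :: 'k^4^4))"

definition asymptotic_surface :: "('k::{real_normed_field, euclidean_space}^2) set \<Rightarrow> ('k^2 \<Rightarrow> 'k^4) \<Rightarrow> bool" where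
  "asymptotic_surface U \<sigma> \<longleftrightarrow> open U \<and> smooth_vec_on U \<sigma> \<and>
     (\<forall>m\<in>U. vec.dim {\<sigma> m, pd_vec 1 \<sigma> m, pd_vec 2 \<sigma> m} = 3 \<and>
        det (second_form \<sigma> m) \<noteq> 0 \<and>
        second_form \<sigma> m $ 1 $ 1 = 0 \<and> second_form \<sigma> m $ 2 $ 2 = 0)"

definition canonical_surface ::
  "('k::{real_normed_field, euclidean_space}^2) set \<Rightarrow> ('k^2 \<Rightarrow> 'k^4) \<Rightarrow> ('k^2 \<Rightarrow> 'k) \<Rightarrow> ('k^2 \<Rightarrow> 'k) \<Rightarrow> ('k^2 \<Rightarrow> 'k) \<Rightarrow> ('k^2 \<Rightarrow> 'k) \<Rightarrow> bool" where
  "canonical_surface U \<sigma> b c \<mu> \<nu> \<longleftrightarrow> asymptotic_surface U \<sigma> \<and>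
     smooth_on U b \<and> smooth_on U c \<and> smooth_on U \<mu> \<and> smooth_on U \<nu> \<and>
     (\<forall>m\<in>U. pd_vec 1 (pd_vec 1 \<sigma>) m = b m *s pd_vec 2 \<sigma> m + \<mu> m *s \<sigma> m \<and>
             pd_vec 2 (pd_vec 2 \<sigma>) m = c m *s pd_vec 1 \<sigma> m + \<nu> m *s \<sigma> m)"

section \<open>Genericity\<close>

type_synonym 'k jet2 = "'k \<times> ('k^2) \<times> ('k^2^2)"

definition jet2 :: "('k::{real_normed_field, euclidean_space}^2 \<Rightarrow> 'k) \<Rightarrow> 'k^2 \<Rightarrow> 'k jet2" where
  "jet2 f m = (f m, (\<chi> i. pd i f m), (\<chi> i j. pd i (pd j f) m))"

text \<open>
  The 2-jets of canonical systems at a point: 2-jets of \<open>(b, c, \<mu>, \<nu>)\<close> that satisfy the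
  compatibility conditions of the canonical system and nothing else.
\<close>

definition canonical_jets :: "('k::{real_normed_field, euclidean_space} jet2 \<times> 'k jet2 \<times> 'k jet2 \<times> 'k jet2) set" where
  "canonical_jets = {((b, db, ddb), (c, dc, ddc), (\<mu>, d\<mu>, dd\<mu>), (\<nu>, d\<nu>, dd\<nu>)) | b db ddb c dc ddc \<mu> d\<mu> dd\<mu> \<nu> d\<nu> dd\<nu>.
     transpose ddb = ddb \<and> transpose ddc = ddc \<and> transpose dd\<mu> = dd\<mu> \<and> transpose dd\<nu> = dd\<nu> \<and>
     - 2 * db$2 * \<nu> - b * d\<nu>$2 - dd\<mu>$2$2 + d\<mu>$1 * c + 2 * \<mu> * dc$1 + dd\<nu>$1$1 = 0 \<and>
     - 2 * db$2 * c - b * dc$2 + ddc$1$1 + 2 * d\<nu>$1 = 0 \<and>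
     - 2 * d\<mu>$2 - ddb$2$2 + db$1 * c + 2 * b * dc$1 = 0}"

text \<open>
  A property of surfaces with their canonical system holds generically if it follows from an open
  dense condition on the 2-jets of the coefficients; this condition has to be fulfilled by some
  surface.
\<close>

definition generically ::
  "(('k::{real_normed_field, euclidean_space}^2) set \<Rightarrow> ('k^2 \<Rightarrow> 'k) \<Rightarrow> ('k^2 \<Rightarrow> 'k) \<Rightarrow> ('k^2 \<Rightarrow> 'k) \<Rightarrow> ('k^2 \<Rightarrow> 'k) \<Rightarrow> bool) \<Rightarrow> bool" where
  "generically P \<longleftrightarrow> (\<exists>G. openin (top_of_set canonical_jets) G \<and> canonical_jets \<subseteq> closure G \<and>
     (\<forall>U \<sigma> b c \<mu> \<nu>. canonical_surface U \<sigma> b c \<mu> \<nu> \<and>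
        (\<forall>m\<in>U. (jet2 b m, jet2 c m, jet2 \<mu> m, jet2 \<nu> m) \<in> G) \<longrightarrow> P U b c \<mu> \<nu>) \<and>
     (\<exists>U \<sigma> b c \<mu> \<nu>. U \<noteq> {} \<and> canonical_surface U \<sigma> b c \<mu> \<nu> \<and>
        (\<forall>m\<in>U. (jet2 b m, jet2 c m, jet2 \<mu> m, jet2 \<nu> m) \<in> G)))"

section \<open>The 3-plane distribution and its Cauchy reduction\<close>

text \<open>Coordinates 1 to 6 on \<open>M\<^sup>6\<close> are \<open>(x, y, z, p, q, s)\<close>.\<close>

definition base :: "'k::{real_normed_field, euclidean_space}^6 \<Rightarrow> 'k^2" where
  "base v = vector [v$1, v$2]"

definition M6 :: "('k::{real_normed_field, euclidean_space}^2) set \<Rightarrow> ('k^6) set" where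
  "M6 U = {v. base v \<in> U \<and> (v$3, v$4, v$5, v$6) \<noteq> (0, 0, 0, 0)}"

definition X_field :: "('k::{real_normed_field, euclidean_space}^2 \<Rightarrow> 'k) \<Rightarrow> ('k^2 \<Rightarrow> 'k) \<Rightarrow> 'k \<Rightarrow> 'k^6 \<Rightarrow> 'k^6" where
  "X_field b \<mu> s0 v = vector [1, 0, v$4, b (base v) * v$5 + \<mu> (base v) * v$3, s0, 0]"

definition Y_field :: "('k::{real_normed_field, euclidean_space}^2 \<Rightarrow> 'k) \<Rightarrow> ('k^2 \<Rightarrow> 'k) \<Rightarrow> 'k \<Rightarrow> 'k^6 \<Rightarrow> 'k^6" where
  "Y_field c \<nu> s0 v = vector [0, 1, v$5, s0, c (base v) * v$4 + \<nu> (base v) * v$3, 0]"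

definition Z_field :: "'k::{real_normed_field, euclidean_space}^6 \<Rightarrow> 'k^6" where
  "Z_field v = axis 6 1"

definition hat_dist ::
  "('k::{real_normed_field, euclidean_space}^2 \<Rightarrow> 'k) \<Rightarrow> ('k^2 \<Rightarrow> 'k) \<Rightarrow> ('k^2 \<Rightarrow> 'k) \<Rightarrow> ('k^2 \<Rightarrow> 'k) \<Rightarrow> 'k \<Rightarrow> 'k^6 \<Rightarrow> ('k^6) set" where
  "hat_dist b c \<mu> \<nu> s0 v = vec.span {X_field b \<mu> s0 v, Y_field c \<nu> s0 v, Z_field v}"

text \<open>
  The level set \<open>s = s\<^sub>0\<close> in \<open>M\<^sup>6\<close> carries the coordinates \<open>(x, y, z, p, q)\<close>; in them its inclusion is
  \<open>level_incl s0\<close>. The projection \<open>forget_s\<close> is linear, hence equal to its own differential.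
\<close>

definition level_incl :: "'k::{real_normed_field, euclidean_space} \<Rightarrow> 'k^5 \<Rightarrow> 'k^6" where
  "level_incl s0 m = vector [m$1, m$2, m$3, m$4, m$5, s0]"

definition forget_s :: "'k::{real_normed_field, euclidean_space}^6 \<Rightarrow> 'k^5" where
  "forget_s v = vector [v$1, v$2, v$3, v$4, v$5]"

definition M5 :: "('k::{real_normed_field, euclidean_space}^2) set \<Rightarrow> 'k \<Rightarrow> ('k^5) set" where
  "M5 U s0 = {m. level_incl s0 m \<in> M6 U}"

definition bar_dist ::
  "('k::{real_normed_field, euclidean_space}^2 \<Rightarrow> 'k) \<Rightarrow> ('k^2 \<Rightarrow> 'k) \<Rightarrow> ('k^2 \<Rightarrow> 'k) \<Rightarrow> ('k^2 \<Rightarrow> 'k) \<Rightarrow> 'k \<Rightarrow> 'k^5 \<Rightarrow> ('k^5) set" where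
  "bar_dist b c \<mu> \<nu> s0 m =
     forget_s ` vec.span {X_field b \<mu> s0 (level_incl s0 m), Y_field c \<nu> s0 (level_incl s0 m)}"

section \<open>The connection on the quotient bundle\<close>

definition conn :: "('k::{real_normed_field, euclidean_space}^2 \<Rightarrow> 'k) \<Rightarrow> ('k^2 \<Rightarrow> 'k) \<Rightarrow> ('k^2 \<Rightarrow> 'k) \<Rightarrow> ('k^2 \<Rightarrow> 'k) \<Rightarrow> 2 \<Rightarrow> 'k^2 \<Rightarrow> 'k^3^3" where
  "conn b c \<mu> \<nu> k m =
     (if k = 1 then vector [vector [0, 1, 0], vector [\<mu> m, 0, b m], vector [0, 0, 0]]
      else vector [vector [0, 0, 1], vector [0, 0, 0], vector [\<nu> m, c m, 0]])"

definition pd_mat :: "'n::finite \<Rightarrow> ('k::{real_normed_field, euclidean_space}^'n \<Rightarrow> 'k^'l^'m) \<Rightarrow> 'k^'n \<Rightarrow> 'k^'l^'m" where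
  "pd_mat i A p = (\<chi> r. pd_vec i (\<lambda>q. A q $ r) p)"

definition commutator :: "'k::comm_ring_1^'n::finite^'n \<Rightarrow> 'k^'n^'n \<Rightarrow> 'k^'n^'n" where
  "commutator A B = A ** B - B ** A"

text \<open>
  For \<open>\<omega> = \<Gamma>\<^sub>1 dx + \<Gamma>\<^sub>2 dy\<close>, the coefficient of \<open>dx \<and> dy\<close> in \<open>d\<omega> - \<omega> \<and> \<omega>\<close> is
  \<open>\<partial>\<^sub>x \<Gamma>\<^sub>2 - \<partial>\<^sub>y \<Gamma>\<^sub>1 - [\<Gamma>\<^sub>1, \<Gamma>\<^sub>2]\<close>.
\<close>

definition curv :: "('k::{real_normed_field, euclidean_space}^2 \<Rightarrow> 'k) \<Rightarrow> ('k^2 \<Rightarrow> 'k) \<Rightarrow> ('k^2 \<Rightarrow> 'k) \<Rightarrow> ('k^2 \<Rightarrow> 'k) \<Rightarrow> 'k^2 \<Rightarrow> 'k^3^3" where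
  "curv b c \<mu> \<nu> m = pd_mat 1 (conn b c \<mu> \<nu> 2) m - pd_mat 2 (conn b c \<mu> \<nu> 1) m
     - commutator (conn b c \<mu> \<nu> 1 m) (conn b c \<mu> \<nu> 2 m)"

definition nabla_curv :: "('k::{real_normed_field, euclidean_space}^2 \<Rightarrow> 'k) \<Rightarrow> ('k^2 \<Rightarrow> 'k) \<Rightarrow> ('k^2 \<Rightarrow> 'k) \<Rightarrow> ('k^2 \<Rightarrow> 'k) \<Rightarrow> 'k^2 \<Rightarrow> 'k^3^3^2" where
  "nabla_curv b c \<mu> \<nu> m = (\<chi> k. pd_mat k (curv b c \<mu> \<nu>) m - commutator (conn b c \<mu> \<nu> k m) (curv b c \<mu> \<nu> m))"

definition nabla_curv_along ::
  "('k::{real_normed_field, euclidean_space}^2 \<Rightarrow> 'k) \<Rightarrow> ('k^2 \<Rightarrow> 'k) \<Rightarrow> ('k^2 \<Rightarrow> 'k) \<Rightarrow> ('k^2 \<Rightarrow> 'k) \<Rightarrow> ('k^2 \<Rightarrow> 'k^2) \<Rightarrow> 'k^2 \<Rightarrow> 'k^3^3" where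
  "nabla_curv_along b c \<mu> \<nu> W m = (\<chi> i j. \<Sum>k\<in>UNIV. W m $ k * nabla_curv b c \<mu> \<nu> m $ k $ i $ j)"

end

theory Submission
  imports Defs
begin

text \<open>Write a point of \<open>M\<^sup>5\<close> as \<open>(x, y, w)\<close> with \<open>w = (z, p, q)\<close>. Then \<open>X = \<partial>\<^sub>x + \<Gamma>\<^sub>1 w + s\<^sub>0 e\<^sub>3\<close> and \<open>Y = \<partial>\<^sub>y + \<Gamma>\<^sub>2 w + s\<^sub>0 e\<^sub>2\<close>
  are horizontal lifts for the connection up to constant vertical terms. Since \<open>\<Gamma>\<^sub>1 e\<^sub>2 = \<Gamma>\<^sub>2 e\<^sub>3 = e\<^sub>1\<close>, these
  terms cancel in the bracket, and \<open>[X, Y]\<close> is the vertical field \<open>T = R w\<close> whatever \<open>s\<^sub>0\<close> is (\<open>bracket_XY\<close>). So the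
  first derived distribution is the span of \<open>X\<close>, \<open>Y\<close> and \<open>R w\<close> (\<open>derived_bar_dist\<close>). The first row of \<open>R\<close> is zero, and
  the \<open>z\<close>-components of \<open>[X, T]\<close> and \<open>[Y, T]\<close> are minus the \<open>p\<close>- and \<open>q\<close>-component of \<open>T\<close>. Hence the second derived
  distribution has rank at least 4 wherever \<open>R w \<noteq> 0\<close>, and rank 5 wherever the vertical parts of \<open>T\<close>, \<open>[X, T]\<close>
  and \<open>[Y, T]\<close> are independent.

  The six-dimensional distribution is the preimage of the five-dimensional one under the linear projection that
  forgets \<open>s\<close>. Taking derived distributions commutes with this preimage (\<open>derived_pull\<close>), because the derivative
  along \<open>s\<close> of a section stays in a subspace that is constant along \<open>s\<close>. Thus \<open>Z\<close> is a Cauchy characteristic, and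
  all ranks on \<open>M\<^sup>6\<close> are those on \<open>M\<^sup>5\<close> plus one.

  Genericity: the determinant of the vertical parts of \<open>T\<close>, \<open>[X, T]\<close> and \<open>[Y, T]\<close> is a polynomial in \<open>w\<close> whose coefficients
  are polynomials in the 2-jet of the coefficients. The generic jets are those for which it is not the zero
  polynomial. They are open, and they are dense because \<open>\<mu>\<close> and \<open>\<nu>\<^sub>x\<^sub>y\<close> can be varied within the compatibility
  conditions so as to make the determinant nonzero. An explicit surface with such jets is the one with \<open>b = c = 0\<close>,
  \<open>\<mu> = 2/x\<^sup>2\<close>, \<open>\<nu> = 2/y\<^sup>2\<close>.

  Degenerate curvature: the first row of \<open>\<nabla>\<^sub>x R\<close> and \<open>\<nabla>\<^sub>y R\<close> is minus the second and third row of \<open>R\<close>, so a parallel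
  \<open>R\<close> vanishes, and a nowhere locally zero parallel curvature exists only over the empty surface. If
  \<open>\<nabla>\<^sub>W R = 0\<close>, the two rows of \<open>R\<close> are proportional with ratio given by \<open>W\<close>, so \<open>R w\<close> has a direction that depends on \<open>(x, y)\<close>
  only. On an open dense set of base points there is then a covector \<open>\<rho>\<close> on \<open>B\<close> that spans a parallel line and annihilates \<open>R\<close>
  (\<open>recurrent_covector_somewhere\<close>). In the case where both components of \<open>W\<close> are nonzero this uses the compatibility conditions,
  which follow from the symmetry of the mixed derivatives of \<open>\<sigma>\<close>. The kernel of \<open>\<rho>\<close>, together with \<open>X\<close> and \<open>Y\<close>, spans an integrable distribution of
  rank 4 that contains \<open>X\<close> and \<open>Y\<close> (\<open>\<theta>_bracket\<close>), so the growth stops at 4.\<close>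

section \<open>Smooth functions over a real or complex field\<close>

lemma axis_0 [simp]: "axis i (0::'k::zero) = 0"
  by (simp add: axis_eq_0_iff)

lemma continuous_on_axis [continuous_intros]:
  fixes f :: "'a::topological_space \<Rightarrow> 'k::{topological_space, zero}"
  assumes "continuous_on S f"
  shows "continuous_on S (\<lambda>t. axis i (f t) :: 'k^'n::finite)"
proof -
  have "continuous_on S (\<lambda>t. if j = i then f t else 0)" for j :: 'n
    using assms by (cases "j = i") auto
  then show ?thesis unfolding axis_def by (intro continuous_on_vec_lambda)
qed

lemma eventually_line_in:
  fixes U :: "('k::real_normed_vector^'n::finite) set"
  assumes "open U" "p \<in> U"
  shows "\<forall>\<^sub>F t in nhds 0. p + axis i t \<in> U"
proof -
  have "open ((\<lambda>t. p + axis i t) -` U)"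
    by (intro open_vimage assms) (intro continuous_intros)
  moreover have "0 \<in> (\<lambda>t. p + axis i t) -` U" using assms by simp
  ultimately show ?thesis using eventually_nhds by blast
qed

lemma pd_cong:
  assumes "open U" "p \<in> U" "\<And>q. q \<in> U \<Longrightarrow> f q = g q"
  shows "pd i f p = pd i g p"
  unfolding pd_def
  by (rule deriv_cong_ev[OF eventually_mono[OF eventually_line_in[OF assms(1,2)]]]) (auto intro: assms(3))

lemma line_differentiable_cong:
  fixes f g :: "'k::{real_normed_field, euclidean_space}^'n::finite \<Rightarrow> 'k"
  assumes "open U" "p \<in> U" "\<And>q. q \<in> U \<Longrightarrow> f q = g q"
    and "(\<lambda>t. f (p + axis i t)) field_differentiable at 0"
  shows "(\<lambda>t. g (p + axis i t)) field_differentiable at 0"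
proof -
  have *: "\<forall>\<^sub>F t in nhds 0. f (p + axis i t) = g (p + axis i t)"
    by (rule eventually_mono[OF eventually_line_in[OF assms(1,2)]]) (auto intro: assms(3))
  show ?thesis
    using assms(4) DERIV_cong_ev[OF refl * refl] unfolding field_differentiable_def by blast
qed

lemma Ck_on_cong:
  assumes "open U" "\<And>q. q \<in> U \<Longrightarrow> f q = g q" "Ck_on k U f"
  shows "Ck_on k U g"
  using assms(2,3)
proof (induction k arbitrary: f g)
  case 0
  then show ?case unfolding Ck_on.simps by (rule continuous_on_eq[of U f g, rotated])
next
  case (Suc k)
  have "Ck_on k U (pd i g)" for i
    by (rule Suc.IH[of "pd i f"]) (use Suc.prems pd_cong[OF assms(1), of _ f g i] in auto)
  moreover have "continuous_on U g"
    by (rule continuous_on_eq[of U f]) (use Suc.prems in simp_all)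
  moreover have "(\<lambda>t. g (p + axis i t)) field_differentiable at 0" if "p \<in> U" for p i
    by (rule line_differentiable_cong[OF assms(1) that Suc.prems(1)]) (use Suc.prems that in auto)
  ultimately show ?case by simp
qed

lemma Ck_on_SucD: "Ck_on (Suc k) U f \<Longrightarrow> Ck_on k U f"
  by (induction k arbitrary: f) auto

lemma Ck_on_subset: "Ck_on k U f \<Longrightarrow> N \<subseteq> U \<Longrightarrow> Ck_on k N f"
  by (induction k arbitrary: f) (auto intro: continuous_on_subset)

lemma smooth_on_subset: "smooth_on U f \<Longrightarrow> N \<subseteq> U \<Longrightarrow> smooth_on N f"
  using Ck_on_subset unfolding smooth_on_def by blast

lemma smooth_on_imp_continuous_on: "smooth_on U f \<Longrightarrow> continuous_on U f"
  unfolding smooth_on_def by (metis Ck_on.simps(1))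

lemma smooth_on_pd [simp, intro]: "smooth_on U f \<Longrightarrow> smooth_on U (pd i f)"
  unfolding smooth_on_def by (metis Ck_on.simps(2))

lemma smooth_on_has_pd:
  assumes "smooth_on U f" "p \<in> U"
  shows "((\<lambda>t. f (p + axis i t)) has_field_derivative pd i f p) (at 0)"
proof -
  have "(\<lambda>t. f (p + axis i t)) field_differentiable at 0"
    using assms unfolding smooth_on_def by (metis Ck_on.simps(2))
  then show ?thesis unfolding pd_def by (simp add: field_differentiable_derivI)
qed

lemma pd_eqI: "((\<lambda>t. f (p + axis i t)) has_field_derivative d) (at 0) \<Longrightarrow> pd i f p = d"
  unfolding pd_def by (rule DERIV_imp_deriv)

lemma pd_const [simp]: "pd i (\<lambda>q. a) p = 0"
  by (simp add: pd_def)

lemma pd_add: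
  assumes "smooth_on U f" "smooth_on U g" "p \<in> U"
  shows "pd i (\<lambda>q. f q + g q) p = pd i f p + pd i g p"
  by (rule pd_eqI, rule DERIV_add[OF assms(1,2)[THEN smooth_on_has_pd, OF assms(3)]])

lemma pd_mult:
  assumes "smooth_on U f" "smooth_on U g" "p \<in> U"
  shows "pd i (\<lambda>q. f q * g q) p = pd i f p * g p + f p * pd i g p"
  by (rule pd_eqI)
     (use DERIV_mult[OF assms(1,2)[THEN smooth_on_has_pd, OF assms(3)], of i i] in \<open>simp add: mult.commute\<close>)

lemma pd_coord: "pd i (\<lambda>q. q $ j) p = (if i = j then 1 else 0)"
  by (rule pd_eqI) (auto simp: axis_def intro!: derivative_eq_intros)

lemma Ck_on_const: "Ck_on k (U :: ('k::{real_normed_field, euclidean_space}^'n::finite) set) (\<lambda>q. a)"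
proof (induction k arbitrary: a)
  case (Suc k)
  have "pd i (\<lambda>q. a) = (\<lambda>q. 0)" for i :: 'n and a :: 'k by (simp add: fun_eq_iff)
  with Suc show ?case by (auto intro: field_differentiable_const)
qed simp

lemma smooth_on_const [simp, intro]: "smooth_on U (\<lambda>q. a)"
  unfolding smooth_on_def using Ck_on_const by blast

lemma Ck_on_coord:
  "Ck_on k (U :: ('k::{real_normed_field, euclidean_space}^'n::finite) set) (\<lambda>q. q $ j)"
proof (cases k)
  case (Suc l)
  have "pd i (\<lambda>q::'k^'n. q $ j) = (\<lambda>q. if i = j then 1 else 0)" for i by (simp add: fun_eq_iff pd_coord)
  moreover have "(\<lambda>t::'k. (p + axis i t) $ j) field_differentiable at 0" for p :: "'k^'n" and i
    by (cases "i = j") (auto simp: axis_def intro!: derivative_intros)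
  ultimately show ?thesis using Suc by (auto intro!: continuous_intros Ck_on_const)
qed (auto intro!: continuous_intros)

lemma smooth_on_coord [simp, intro]: "smooth_on U (\<lambda>q. q $ j)"
  unfolding smooth_on_def using Ck_on_coord by blast

lemma Ck_on_add:
  assumes "open U" "Ck_on k U f" "Ck_on k U g"
  shows "Ck_on k U (\<lambda>q. f q + g q)"
  using assms(2,3)
proof (induction k arbitrary: f g)
  case 0
  then show ?case by (auto intro!: continuous_intros)
next
  case (Suc k)
  have *: "pd i (\<lambda>q. f q + g q) p = pd i f p + pd i g p" if "p \<in> U" for p i
    unfolding pd_def by (rule deriv_add) (use Suc.prems that in auto)
  have "Ck_on k U (pd i (\<lambda>q. f q + g q))" for i
    by (rule Ck_on_cong[OF assms(1) _ Suc.IH[of "pd i f" "pd i g"]]) (use Suc.prems * in auto)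
  moreover have "(\<lambda>t. f (p + axis i t) + g (p + axis i t)) field_differentiable at 0" if "p \<in> U" for p i
    by (rule field_differentiable_add) (use Suc.prems that in auto)
  moreover have "continuous_on U (\<lambda>q. f q + g q)"
    by (rule continuous_on_add) (use Suc.prems in auto)
  ultimately show ?case by simp
qed

lemma Ck_on_mult:
  assumes "open U" "Ck_on k U f" "Ck_on k U g"
  shows "Ck_on k U (\<lambda>q. f q * g q)"
  using assms(2,3)
proof (induction k arbitrary: f g)
  case 0
  then show ?case by (auto intro!: continuous_intros)
next
  case (Suc k)
  have *: "pd i (\<lambda>q. f q * g q) p = f p * pd i g p + pd i f p * g p" if "p \<in> U" for p i
    unfolding pd_def using deriv_mult[of "\<lambda>t. f (p + axis i t)" 0 "\<lambda>t. g (p + axis i t)"] Suc.prems that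
    by auto
  have "Ck_on k U (pd i (\<lambda>q. f q * g q))" for i
    by (rule Ck_on_cong[OF assms(1) _ Ck_on_add[OF assms(1) Suc.IH[of f "pd i g"] Suc.IH[of "pd i f" g]]])
       (use Suc.prems Suc.prems[THEN Ck_on_SucD] * in auto)
  moreover have "(\<lambda>t. f (p + axis i t) * g (p + axis i t)) field_differentiable at 0" if "p \<in> U" for p i
    by (rule field_differentiable_mult) (use Suc.prems that in auto)
  moreover have "continuous_on U (\<lambda>q. f q * g q)"
    by (rule continuous_on_mult) (use Suc.prems in auto)
  ultimately show ?case by simp
qed

lemma Ck_on_inverse:
  assumes "open U" "\<And>p. p \<in> U \<Longrightarrow> f p \<noteq> 0" "Ck_on k U f"
  shows "Ck_on k U (\<lambda>q. inverse (f q))"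
  using assms(3)
proof (induction k)
  case 0
  then show ?case using assms(2) by (auto intro!: continuous_intros)
next
  case (Suc k)
  note IH = Suc.IH[OF Ck_on_SucD[OF Suc.prems]]
  have *: "pd i (\<lambda>q. inverse (f q)) p = (-1) * (pd i f p * (inverse (f p) * inverse (f p)))"
    if "p \<in> U" for p i
  proof (rule pd_eqI)
    have "((\<lambda>t. f (p + axis i t)) has_field_derivative pd i f p) (at 0)"
      unfolding pd_def using Suc.prems that by (auto intro: field_differentiable_derivI)
    from DERIV_inverse'[OF this]
    show "((\<lambda>t. inverse (f (p + axis i t))) has_field_derivative
        (-1) * (pd i f p * (inverse (f p) * inverse (f p)))) (at 0)"
      using assms(2)[OF that] by (simp add: ac_simps)
  qed
  have "Ck_on k U (pd i (\<lambda>q. inverse (f q)))" for i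
    by (rule Ck_on_cong[OF assms(1) *[symmetric]],
        assumption, intro Ck_on_mult assms(1) Ck_on_const IH) (use Suc.prems in auto)
  moreover have "(\<lambda>t. inverse (f (p + axis i t))) field_differentiable at 0" if "p \<in> U" for p i
    by (rule field_differentiable_inverse) (use Suc.prems assms(2) that in auto)
  moreover have "continuous_on U (\<lambda>q. inverse (f q))"
    by (rule continuous_on_inverse) (use Suc.prems assms(2) in auto)
  ultimately show ?case by simp
qed

lemma smooth_on_add [simp, intro]:
  "open U \<Longrightarrow> smooth_on U f \<Longrightarrow> smooth_on U g \<Longrightarrow> smooth_on U (\<lambda>q. f q + g q)"
  unfolding smooth_on_def by (auto intro: Ck_on_add)

lemma smooth_on_mult [simp, intro]:
  "open U \<Longrightarrow> smooth_on U f \<Longrightarrow> smooth_on U g \<Longrightarrow> smooth_on U (\<lambda>q. f q * g q)"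
  unfolding smooth_on_def by (auto intro: Ck_on_mult)


lemma smooth_on_minus [simp, intro]:
  "open U \<Longrightarrow> smooth_on U f \<Longrightarrow> smooth_on U (\<lambda>q. - f q)"
  using smooth_on_mult[OF _ smooth_on_const[of U "-1"], of f] by simp

lemma smooth_on_diff [simp, intro]:
  "open U \<Longrightarrow> smooth_on U f \<Longrightarrow> smooth_on U g \<Longrightarrow> smooth_on U (\<lambda>q. f q - g q)"
  using smooth_on_add[OF _ _ smooth_on_minus[of U g], of f] by simp

lemma smooth_on_power [simp, intro]:
  "open U \<Longrightarrow> smooth_on U f \<Longrightarrow> smooth_on U (\<lambda>q. f q ^ k)"
  by (induction k) auto

lemma smooth_on_inverse:
  "open U \<Longrightarrow> smooth_on U f \<Longrightarrow> (\<And>p. p \<in> U \<Longrightarrow> f p \<noteq> 0) \<Longrightarrow> smooth_on U (\<lambda>q. inverse (f q))"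
  unfolding smooth_on_def by (intro allI Ck_on_inverse) auto

lemma smooth_on_divide [intro]:
  "open U \<Longrightarrow> smooth_on U f \<Longrightarrow> smooth_on U g \<Longrightarrow> (\<And>p. p \<in> U \<Longrightarrow> g p \<noteq> 0) \<Longrightarrow>
     smooth_on U (\<lambda>q. f q / g q)"
  unfolding smooth_on_def divide_inverse by (intro allI Ck_on_mult Ck_on_inverse) auto

lemma pd_minus: "smooth_on U f \<Longrightarrow> p \<in> U \<Longrightarrow> pd i (\<lambda>q. - f q) p = - pd i f p"
  using pd_mult[of U "\<lambda>q. -1" f p i] by simp

lemma pd_diff:
  "open U \<Longrightarrow> smooth_on U f \<Longrightarrow> smooth_on U g \<Longrightarrow> p \<in> U \<Longrightarrow> pd i (\<lambda>q. f q - g q) p = pd i f p - pd i g p"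
  using pd_add[of U f "\<lambda>q. - g q" p i] pd_minus[of U g p i] by simp

text \<open>Projections such as \<open>base\<close> and inclusions such as \<open>level_incl s0\<close> carry each coordinate line
  either to a coordinate line or to a point. Along such maps the chain rule needs no total
  derivative.\<close>

definition coordinate_map :: "('k::{real_normed_field, euclidean_space}^'n::finite \<Rightarrow> 'k^'m::finite) \<Rightarrow> bool" where
  "coordinate_map L \<longleftrightarrow> continuous_on UNIV L \<and>
     (\<forall>i. (\<exists>j. \<forall>p t. L (p + axis i t) = L p + axis j t) \<or> (\<forall>p t. L (p + axis i t) = L p))"

lemma Ck_on_compose_coordinate_map:
  fixes L :: "'k::{real_normed_field, euclidean_space}^'n::finite \<Rightarrow> 'k^'m::finite"
  assumes L: "coordinate_map L"
  shows "Ck_on k U f \<Longrightarrow> Ck_on k (L -` U) (\<lambda>q. f (L q))"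
proof (induction k arbitrary: f)
  case 0
  then show ?case
    using L unfolding coordinate_map_def
    by (auto intro!: continuous_on_compose2[of U f] intro: continuous_on_subset)
next
  case (Suc k)
  have "Ck_on k (L -` U) (pd i (\<lambda>q. f (L q))) \<and>
      (\<forall>p\<in>L -` U. (\<lambda>t. f (L (p + axis i t))) field_differentiable at 0)" for i
  proof (cases "\<forall>p t. L (p + axis i t) = L p")
    case True
    then have "pd i (\<lambda>q. f (L q)) = (\<lambda>q. 0)" by (simp add: fun_eq_iff pd_def)
    then show ?thesis using True by (simp add: Ck_on_const)
  next
    case False
    then obtain j where j: "\<And>p t. L (p + axis i t) = L p + axis j t"
      using L unfolding coordinate_map_def by blast
    then have "pd i (\<lambda>q. f (L q)) = (\<lambda>q. pd j f (L q))" by (simp add: fun_eq_iff pd_def)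
    then show ?thesis using j Suc by simp
  qed
  moreover have "continuous_on (L -` U) (\<lambda>q. f (L q))"
    using Suc.prems L unfolding coordinate_map_def
    by (auto intro!: continuous_on_compose2[of U f] intro: continuous_on_subset)
  ultimately show ?case by simp
qed

lemma smooth_on_compose_coordinate_map:
  "coordinate_map L \<Longrightarrow> smooth_on U f \<Longrightarrow> smooth_on (L -` U) (\<lambda>q. f (L q))"
  unfolding smooth_on_def using Ck_on_compose_coordinate_map by blast

lemma axis_add: "axis i (s + t) = axis i s + (axis i t :: 'k::monoid_add^'n)"
  by (simp add: vec_eq_iff axis_def)

lemma has_field_derivative_line:
  assumes "smooth_on U f" "q + axis i s \<in> U"
  shows "((\<lambda>t. f (q + axis i t)) has_field_derivative pd i f (q + axis i s)) (at s)"
  using smooth_on_has_pd[OF assms, of i] DERIV_shift[of "\<lambda>t. f (q + axis i t)" _ 0 s]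
  by (simp add: axis_add ac_simps)

lemma norm_axis: "norm (axis i t :: 'k::real_normed_vector^'n::finite) = norm t"
proof -
  have "(\<Sum>j\<in>UNIV. (norm ((axis i t :: 'k^'n) $ j))\<^sup>2) = (\<Sum>j\<in>UNIV. if j = i then (norm t)\<^sup>2 else 0)"
    by (rule sum.cong) (auto simp: axis_def)
  then show ?thesis unfolding norm_vec_def L2_set_def by simp
qed

text \<open>The mean value inequality in each of the two variables compares the second difference with
  the mixed derivative. It holds over the complex numbers as well as over the reals, which the
  mean value theorem does not.\<close>

lemma second_difference_bound:
  fixes f :: "'k::{real_normed_field, euclidean_space}^'n::finite \<Rightarrow> 'k"
  assumes f: "smooth_on U f"
    and in_U: "\<And>s t. norm s < d \<Longrightarrow> norm t < d \<Longrightarrow> p + axis i s + axis j t \<in> U"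
    and bd: "\<And>s t. norm s < d \<Longrightarrow> norm t < d \<Longrightarrow> norm (pd j (pd i f) (p + axis i s + axis j t) - l) \<le> e"
    and st: "norm s < d" "norm t < d"
  shows "norm (f (p + axis i s + axis j t) - f (p + axis i s) - f (p + axis j t) + f p - l * t * s)
           \<le> e * norm t * norm s"
proof -
  have d: "0 < d" using st norm_ge_zero[of s] by linarith
  have inner: "norm (pd i f (p + axis i s + axis j t) - pd i f (p + axis i s) - l * t) \<le> e * norm t"
    if s: "norm s < d" for s
  proof -
    have "norm ((pd i f (p + axis i s + axis j t) - l * t)
        - (pd i f (p + axis i s + axis j 0) - l * 0)) \<le> e * norm (t - 0)"
    proof (rule field_differentiable_bound[where S = "ball 0 d"
          and f' = "\<lambda>t. pd j (pd i f) (p + axis i s + axis j t) - l"])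
      fix r :: 'k assume "r \<in> ball 0 d"
      then have r: "norm r < d" by simp
      have "((\<lambda>t. pd i f (p + axis i s + axis j t) - l * t) has_field_derivative
          pd j (pd i f) (p + axis i s + axis j r) - l) (at r)"
        by (auto intro!: derivative_eq_intros has_field_derivative_line[OF smooth_on_pd[OF f]] in_U s r)
      then show "((\<lambda>t. pd i f (p + axis i s + axis j t) - l * t) has_field_derivative
          pd j (pd i f) (p + axis i s + axis j r) - l) (at r within ball 0 d)"
        by (rule has_field_derivative_at_within)
      show "norm (pd j (pd i f) (p + axis i s + axis j r) - l) \<le> e" using bd s r by blast
    qed (use st d in auto)
    then show ?thesis by (simp add: algebra_simps)
  qed
  have "norm ((f (p + axis j t + axis i s) - f (p + axis i s) - l * t * s)
      - (f (p + axis j t + axis i 0) - f (p + axis i 0) - l * t * 0)) \<le> e * norm t * norm (s - 0)"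
  proof (rule field_differentiable_bound[where S = "ball 0 d"
        and f' = "\<lambda>s. pd i f (p + axis j t + axis i s) - pd i f (p + axis i s) - l * t"])
    fix r :: 'k assume "r \<in> ball 0 d"
    then have r: "norm r < d" by simp
    have 1: "p + axis j t + axis i r \<in> U" using in_U[OF r st(2)] by (simp add: add_ac)
    have 2: "p + axis i r \<in> U" using in_U[OF r, of 0] d by simp
    have "((\<lambda>s. f (p + axis j t + axis i s) - f (p + axis i s) - l * t * s) has_field_derivative
        pd i f (p + axis j t + axis i r) - pd i f (p + axis i r) - l * t) (at r)"
      by (auto intro!: derivative_eq_intros has_field_derivative_line[OF f] 1 2)
    then show "((\<lambda>s. f (p + axis j t + axis i s) - f (p + axis i s) - l * t * s) has_field_derivative
        pd i f (p + axis j t + axis i r) - pd i f (p + axis i r) - l * t) (at r within ball 0 d)"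
      by (rule has_field_derivative_at_within)
    show "norm (pd i f (p + axis j t + axis i r) - pd i f (p + axis i r) - l * t) \<le> e * norm t"
      using inner[OF r] by (simp add: add_ac)
  qed (use st d in auto)
  then show ?thesis by (simp add: algebra_simps)
qed

text \<open>Both mixed derivatives approximate the same second difference, divided by the square of the step.\<close>

lemma pd_commute:
  fixes f :: "'k::{real_normed_field, euclidean_space}^'n::finite \<Rightarrow> 'k"
  assumes U: "open U" "p \<in> U" and f: "smooth_on U f"
  shows "pd i (pd j f) p = pd j (pd i f) p"
proof -
  define l where "l = pd j (pd i f) p"
  define l' where "l' = pd i (pd j f) p"
  have near: "\<exists>d>0. \<forall>s t. norm s < d \<longrightarrow> norm t < d \<longrightarrow>
      p + axis i s + axis j t \<in> U \<and> norm (g (p + axis i s + axis j t) - g p) \<le> e"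
    if g: "continuous_on U g" and e: "e > 0" for e :: real and g :: "'k^'n \<Rightarrow> 'k"
  proof -
    obtain d1 where d1: "d1 > 0" "ball p d1 \<subseteq> U" using U open_contains_ball by blast
    obtain d2 where d2: "d2 > 0" "\<And>q. q \<in> U \<Longrightarrow> dist q p < d2 \<Longrightarrow> dist (g q) (g p) < e"
      using g e U(2) unfolding continuous_on_iff by blast
    have "p + axis i s + axis j t \<in> U \<and> norm (g (p + axis i s + axis j t) - g p) \<le> e"
      if "norm s < min d1 d2 / 2" "norm t < min d1 d2 / 2" for s t
    proof -
      have "norm (axis i s + axis j t :: 'k^'n) \<le> norm s + norm t"
        by (metis norm_axis norm_triangle_ineq)
      then have *: "dist (p + axis i s + axis j t) p < min d1 d2"
        using that by (simp add: dist_norm add.assoc)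
      then have "p + axis i s + axis j t \<in> U" using d1 by (auto simp: dist_commute)
      with * d2 show ?thesis by (force simp: dist_norm)
    qed
    then show ?thesis using d1 d2 by (intro exI[of _ "min d1 d2 / 2"]) auto
  qed
  have "norm (l - l') \<le> 2 * e" if e: "e > 0" for e
  proof -
    obtain d1 where d1: "d1 > 0" "\<And>s t. norm s < d1 \<Longrightarrow> norm t < d1 \<Longrightarrow>
        p + axis i s + axis j t \<in> U \<and> norm (pd j (pd i f) (p + axis i s + axis j t) - l) \<le> e"
      using near[OF smooth_on_imp_continuous_on e] f unfolding l_def by (meson smooth_on_pd)
    obtain d2 where d2: "d2 > 0" "\<And>s t. norm s < d2 \<Longrightarrow> norm t < d2 \<Longrightarrow>
        p + axis i s + axis j t \<in> U \<and> norm (pd i (pd j f) (p + axis i s + axis j t) - l') \<le> e"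
      using near[OF smooth_on_imp_continuous_on e] f unfolding l'_def by (meson smooth_on_pd)
    define d where "d = min d1 d2"
    define s :: 'k where "s = of_real (d / 2)"
    have d: "d > 0" "d \<le> d1" "d \<le> d2" using d1 d2 by (auto simp: d_def)
    have s: "norm s < d" "s \<noteq> 0" using d by (auto simp: s_def)
    define D where "D = f (p + axis i s + axis j s) - f (p + axis i s) - f (p + axis j s) + f p"
    have 1: "norm (D - l * s * s) \<le> e * norm s * norm s"
      unfolding D_def by (rule second_difference_bound[OF f, of d]) (use d1 d s in auto)
    have "norm (f (p + axis j s + axis i s) - f (p + axis j s) - f (p + axis i s) + f p - l' * s * s)
        \<le> e * norm s * norm s"
      by (rule second_difference_bound[OF f, of d]) (use d2 d s in \<open>auto simp: add_ac\<close>)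
    then have 2: "norm (D - l' * s * s) \<le> e * norm s * norm s"
      by (simp add: D_def algebra_simps)
    have "norm ((l - l') * (s * s)) = norm ((D - l' * s * s) - (D - l * s * s))"
      by (simp add: algebra_simps)
    also have "\<dots> \<le> 2 * e * (norm s * norm s)"
      using norm_triangle_ineq4[of "D - l' * s * s" "D - l * s * s"] 1 2 by (simp add: algebra_simps)
    finally have "norm (l - l') * (norm s * norm s) \<le> 2 * e * (norm s * norm s)"
      by (simp add: norm_mult)
    then show ?thesis using s by simp
  qed
  from this[of "norm (l - l') / 4"] have "norm (l - l') \<le> 0"
    by (cases "l = l'") auto
  then show ?thesis by (simp add: l_def l'_def)
qed

section \<open>Directional derivatives and Lie brackets\<close>

definition dd :: "'k::{real_normed_field, euclidean_space}^'n::finite \<Rightarrow> ('k^'n \<Rightarrow> 'k) \<Rightarrow> 'k^'n \<Rightarrow> 'k" where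
  "dd v f p = (\<Sum>j\<in>UNIV. v $ j * pd j f p)"

lemma dd_const [simp]: "dd v (\<lambda>q. a) p = 0"
  by (simp add: dd_def)

lemma dd_coord [simp]: "dd v (\<lambda>q. q $ i) p = v $ i"
  by (simp add: dd_def pd_coord if_distrib cong: if_cong)

lemma dd_add:
  "smooth_on U f \<Longrightarrow> smooth_on U g \<Longrightarrow> p \<in> U \<Longrightarrow> dd v (\<lambda>q. f q + g q) p = dd v f p + dd v g p"
  by (simp add: dd_def pd_add sum.distrib algebra_simps)

lemma dd_mult:
  "smooth_on U f \<Longrightarrow> smooth_on U g \<Longrightarrow> p \<in> U \<Longrightarrow>
     dd v (\<lambda>q. f q * g q) p = dd v f p * g p + f p * dd v g p"
  by (simp add: dd_def pd_mult sum.distrib sum_distrib_left sum_distrib_right algebra_simps)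

lemma dd_minus: "smooth_on U f \<Longrightarrow> p \<in> U \<Longrightarrow> dd v (\<lambda>q. - f q) p = - dd v f p"
  using dd_mult[of U "\<lambda>q. -1" f p v] by simp

lemma dd_diff:
  "open U \<Longrightarrow> smooth_on U f \<Longrightarrow> smooth_on U g \<Longrightarrow> p \<in> U \<Longrightarrow> dd v (\<lambda>q. f q - g q) p = dd v f p - dd v g p"
  using dd_add[of U f "\<lambda>q. - g q" p v] dd_minus[of U g p v] by simp

lemma dd_cong:
  "open U \<Longrightarrow> p \<in> U \<Longrightarrow> (\<And>q. q \<in> U \<Longrightarrow> f q = g q) \<Longrightarrow> dd v f p = dd v g p"
  unfolding dd_def using pd_cong[of U p f g] by simp

lemma dd_linear:
  "dd (v + w) f p = dd v f p + dd w f p" "dd (a *s v) f p = a * dd v f p"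
  by (simp_all add: dd_def sum.distrib sum_distrib_left algebra_simps)

lemma bracket_nth: "bracket V W p $ i = dd (V p) (\<lambda>q. W q $ i) p - dd (W p) (\<lambda>q. V q $ i) p"
  by (simp add: bracket_def dd_def pd_vec_def sum_subtractf)

lemma smooth_vec_on_subset: "smooth_vec_on U V \<Longrightarrow> N \<subseteq> U \<Longrightarrow> smooth_vec_on N V"
  unfolding smooth_vec_on_def using smooth_on_subset by blast

lemma section_on_subset: "section_on U D V \<Longrightarrow> N \<subseteq> U \<Longrightarrow> section_on N D V"
  unfolding section_on_def using smooth_vec_on_subset by blast

lemma dd_sum:
  assumes "open U" "p \<in> U" "\<And>i. i \<in> I \<Longrightarrow> smooth_on U (f i)"
  shows "smooth_on U (\<lambda>q. \<Sum>i\<in>I. f i q) \<and> dd v (\<lambda>q. \<Sum>i\<in>I. f i q) p = (\<Sum>i\<in>I. dd v (f i) p)"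
  using assms(3)
proof (induction I rule: infinite_finite_induct)
  case (insert i I)
  then show ?case using assms(1,2) by (simp add: dd_add[of U])
qed auto

text \<open>The bracket of two combinations of \<open>X\<close> and \<open>Y\<close> leaves their span only through \<open>[X, Y]\<close>, so for the derived
  distribution of a rank two distribution a single bracket matters.\<close>

lemma bracket_of_combinations:
  assumes N: "open N" "p \<in> N"
    and sm: "smooth_on N a" "smooth_on N b" "smooth_on N a'" "smooth_on N b'"
      "smooth_vec_on N X" "smooth_vec_on N Y"
    and V: "\<And>q. q \<in> N \<Longrightarrow> V q = a q *s X q + b q *s Y q"
    and W: "\<And>q. q \<in> N \<Longrightarrow> W q = a' q *s X q + b' q *s Y q"
  shows "bracket V W p = (dd (V p) a' p - dd (W p) a p) *s X p + (dd (V p) b' p - dd (W p) b p) *s Y p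
           + (a p * b' p - b p * a' p) *s bracket X Y p"
proof -
  have XY: "smooth_on N (\<lambda>q. X q $ i)" "smooth_on N (\<lambda>q. Y q $ i)" for i
    using sm unfolding smooth_vec_on_def by auto
  have 1: "dd v (\<lambda>q. W q $ i) p = dd v a' p * X p $ i + a' p * dd v (\<lambda>q. X q $ i) p
      + (dd v b' p * Y p $ i + b' p * dd v (\<lambda>q. Y q $ i) p)" for v i
  proof -
    have "dd v (\<lambda>q. W q $ i) p = dd v (\<lambda>q. a' q * X q $ i + b' q * Y q $ i) p"
      by (rule dd_cong[OF N]) (simp add: W)
    then show ?thesis using N sm XY by (simp add: dd_add[of N] dd_mult[of N])
  qed
  have 2: "dd v (\<lambda>q. V q $ i) p = dd v a p * X p $ i + a p * dd v (\<lambda>q. X q $ i) p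
      + (dd v b p * Y p $ i + b p * dd v (\<lambda>q. Y q $ i) p)" for v i
  proof -
    have "dd v (\<lambda>q. V q $ i) p = dd v (\<lambda>q. a q * X q $ i + b q * Y q $ i) p"
      by (rule dd_cong[OF N]) (simp add: V)
    then show ?thesis using N sm XY by (simp add: dd_add[of N] dd_mult[of N])
  qed
  have 3: "dd (V p) f p = a p * dd (X p) f p + b p * dd (Y p) f p"
    "dd (W p) f p = a' p * dd (X p) f p + b' p * dd (Y p) f p" for f
    by (simp_all add: V[OF N(2)] W[OF N(2)] dd_linear)
  show ?thesis
    unfolding vec_eq_iff bracket_nth 1 2 vector_add_component vector_smult_component
    by (simp add: 3 algebra_simps)
qed

text \<open>Differentiating \<open>\<theta>(V) = 0\<close> along \<open>W\<close> and \<open>\<theta>(W) = 0\<close> along \<open>V\<close> gives \<open>\<theta>([V, W]) = - d\<theta>(V, W)\<close>,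
  in which no derivative of \<open>V\<close> or \<open>W\<close> is left.\<close>

lemma annihilator_of_bracket:
  assumes N: "open N" "p \<in> N"
    and sm: "smooth_vec_on N \<theta>" "smooth_vec_on N V" "smooth_vec_on N W"
    and V: "\<And>q. q \<in> N \<Longrightarrow> (\<Sum>i\<in>UNIV. \<theta> q $ i * V q $ i) = 0"
    and W: "\<And>q. q \<in> N \<Longrightarrow> (\<Sum>i\<in>UNIV. \<theta> q $ i * W q $ i) = 0"
  shows "(\<Sum>i\<in>UNIV. \<theta> p $ i * bracket V W p $ i)
           = (\<Sum>i\<in>UNIV. dd (W p) (\<lambda>q. \<theta> q $ i) p * V p $ i - dd (V p) (\<lambda>q. \<theta> q $ i) p * W p $ i)"
proof -
  have *: "(\<Sum>i\<in>UNIV. \<theta> p $ i * dd w (\<lambda>q. Z q $ i) p) = - (\<Sum>i\<in>UNIV. dd w (\<lambda>q. \<theta> q $ i) p * Z p $ i)"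
    if Z: "smooth_vec_on N Z" "\<And>q. q \<in> N \<Longrightarrow> (\<Sum>i\<in>UNIV. \<theta> q $ i * Z q $ i) = 0" for Z w
  proof -
    have s: "smooth_on N (\<lambda>q. \<theta> q $ i)" "smooth_on N (\<lambda>q. Z q $ i)" for i
      using sm Z unfolding smooth_vec_on_def by auto
    have "dd w (\<lambda>q. \<Sum>i\<in>UNIV. \<theta> q $ i * Z q $ i) p = dd w (\<lambda>q. 0) p"
      by (rule dd_cong[OF N]) (rule Z(2))
    moreover have "dd w (\<lambda>q. \<Sum>i\<in>UNIV. \<theta> q $ i * Z q $ i) p
        = (\<Sum>i\<in>UNIV. dd w (\<lambda>q. \<theta> q $ i) p * Z p $ i + \<theta> p $ i * dd w (\<lambda>q. Z q $ i) p)"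
      using dd_sum[OF N, of UNIV "\<lambda>i q. \<theta> q $ i * Z q $ i"] s N by (simp add: dd_mult[of N])
    ultimately show ?thesis by (simp add: sum.distrib eq_neg_iff_add_eq_0 add.commute)
  qed
  show ?thesis
    using *[OF sm(2) V, of "W p"] *[OF sm(3) W, of "V p"]
    by (simp add: bracket_nth right_diff_distrib sum_subtractf)
qed

section \<open>Derived distributions and growth vectors\<close>

lemma derived_superset: "D p \<subseteq> derived D p"
  unfolding derived_def using vec.span_superset by blast

lemma subspace_derived: "vec.subspace (derived D p)"
  unfolding derived_def by (rule vec.subspace_span)

lemma bracket_in_derived:
  "open N \<Longrightarrow> p \<in> N \<Longrightarrow> section_on N D V \<Longrightarrow> section_on N D W \<Longrightarrow> bracket V W p \<in> derived D p"
  unfolding derived_def by (rule vec.span_base) blast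

lemma derived_least:
  assumes "vec.subspace S" "D p \<subseteq> S"
    "\<And>N V W. open N \<Longrightarrow> p \<in> N \<Longrightarrow> section_on N D V \<Longrightarrow> section_on N D W \<Longrightarrow> bracket V W p \<in> S"
  shows "derived D p \<subseteq> S"
  unfolding derived_def by (rule vec.span_minimal) (use assms in auto)

lemma derived_mono:
  assumes "open N" "p \<in> N" "\<And>q. q \<in> N \<Longrightarrow> D q \<subseteq> E q"
  shows "derived D p \<subseteq> derived E p"
proof (rule derived_least[of "derived E p", OF subspace_derived])
  show "D p \<subseteq> derived E p" using assms derived_superset by blast
  fix N' V W assume N': "open N'" "p \<in> N'" and VW: "section_on N' D V" "section_on N' D W"
  have "section_on (N' \<inter> N) E V" "section_on (N' \<inter> N) E W"
    using VW assms(3) smooth_vec_on_subset[of N' _ "N' \<inter> N"] unfolding section_on_def by blast+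
  then show "bracket V W p \<in> derived E p"
    using N' assms by (intro bracket_in_derived[of "N' \<inter> N"]) auto
qed

lemma derived_iterate_superset: "k \<le> l \<Longrightarrow> (derived ^^ k) D p \<subseteq> (derived ^^ l) D p"
proof (induction l rule: dec_induct)
  case (step l)
  then show ?case using derived_superset[of "(derived ^^ l) D" p] by auto
qed simp

text \<open>An integrable distribution that contains \<open>D\<close> bounds all its derived distributions, since forming the derived
  distribution is local and monotone.\<close>

lemma derived_iterate_subset_involutive:
  assumes "open N" "\<And>q. q \<in> N \<Longrightarrow> D q \<subseteq> E q" "\<And>q. q \<in> N \<Longrightarrow> derived E q \<subseteq> E q" "p \<in> N"
  shows "(derived ^^ k) D p \<subseteq> E p"
  using assms(4)
proof (induction k arbitrary: p)
  case (Suc k)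
  then have "derived ((derived ^^ k) D) p \<subseteq> derived E p"
    by (intro derived_mono[OF assms(1)]) auto
  with Suc show ?case using assms(3) by fastforce
qed (use assms in auto)

text \<open>Ranks are constant near a regular point, and every neighbourhood of it meets the dense set \<open>O'\<close>. So it suffices
  to know the ranks on an open dense set, which consists of regular points itself.\<close>

lemma has_growth_vectorI:
  assumes "g \<noteq> []" "sorted_wrt (<) g" "open O'" "O' \<subseteq> M" "M \<subseteq> closure O'"
    and dim: "\<And>p k. p \<in> O' \<Longrightarrow> vec.dim ((derived ^^ k) D p) = g ! min k (length g - 1)"
  shows "has_growth_vector M D g"
proof -
  have "O' \<subseteq> regular_points M D"
    unfolding regular_points_def using assms by (auto intro!: exI[of _ O'])
  then have "M \<subseteq> closure (regular_points M D)"
    by (rule order_trans[OF assms(5) closure_mono])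
  moreover have "vec.dim ((derived ^^ k) D p) = g ! min k (length g - 1)"
    if "p \<in> regular_points M D" for p k
  proof -
    have "p \<in> M" "\<exists>N. open N \<and> p \<in> N \<and> N \<subseteq> M \<and>
        (\<forall>k. \<forall>q\<in>N. vec.dim ((derived ^^ k) D q) = vec.dim ((derived ^^ k) D p))"
      using that unfolding regular_points_def mem_Collect_eq by (rule conjunct1, rule conjunct2)
    then obtain N where N: "open N" "p \<in> N" and
      dim_N: "\<forall>k. \<forall>q\<in>N. vec.dim ((derived ^^ k) D q) = vec.dim ((derived ^^ k) D p)"
      by (elim exE conjE)
    have "p \<in> N \<inter> closure O'" using assms(5) \<open>p \<in> M\<close> N by auto
    then obtain q where "q \<in> N" "q \<in> O'"
      using open_Int_closure_eq_empty[OF N(1), of O'] by auto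
    then show ?thesis using dim_N[rule_format, of q k] dim[of q k] by metis
  qed
  ultimately show ?thesis unfolding has_growth_vector_def using assms by blast
qed

lemma dim_span_list:
  fixes xs :: "('k::field^'n::finite) list"
  assumes "\<And>a. (\<Sum>i<length xs. a i *s xs ! i) = 0 \<Longrightarrow> \<forall>i<length xs. a i = 0"
  shows "vec.dim (vec.span (set xs)) = length xs"
proof -
  have inj: "inj_on ((!) xs) {..<length xs}"
  proof (rule inj_onI, rule ccontr)
    fix i j assume ij: "i \<in> {..<length xs}" "j \<in> {..<length xs}" "xs ! i = xs ! j" "i \<noteq> j"
    define a where "a = (\<lambda>k. if k = i then 1 else if k = j then -1 else (0::'k))"
    have "(\<Sum>k<length xs. a k *s xs ! k) = (\<Sum>k\<in>{i, j}. a k *s xs ! k)"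
      by (rule sum.mono_neutral_right) (use ij in \<open>auto simp: a_def\<close>)
    also have "\<dots> = 0" using ij by (simp add: a_def vec_eq_iff)
    finally have "a i = 0" using assms ij by auto
    then show False by (simp add: a_def)
  qed
  have set_xs: "set xs = (!) xs ` {..<length xs}" by (auto simp: in_set_conv_nth)
  have "vec.independent (set xs)"
  proof
    assume "vec.dependent (set xs)"
    then obtain u v where u: "v \<in> set xs" "u v \<noteq> 0" "(\<Sum>v\<in>set xs. u v *s v) = 0"
      unfolding vec.dependent_finite[OF finite_set] by blast
    have "(\<Sum>i<length xs. u (xs ! i) *s xs ! i) = 0"
      using u(3) unfolding set_xs sum.reindex[OF inj] by simp
    then show False using assms u by (metis in_set_conv_nth)
  qed
  moreover have "card (set xs) = length xs"
    unfolding set_xs card_image[OF inj] by simp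
  ultimately show ?thesis by (metis vec.dim_span vec.dim_eq_card_independent)
qed

lemma subspace_of_vec_subspace:
  fixes S :: "('k::{real_normed_field, euclidean_space}^'n::finite) set"
  assumes "vec.subspace S"
  shows "subspace S"
proof (rule subspaceI)
  fix c :: real and x assume "x \<in> S"
  then have "(of_real c :: 'k) *s x \<in> S" using assms by (simp add: vec.subspace_scale)
  moreover have "(of_real c :: 'k) *s x = c *\<^sub>R x" 
    unfolding vec_eq_iff vector_scaleR_component vector_smult_component
    unfolding scaleR_conv_of_real by simp
  ultimately show "c *\<^sub>R x \<in> S" by simp
qed (use assms vec.subspace_0 vec.subspace_add in auto)

text \<open>Subspaces of a finite-dimensional space are closed, hence contain the limits of difference quotients.\<close>

lemma derivative_in_subspace:
  fixes f :: "'k::{real_normed_field, euclidean_space} \<Rightarrow> 'k^'n::finite"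
  assumes S: "vec.subspace S" and f: "\<forall>\<^sub>F t in nhds 0. f t \<in> S"
    and d: "\<And>j. ((\<lambda>t. f t $ j) has_field_derivative d $ j) (at 0)"
  shows "d \<in> S"
proof (rule Lim_in_closed_set)
  show "closed S" using closed_subspace[OF subspace_of_vec_subspace[OF S]] .
  show "((\<lambda>t. (1 / t) *s (f t - f 0)) \<longlongrightarrow> d) (at 0)"
    by (rule vec_tendstoI) (use d in \<open>simp add: DERIV_def diff_divide_distrib\<close>)
  have "f 0 \<in> S" using f eventually_nhds_x_imp_x by blast
  then show "\<forall>\<^sub>F t in at 0. (1 / t) *s (f t - f 0) \<in> S"
    using f S by (auto simp: eventually_at_filter vec.subspace_diff vec.subspace_scale elim: eventually_mono)
qed simp

text \<open>For density arguments: the curve starts at a given point, and the parameters with values outside \<open>S\<close> are zeros of a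
  nonzero polynomial.\<close>

lemma curve_in_closure:
  fixes \<gamma> :: "'k::{real_normed_field, euclidean_space} \<Rightarrow> 'a::topological_space"
  assumes "continuous_on UNIV \<gamma>" "finite {t. \<gamma> t \<notin> S}"
  shows "\<gamma> 0 \<in> closure S"
proof -
  have "(\<gamma> \<longlongrightarrow> \<gamma> 0) (at 0)" using assms(1) by (simp add: continuous_on_def)
  moreover have "\<forall>\<^sub>F t in at 0. \<gamma> t \<in> closure S"
  proof -
    have "open (- ({t. \<gamma> t \<notin> S} - {0}))" using assms(2) by (intro open_Compl finite_imp_closed) auto
    then have "\<forall>\<^sub>F t in at 0. t \<in> - ({t. \<gamma> t \<notin> S} - {0})"
      by (intro eventually_at_in_open') auto
    moreover have "\<forall>\<^sub>F t in at 0. t \<noteq> (0::'k)" by (rule eventually_neq_at_within)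
    ultimately show ?thesis
      by eventually_elim (use closure_subset in auto)
  qed
  ultimately show ?thesis
    by (rule Lim_in_closed_set[OF closed_closure, rotated 2]) simp
qed

section \<open>Coordinates on the bundles\<close>

lemma exhaust_5: "x = 1 \<or> x = 2 \<or> x = 3 \<or> x = 4 \<or> x = 5" for x :: 5
proof (induct x)
  case (of_int z)
  then have "z = 0 \<or> z = 1 \<or> z = 2 \<or> z = 3 \<or> z = 4" by fastforce
  then show ?case by auto
qed

lemma exhaust_6: "x = 1 \<or> x = 2 \<or> x = 3 \<or> x = 4 \<or> x = 5 \<or> x = 6" for x :: 6
proof (induct x)
  case (of_int z)
  then have "z = 0 \<or> z = 1 \<or> z = 2 \<or> z = 3 \<or> z = 4 \<or> z = 5" by fastforce
  then show ?case by auto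
qed

lemma forall_5: "(\<forall>i::5. P i) \<longleftrightarrow> P 1 \<and> P 2 \<and> P 3 \<and> P 4 \<and> P 5"
  by (metis exhaust_5)

lemma forall_6: "(\<forall>i::6. P i) \<longleftrightarrow> P 1 \<and> P 2 \<and> P 3 \<and> P 4 \<and> P 5 \<and> P 6"
  by (metis exhaust_6)

lemma sum_5: "sum f (UNIV::5 set) = f 1 + f 2 + f 3 + f 4 + f 5"
proof -
  have *: "(UNIV::5 set) = {1, 2, 3, 4, 5}" using exhaust_5 by auto
  show ?thesis unfolding * by (simp add: add.assoc)
qed

lemma sum_6: "sum f (UNIV::6 set) = f 1 + f 2 + f 3 + f 4 + f 5 + f 6"
proof -
  have *: "(UNIV::6 set) = {1, 2, 3, 4, 5, 6}" using exhaust_6 by auto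
  show ?thesis unfolding * by (simp add: add.assoc)
qed

lemma vector_4 [simp]:
  "(vector [a1, a2, a3, a4] :: 'a::zero^4) $ 1 = a1" "(vector [a1, a2, a3, a4] :: 'a::zero^4) $ 2 = a2"
  "(vector [a1, a2, a3, a4] :: 'a::zero^4) $ 3 = a3" "(vector [a1, a2, a3, a4] :: 'a::zero^4) $ 4 = a4"
  unfolding vector_def by simp_all

lemma vector_5 [simp]:
  "(vector [a1, a2, a3, a4, a5] :: 'a::zero^5) $ 1 = a1" "(vector [a1, a2, a3, a4, a5] :: 'a::zero^5) $ 2 = a2"
  "(vector [a1, a2, a3, a4, a5] :: 'a::zero^5) $ 3 = a3" "(vector [a1, a2, a3, a4, a5] :: 'a::zero^5) $ 4 = a4"
  "(vector [a1, a2, a3, a4, a5] :: 'a::zero^5) $ 5 = a5"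
  unfolding vector_def by simp_all

lemma vector_6 [simp]:
  "(vector [a1, a2, a3, a4, a5, a6] :: 'a::zero^6) $ 1 = a1" "(vector [a1, a2, a3, a4, a5, a6] :: 'a::zero^6) $ 2 = a2"
  "(vector [a1, a2, a3, a4, a5, a6] :: 'a::zero^6) $ 3 = a3" "(vector [a1, a2, a3, a4, a5, a6] :: 'a::zero^6) $ 4 = a4"
  "(vector [a1, a2, a3, a4, a5, a6] :: 'a::zero^6) $ 5 = a5" "(vector [a1, a2, a3, a4, a5, a6] :: 'a::zero^6) $ 6 = a6"
  unfolding vector_def by simp_all

definition base5 :: "'k::{real_normed_field, euclidean_space}^5 \<Rightarrow> 'k^2" where
  "base5 m = vector [m$1, m$2]"

text \<open>The total space of the bundle \<open>B\<close> over \<open>U\<close>, with the zero section, where the distribution is still defined. It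
  contains \<open>M5 U s0\<close> for every \<open>s0\<close>.\<close>

definition B5 :: "('k::{real_normed_field, euclidean_space}^2) set \<Rightarrow> ('k^5) set" where
  "B5 U = base5 -` U"

lemma base_level_incl [simp]: "base (level_incl s m) = base5 m"
  by (simp add: base_def base5_def level_incl_def)

lemma base5_forget_s [simp]: "base5 (forget_s v) = base v"
  by (simp add: base_def base5_def forget_s_def)

lemma forget_s_level_incl [simp]: "forget_s (level_incl s m) = m"
  by (simp add: forget_s_def level_incl_def vec_eq_iff forall_5)

lemma base5_axis:
  "base5 (p + axis 1 t) = base5 p + axis 1 t" "base5 (p + axis 2 t) = base5 p + axis 2 t"
  "base5 (p + axis 3 t) = base5 p" "base5 (p + axis 4 t) = base5 p" "base5 (p + axis 5 t) = base5 p"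
  by (simp_all add: base5_def vec_eq_iff forall_2 axis_def)

lemma continuous_on_vector_2:
  fixes f :: "'a::topological_space \<Rightarrow> 'b::{topological_space, zero}"
  assumes "continuous_on S f" "continuous_on S g"
  shows "continuous_on S (\<lambda>x. vector [f x, g x] :: 'b^2)"
proof -
  have "continuous_on S (\<lambda>x. \<chi> i::2. (vector [f x, g x] :: 'b^2) $ i)"
  proof (rule continuous_on_vec_lambda)
    fix i :: 2
    show "continuous_on S (\<lambda>x. (vector [f x, g x] :: 'b^2) $ i)"
      using assms exhaust_2[of i] by auto
  qed
  then show ?thesis by simp
qed

lemma coordinate_map_base5: "coordinate_map base5"
  unfolding coordinate_map_def forall_5 base5_axis
  by (auto simp: base5_def intro!: continuous_intros continuous_on_vector_2)

lemma continuous_on_base5 [continuous_intros]: "continuous_on S base5"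
  using coordinate_map_base5 unfolding coordinate_map_def by (metis continuous_on_subset subset_UNIV)

lemma open_B5: "open U \<Longrightarrow> open (B5 U)"
  unfolding B5_def by (intro open_vimage continuous_intros)

lemma smooth_on_base5: "smooth_on U f \<Longrightarrow> smooth_on (B5 U) (\<lambda>m. f (base5 m))"
  unfolding B5_def by (rule smooth_on_compose_coordinate_map[OF coordinate_map_base5])

lemma dd_base5: "dd v (\<lambda>m. f (base5 m)) m = v $ 1 * pd 1 f (base5 m) + v $ 2 * pd 2 f (base5 m)"
  unfolding dd_def sum_5 by (simp add: pd_def base5_axis)

lemma span_2: "vec.span {v, w} = range (\<lambda>(k, l). k *s v + l *s w)"
  unfolding vec.span_insert by (auto simp: algebra_simps)

lemma forget_s_combination: "forget_s (k *s v + l *s w) = k *s forget_s v + l *s forget_s w"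
  by (simp add: forget_s_def vec_eq_iff forall_5)

lemma forget_s_span: "forget_s ` vec.span {v, w} = vec.span {forget_s v, forget_s w}"
  unfolding span_2 by (simp add: image_image case_prod_unfold forget_s_combination)

section \<open>The rank two distribution\<close>

locale smooth_system =
  fixes U :: "('k::{real_normed_field, euclidean_space}^2) set" and b c \<mu> \<nu> :: "'k^2 \<Rightarrow> 'k" and s0 :: 'k
  assumes open_U: "open U"
    and smooth_coefficients: "smooth_on U b" "smooth_on U c" "smooth_on U \<mu>" "smooth_on U \<nu>"
begin

abbreviation D where "D \<equiv> bar_dist b c \<mu> \<nu> s0"

abbreviation R where "R i j n \<equiv> curv b c \<mu> \<nu> n $ i $ j"

lemma curv_entries:
  "R 1 1 n = 0" "R 1 2 n = 0" "R 1 3 n = 0"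
  "R 2 1 n = - pd 2 \<mu> n - b n * \<nu> n" "R 2 2 n = - (b n * c n)" "R 2 3 n = - pd 2 b n - \<mu> n"
  "R 3 1 n = pd 1 \<nu> n + c n * \<mu> n" "R 3 2 n = pd 1 c n + \<nu> n" "R 3 3 n = b n * c n"
  by (simp_all add: curv_def pd_mat_def pd_vec_def conn_def commutator_def matrix_matrix_mult_def sum_3)

lemma smooth_curv: "smooth_on U (\<lambda>n. R i j n)"
proof -
  have "\<forall>i j. smooth_on U (\<lambda>n. R i j n)"
    unfolding forall_3 curv_entries using open_U smooth_coefficients by auto
  then show ?thesis by blast
qed

definition X where "X m = (vector [1, 0, m$4, b (base5 m) * m$5 + \<mu> (base5 m) * m$3, s0] :: 'k^5)"
definition Y where "Y m = (vector [0, 1, m$5, s0, c (base5 m) * m$4 + \<nu> (base5 m) * m$3] :: 'k^5)"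

text \<open>\<open>T\<close> is the vertical field with value \<open>R w\<close> at \<open>w = (z, p, q)\<close>; \<open>tp\<close> and \<open>tq\<close> are the components of
  \<open>R w\<close> along \<open>\<partial>\<^sub>p\<close> and \<open>\<partial>\<^sub>q\<close>.\<close>

definition tp where "tp m = R 2 1 (base5 m) * m$3 + R 2 2 (base5 m) * m$4 + R 2 3 (base5 m) * m$5"
definition tq where "tq m = R 3 1 (base5 m) * m$3 + R 3 2 (base5 m) * m$4 + R 3 3 (base5 m) * m$5"
definition T where "T m = (vector [0, 0, 0, tp m, tq m] :: 'k^5)"

lemma XYT_nth [simp]:
  "X m $ 1 = 1" "X m $ 2 = 0" "X m $ 3 = m$4" "X m $ 4 = b (base5 m) * m$5 + \<mu> (base5 m) * m$3" "X m $ 5 = s0"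
  "Y m $ 1 = 0" "Y m $ 2 = 1" "Y m $ 3 = m$5" "Y m $ 4 = s0" "Y m $ 5 = c (base5 m) * m$4 + \<nu> (base5 m) * m$3"
  "T m $ 1 = 0" "T m $ 2 = 0" "T m $ 3 = 0" "T m $ 4 = tp m" "T m $ 5 = tq m"
  by (simp_all add: X_def Y_def T_def)

lemma open_total: "open (B5 U)"
  by (rule open_B5[OF open_U])

lemmas smooth_pulled_back =
  open_total smooth_coefficients[THEN smooth_on_base5] smooth_curv[THEN smooth_on_base5]

lemma smooth_tp: "smooth_on (B5 U) tp" and smooth_tq: "smooth_on (B5 U) tq"
  unfolding tp_def[abs_def] tq_def[abs_def] by (intro smooth_on_add smooth_on_mult smooth_on_coord smooth_pulled_back)+

lemma smooth_fields: "smooth_vec_on (B5 U) X" "smooth_vec_on (B5 U) Y" "smooth_vec_on (B5 U) T"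
  unfolding smooth_vec_on_def forall_5 XYT_nth
  by (intro conjI smooth_on_add smooth_on_mult smooth_on_coord smooth_on_const smooth_tp smooth_tq
      smooth_pulled_back)+

lemma bar_dist_eq: "D m = vec.span {X m, Y m}"
proof -
  have "forget_s (X_field b \<mu> s0 (level_incl s0 m)) = X m" "forget_s (Y_field c \<nu> s0 (level_incl s0 m)) = Y m"
    by (simp_all add: X_field_def Y_field_def forget_s_def vec_eq_iff forall_5, simp_all add: level_incl_def)
  then show ?thesis
    unfolding bar_dist_def forget_s_span by simp
qed

lemma bar_dist_sectionE:
  assumes "section_on N D V" "q \<in> N"
  shows "V q = V q $ 1 *s X q + V q $ 2 *s Y q"
proof -
  have "V q \<in> vec.span {X q, Y q}" using assms unfolding section_on_def bar_dist_eq by blast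
  then obtain k l where kl: "V q = k *s X q + l *s Y q"
    unfolding span_2 by auto
  then have "V q $ 1 = k" "V q $ 2 = l" by simp_all
  with kl show ?thesis by simp
qed

text \<open>Both \<open>X(Y\<^sub>z)\<close> and \<open>Y(X\<^sub>z)\<close> are \<open>s\<^sub>0\<close>, and in the other components \<open>s\<^sub>0\<close> does not occur: the bracket is independent of \<open>s\<^sub>0\<close>.\<close>

lemma bracket_XY: assumes "m \<in> B5 U" shows "bracket X Y m = T m"
  unfolding vec_eq_iff forall_5 bracket_nth XYT_nth
  using assms smooth_pulled_back
  by (simp add: dd_add[of "B5 U"] dd_mult[of "B5 U"] dd_base5 tp_def tq_def curv_entries algebra_simps)

lemma derived_bar_dist:
  assumes m: "m \<in> B5 U"
  shows "derived D m = vec.span {X m, Y m, T m}"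
proof
  show "derived D m \<subseteq> vec.span {X m, Y m, T m}"
  proof (rule derived_least[OF vec.subspace_span])
    show "D m \<subseteq> vec.span {X m, Y m, T m}" unfolding bar_dist_eq by (rule vec.span_mono) auto
    fix N V W assume N: "open N" "m \<in> N" and VW: "section_on N D V" "section_on N D W"
    have sm: "smooth_on (N \<inter> B5 U) (\<lambda>q. V q $ i)" "smooth_on (N \<inter> B5 U) (\<lambda>q. W q $ i)" for i
      using VW unfolding section_on_def smooth_vec_on_def by (auto intro: smooth_on_subset)
    have "bracket V W m = (dd (V m) (\<lambda>q. W q $ 1) m - dd (W m) (\<lambda>q. V q $ 1) m) *s X m
        + (dd (V m) (\<lambda>q. W q $ 2) m - dd (W m) (\<lambda>q. V q $ 2) m) *s Y m
        + (V m $ 1 * W m $ 2 - V m $ 2 * W m $ 1) *s bracket X Y m"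
      by (rule bracket_of_combinations[where N = "N \<inter> B5 U"])
         (use N m sm open_total smooth_fields smooth_vec_on_subset bar_dist_sectionE VW in blast)+
    then show "bracket V W m \<in> vec.span {X m, Y m, T m}"
      unfolding bracket_XY[OF m]
      by (metis insertCI vec.span_add vec.span_base vec.span_scale)
  qed
  have "section_on (B5 U) D X" "section_on (B5 U) D Y"
    using smooth_fields unfolding section_on_def bar_dist_eq by (auto intro: vec.span_base)
  then have "T m \<in> derived D m"
    using bracket_in_derived[OF open_total m] bracket_XY[OF m] by metis
  moreover have "X m \<in> derived D m" "Y m \<in> derived D m"
    using derived_superset[of D m] unfolding bar_dist_eq by (auto intro: vec.span_base)
  ultimately show "vec.span {X m, Y m, T m} \<subseteq> derived D m"
    by (intro vec.span_minimal subspace_derived) auto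
qed

lemma dim_bar_dist: "vec.dim (D m) = 2"
proof -
  have "vec.dim (vec.span (set [X m, Y m])) = length [X m, Y m]"
    by (rule dim_span_list) (auto simp: vec_eq_iff forall_5 lessThan_Suc less_Suc_eq)
  then show ?thesis by (simp add: bar_dist_eq)
qed

lemma dim_derived_bar_dist:
  assumes "m \<in> B5 U" "T m \<noteq> 0"
  shows "vec.dim (derived D m) = 3"
proof -
  have "tp m \<noteq> 0 \<or> tq m \<noteq> 0" using assms(2) by (auto simp: vec_eq_iff forall_5)
  then have "vec.dim (vec.span (set [X m, Y m, T m])) = length [X m, Y m, T m]"
    by (intro dim_span_list) (auto simp: vec_eq_iff forall_5 lessThan_Suc less_Suc_eq)
  then show ?thesis using derived_bar_dist[OF assms(1)] by simp
qed

lemma bracket_XT: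
  assumes "m \<in> B5 U"
  shows "bracket X T m = vector [0, 0, - tp m, dd (X m) tp m - b (base5 m) * tq m, dd (X m) tq m]"
  unfolding vec_eq_iff forall_5 bracket_nth XYT_nth
  using assms smooth_pulled_back
  by (simp add: dd_add[of "B5 U"] dd_mult[of "B5 U"] dd_base5)

lemma bracket_YT:
  assumes "m \<in> B5 U"
  shows "bracket Y T m = vector [0, 0, - tq m, dd (Y m) tp m, dd (Y m) tq m - c (base5 m) * tp m]"
  unfolding vec_eq_iff forall_5 bracket_nth XYT_nth
  using assms smooth_pulled_back
  by (simp add: dd_add[of "B5 U"] dd_mult[of "B5 U"] dd_base5)

lemma second_derived_contains:
  assumes m: "m \<in> B5 U"
  shows "{X m, Y m, T m, bracket X T m, bracket Y T m} \<subseteq> derived (derived D) m"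
proof -
  have "section_on (B5 U) (derived D) V" if "V \<in> {X, Y, T}" for V
    using that smooth_fields derived_bar_dist unfolding section_on_def by (auto intro: vec.span_base)
  then have "bracket X T m \<in> derived (derived D) m" "bracket Y T m \<in> derived (derived D) m"
    using bracket_in_derived[OF open_total m] by auto
  moreover have "{X m, Y m, T m} \<subseteq> derived D m"
    unfolding derived_bar_dist[OF m] by (rule vec.span_superset)
  then have "{X m, Y m, T m} \<subseteq> derived (derived D) m"
    by (rule order_trans[OF _ derived_superset])
  ultimately show ?thesis by auto
qed

text \<open>The \<open>z\<close>-components of \<open>[X, T]\<close> and \<open>[Y, T]\<close> are \<open>- tp\<close> and \<open>- tq\<close>, while \<open>T\<close> has none. So one of the two brackets is
  new as soon as \<open>T\<close> is not zero.\<close>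

lemma dim_second_derived_ge_4:
  assumes m: "m \<in> B5 U" and T: "T m \<noteq> 0"
  shows "4 \<le> vec.dim (derived (derived D) m)"
proof -
  have T': "tp m \<noteq> 0 \<or> tq m \<noteq> 0" using T by (auto simp: vec_eq_iff forall_5)
  define S where "S = (if tp m \<noteq> 0 then bracket X T m else bracket Y T m)"
  have S: "S $ 1 = 0" "S $ 2 = 0" "S $ 3 \<noteq> 0"
    using T' unfolding S_def bracket_XT[OF m] bracket_YT[OF m] by auto
  have "vec.dim (vec.span (set [X m, Y m, T m, S])) = length [X m, Y m, T m, S]"
    by (rule dim_span_list) (use S T' in \<open>auto simp: vec_eq_iff forall_5 lessThan_Suc less_Suc_eq\<close>)
  moreover have "vec.span (set [X m, Y m, T m, S]) \<subseteq> derived (derived D) m"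
    by (rule vec.span_minimal[OF _ subspace_derived])
       (use second_derived_contains[OF m] in \<open>auto simp: S_def\<close>)
  ultimately show ?thesis
    using vec.dim_subset[of "vec.span (set [X m, Y m, T m, S])" "derived (derived D) m"] by simp
qed

text \<open>The determinant of the vertical parts of \<open>T\<close>, \<open>[X, T]\<close> and \<open>[Y, T]\<close>.\<close>

definition bracket_det where
  "bracket_det m = (tp m)\<^sup>2 * (dd (Y m) tq m - c (base5 m) * tp m)
     - tp m * tq m * (dd (Y m) tp m + dd (X m) tq m) + (tq m)\<^sup>2 * (dd (X m) tp m - b (base5 m) * tq m)"

lemma dim_second_derived_5:
  assumes m: "m \<in> B5 U" and det: "bracket_det m \<noteq> 0"
  shows "vec.dim (derived (derived D) m) = 5"
proof -
  let ?L = "[X m, Y m, T m, bracket X T m, bracket Y T m]"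
  \<comment> \<open>Cramer's rule for the matrix with columns the vertical parts of \<open>T\<close>, \<open>[X, T]\<close> and \<open>[Y, T]\<close>.\<close>
  have indep: "x = 0 \<and> y = 0 \<and> z = 0"
    if "tp m * y + tq m * z = 0" "x * tp m + y * (dd (X m) tp m - b (base5 m) * tq m) + z * dd (Y m) tp m = 0"
      "x * tq m + y * dd (X m) tq m + z * (dd (Y m) tq m - c (base5 m) * tp m) = 0" for x y z
  proof -
    have "bracket_det m * x = 0" "bracket_det m * y = 0" "bracket_det m * z = 0"
      using that unfolding bracket_det_def by algebra+
    then show ?thesis using det by simp
  qed
  have "vec.dim (vec.span (set ?L)) = length ?L"
  proof (rule dim_span_list)
    fix a assume *: "(\<Sum>i<length ?L. a i *s ?L ! i) = 0"
    have "a 0 *s X m + a 1 *s Y m + a 2 *s T m + a 3 *s bracket X T m + a 4 *s bracket Y T m = 0"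
      using * by (simp add: lessThan_Suc eval_nat_numeral add_ac)
    then have comp: "a 0 * X m $ i + a 1 * Y m $ i + a 2 * T m $ i + a 3 * bracket X T m $ i
        + a 4 * bracket Y T m $ i = 0" for i
      unfolding vec_eq_iff by simp
    have a: "a 0 = 0" "a 1 = 0"
      using comp[of 1] comp[of 2] by (simp_all add: bracket_XT[OF m] bracket_YT[OF m])
    have "a 2 = 0 \<and> a 3 = 0 \<and> a 4 = 0"
    proof (rule indep)
      show "tp m * a 3 + tq m * a 4 = 0"
        using comp[of 3] a by (simp add: bracket_XT[OF m] bracket_YT[OF m]) algebra
    qed (use comp[of 4] comp[of 5] a in \<open>simp_all add: bracket_XT[OF m] bracket_YT[OF m]\<close>)
    then show "\<forall>i<length ?L. a i = 0" using a by (auto simp: less_Suc_eq eval_nat_numeral)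
  qed
  moreover have "vec.span (set ?L) \<subseteq> derived (derived D) m"
    by (rule vec.span_minimal[OF _ subspace_derived]) (use second_derived_contains[OF m] in auto)
  ultimately have "5 \<le> vec.dim (derived (derived D) m)"
    using vec.dim_subset[of "vec.span (set ?L)" "derived (derived D) m"] by simp
  moreover have "vec.dim (derived (derived D) m) \<le> 5"
    using dim_subset_UNIV_cart_gen[of "derived (derived D) m"] by simp
  ultimately show ?thesis by simp
qed

lemma T_nonzero_if_bracket_det: "bracket_det m \<noteq> 0 \<Longrightarrow> T m \<noteq> 0"
  by (auto simp: bracket_det_def vec_eq_iff forall_5)

lemma dims_2_3_5:
  assumes m: "m \<in> B5 U" and det: "bracket_det m \<noteq> 0"
  shows "vec.dim ((derived ^^ k) D m) = [2, 3, 5] ! min k 2"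
proof -
  consider "k = 0" | "k = 1" | "2 \<le> k" by linarith
  then show ?thesis
  proof cases
    case 3
    then have "vec.dim ((derived ^^ 2) D m) \<le> vec.dim ((derived ^^ k) D m)"
      by (intro vec.dim_subset derived_iterate_superset)
    moreover have "vec.dim ((derived ^^ k) D m) \<le> 5"
      using dim_subset_UNIV_cart_gen[of "(derived ^^ k) D m"] by simp
    ultimately show ?thesis using 3 dim_second_derived_5[OF assms] by (simp add: eval_nat_numeral)
  qed (use assms dim_bar_dist dim_derived_bar_dist T_nonzero_if_bracket_det in auto)
qed

end

section \<open>Pulling distributions back along the projection that forgets s\<close>

definition pull :: "('k::{real_normed_field, euclidean_space}^5 \<Rightarrow> ('k^5) set) \<Rightarrow> 'k^6 \<Rightarrow> ('k^6) set" where
  "pull D v = {x. forget_s x \<in> D (forget_s v)}"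

lemma forget_s_nth [simp]:
  "forget_s v $ 1 = v $ 1" "forget_s v $ 2 = v $ 2" "forget_s v $ 3 = v $ 3" "forget_s v $ 4 = v $ 4"
  "forget_s v $ 5 = v $ 5"
  by (simp_all add: forget_s_def)

lemma level_incl_nth [simp]:
  "level_incl s m $ 1 = m $ 1" "level_incl s m $ 2 = m $ 2" "level_incl s m $ 3 = m $ 3"
  "level_incl s m $ 4 = m $ 4" "level_incl s m $ 5 = m $ 5" "level_incl s m $ 6 = s"
  by (simp_all add: level_incl_def)

lemma level_incl_forget_s: "level_incl (v $ 6) (forget_s v) = v"
  by (simp add: vec_eq_iff forall_6)

lemma forget_s_axis:
  "forget_s (v + axis 1 t) = forget_s v + axis 1 t" "forget_s (v + axis 2 t) = forget_s v + axis 2 t"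
  "forget_s (v + axis 3 t) = forget_s v + axis 3 t" "forget_s (v + axis 4 t) = forget_s v + axis 4 t"
  "forget_s (v + axis 5 t) = forget_s v + axis 5 t" "forget_s (v + axis 6 t) = forget_s v"
  by (simp_all add: vec_eq_iff forall_5 axis_def)

lemma level_incl_axis:
  "level_incl s (m + axis 1 t) = level_incl s m + axis 1 t" "level_incl s (m + axis 2 t) = level_incl s m + axis 2 t"
  "level_incl s (m + axis 3 t) = level_incl s m + axis 3 t" "level_incl s (m + axis 4 t) = level_incl s m + axis 4 t"
  "level_incl s (m + axis 5 t) = level_incl s m + axis 5 t"
  by (simp_all add: vec_eq_iff forall_6 axis_def)

lemma continuous_on_forget_s: "continuous_on S forget_s"
proof -
  have "continuous_on S (\<lambda>v. \<chi> i. forget_s v $ i)"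
  proof (rule continuous_on_vec_lambda)
    fix i :: 5
    show "continuous_on S (\<lambda>v. forget_s v $ i)"
      using exhaust_5[of i] by (elim disjE; simp; intro continuous_intros)
  qed
  then show ?thesis by simp
qed

lemma continuous_on_level_incl: "continuous_on S (level_incl s)"
proof -
  have "continuous_on S (\<lambda>m. \<chi> i. level_incl s m $ i)"
  proof (rule continuous_on_vec_lambda)
    fix i :: 6
    show "continuous_on S (\<lambda>m. level_incl s m $ i)"
      using exhaust_6[of i] by (elim disjE; simp; intro continuous_intros)
  qed
  then show ?thesis by simp
qed

lemma coordinate_map_forget_s: "coordinate_map forget_s"
  unfolding coordinate_map_def forall_6 forget_s_axis by (auto intro: continuous_on_forget_s)

lemma coordinate_map_level_incl: "coordinate_map (level_incl s)"
  unfolding coordinate_map_def forall_5 level_incl_axis by (auto intro: continuous_on_level_incl)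

lemma dd_forget_s: "dd x (\<lambda>v. f (forget_s v)) v = dd (forget_s x) f (forget_s v)"
  unfolding dd_def sum_5 sum_6 by (simp add: pd_def forget_s_axis)

lemma dd_level_incl: "dd x f v = dd (forget_s x) (\<lambda>m. f (level_incl (v $ 6) m)) (forget_s v) + x $ 6 * pd 6 f v"
  unfolding dd_def sum_5 sum_6 by (simp add: pd_def level_incl_axis level_incl_forget_s)

text \<open>Along \<open>s\<close> the projected values of a section move within the fixed subspace \<open>D (forget_s v)\<close>.\<close>

lemma pd_6_section_of_pull:
  assumes D: "vec.subspace (D (forget_s v))" and N: "open N" "v \<in> N" and V: "section_on N (pull D) V"
  shows "forget_s (pd_vec 6 V v) \<in> D (forget_s v)"
proof (rule derivative_in_subspace[OF D])
  show "\<forall>\<^sub>F t in nhds 0. forget_s (V (v + axis 6 t)) \<in> D (forget_s v)"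
  proof (rule eventually_mono[OF eventually_line_in[OF N]])
    fix t assume "v + axis 6 t \<in> N"
    then show "forget_s (V (v + axis 6 t)) \<in> D (forget_s v)"
      using V unfolding section_on_def pull_def by (auto simp: forget_s_axis)
  qed
  have sm: "smooth_on N (\<lambda>q. V q $ i)" for i using V unfolding section_on_def smooth_vec_on_def by blast
  have "\<forall>j::5. ((\<lambda>t. forget_s (V (v + axis 6 t)) $ j) has_field_derivative forget_s (pd_vec 6 V v) $ j) (at 0)"
    unfolding forall_5 forget_s_nth pd_vec_def using smooth_on_has_pd[OF sm N(2)] by simp
  then show "((\<lambda>t. forget_s (V (v + axis 6 t)) $ j) has_field_derivative forget_s (pd_vec 6 V v) $ j) (at 0)" for j
    by blast
qed

lemma subspace_pull: "vec.subspace (D (forget_s v)) \<Longrightarrow> vec.subspace (pull D v)"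
proof (rule vec.subspaceI)
  assume D: "vec.subspace (D (forget_s v))"
  have 0: "forget_s (0 :: 'a^6) = 0" by (simp add: vec_eq_iff forall_5)
  show "0 \<in> pull D v" unfolding pull_def mem_Collect_eq 0 by (rule vec.subspace_0[OF D])
  fix x y assume "x \<in> pull D v" "y \<in> pull D v"
  then show "x + y \<in> pull D v"
    using vec.subspace_add[OF D] forget_s_combination[of 1 x 1 y] by (simp add: pull_def)
next
  fix k x assume D: "vec.subspace (D (forget_s v))" and "x \<in> pull D v"
  then show "k *s x \<in> pull D v"
    using vec.subspace_scale[OF D] forget_s_combination[of k x 0 0] by (simp add: pull_def)
qed

text \<open>The bracket of two sections of \<open>pull D\<close> projects to the bracket of their restrictions to the
  level set of \<open>s\<close>, up to derivatives along \<open>s\<close>. The latter stay in \<open>D\<close>, which is constant along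
  the fibres of the projection. Hence nothing new arises upstairs.\<close>

lemma derived_pull:
  assumes D: "\<And>m. vec.subspace (D m)"
  shows "derived (pull D) = pull (derived D)"
proof (intro ext equalityI)
  fix v :: "'a^6"
  have "D (forget_s v) \<subseteq> derived D (forget_s v)" by (rule derived_superset)
  note D' = subsetD[OF this]
  show "derived (pull D) v \<subseteq> pull (derived D) v"
  proof (rule derived_least[OF subspace_pull[OF subspace_derived]])
    show "pull D v \<subseteq> pull (derived D) v" using D' by (auto simp: pull_def)
    fix N V W assume N: "open N" "v \<in> N" and VW: "section_on N (pull D) V" "section_on N (pull D) W"
    define s where "s = v $ 6"
    have v: "level_incl s (forget_s v) = v" by (simp add: s_def level_incl_forget_s)
    have sec: "section_on (level_incl s -` N) D (\<lambda>m. forget_s (Z (level_incl s m)))"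
      if Z: "section_on N (pull D) Z" for Z
    proof -
      have Z_smooth: "smooth_on N (\<lambda>q. Z q $ i)" for i
        using Z unfolding section_on_def smooth_vec_on_def by blast
      have "\<forall>i::5. smooth_on (level_incl s -` N) (\<lambda>m. forget_s (Z (level_incl s m)) $ i)"
        unfolding forall_5 forget_s_nth using smooth_on_compose_coordinate_map[OF coordinate_map_level_incl Z_smooth] by simp
      then show ?thesis using Z unfolding section_on_def smooth_vec_on_def pull_def by auto
    qed
    let ?B = "bracket (\<lambda>m. forget_s (V (level_incl s m))) (\<lambda>m. forget_s (W (level_incl s m))) (forget_s v)"
    have "?B \<in> derived D (forget_s v)"
      by (rule bracket_in_derived[OF _ _ sec[OF VW(1)] sec[OF VW(2)]])
         (use N v in \<open>auto intro: open_vimage continuous_on_level_incl\<close>)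
    moreover have "forget_s (bracket V W v) = (?B + V v $ 6 *s forget_s (pd_vec 6 W v)) - W v $ 6 *s forget_s (pd_vec 6 V v)"
      unfolding vec_eq_iff forall_5 forget_s_nth vector_add_component vector_minus_component
        vector_smult_component bracket_nth v
      by (simp add: dd_level_incl[of _ _ v] s_def pd_vec_def)
    ultimately show "bracket V W v \<in> pull (derived D) v"
      using D' pd_6_section_of_pull[OF D N VW(1)] pd_6_section_of_pull[OF D N VW(2)]
        subspace_derived[of D "forget_s v"]
      by (simp add: pull_def vec.subspace_add vec.subspace_diff vec.subspace_scale)
  qed
  \<comment> \<open>Conversely, sections of \<open>D\<close> lift to sections that are constant in \<open>s\<close> and have no \<open>s\<close>-component.\<close>
  have lift: "level_incl 0 x \<in> derived (pull D) v" if x: "x \<in> derived D (forget_s v)" for x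
  proof -
    have "derived D (forget_s v) \<subseteq> {x. level_incl 0 x \<in> derived (pull D) v}"
    proof (rule derived_least)
      have "level_incl 0 (k *s x + l *s y) = k *s level_incl 0 x + l *s level_incl 0 y" for k l and x y :: "'a^5"
        by (simp add: vec_eq_iff forall_6)
      note lin = this this[of 1 _ 1] this[of _ _ 0 0] this[of 0 0 0 0]
      show "vec.subspace {x. level_incl 0 x \<in> derived (pull D) v}"
        using lin subspace_derived[of "pull D" v]
        by (intro vec.subspaceI) (auto simp: vec.subspace_0 vec.subspace_add vec.subspace_scale)
      show "D (forget_s v) \<subseteq> {x. level_incl 0 x \<in> derived (pull D) v}"
        using derived_superset[of "pull D" v] by (auto simp: pull_def)
      fix N V W assume N: "open N" "forget_s v \<in> N" and VW: "section_on N D V" "section_on N D W"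
      have sec: "section_on (forget_s -` N) (pull D) (\<lambda>v. level_incl 0 (Z (forget_s v)))"
        if Z: "section_on N D Z" for Z
      proof -
        have Z_smooth: "smooth_on N (\<lambda>q. Z q $ i)" for i
          using Z unfolding section_on_def smooth_vec_on_def by blast
        have "\<forall>i::6. smooth_on (forget_s -` N) (\<lambda>v. level_incl 0 (Z (forget_s v)) $ i)"
          unfolding forall_6 level_incl_nth using smooth_on_compose_coordinate_map[OF coordinate_map_forget_s Z_smooth] by simp
        then show ?thesis using Z unfolding section_on_def smooth_vec_on_def pull_def by auto
      qed
      have "bracket (\<lambda>v. level_incl 0 (V (forget_s v))) (\<lambda>v. level_incl 0 (W (forget_s v))) v
          = level_incl 0 (bracket V W (forget_s v))"
        unfolding vec_eq_iff forall_6 level_incl_nth bracket_nth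
        by (simp add: dd_forget_s[where f = "\<lambda>m. _ m $ _"])
      moreover have "bracket (\<lambda>v. level_incl 0 (V (forget_s v))) (\<lambda>v. level_incl 0 (W (forget_s v))) v \<in> derived (pull D) v"
        by (rule bracket_in_derived[OF _ _ sec[OF VW(1)] sec[OF VW(2)]])
           (use N in \<open>auto intro: open_vimage continuous_on_forget_s\<close>)
      ultimately show "bracket V W (forget_s v) \<in> {x. level_incl 0 x \<in> derived (pull D) v}" by simp
    qed
    then show ?thesis using x by blast
  qed
  show "pull (derived D) v \<subseteq> derived (pull D) v"
  proof
    fix x assume "x \<in> pull (derived D) v"
    then have "level_incl 0 (forget_s x) \<in> derived (pull D) v" using lift by (simp add: pull_def)
    moreover have "axis 6 (x $ 6) \<in> pull D v"
    proof -
      have 0: "forget_s (axis 6 (x $ 6) :: 'a^6) = 0" by (simp add: vec_eq_iff forall_5 axis_def)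
      show ?thesis unfolding pull_def mem_Collect_eq 0 by (rule vec.subspace_0[OF D])
    qed
    then have "axis 6 (x $ 6) \<in> derived (pull D) v" by (rule subsetD[OF derived_superset])
    moreover have "x = level_incl 0 (forget_s x) + axis 6 (x $ 6)"
      by (simp add: vec_eq_iff forall_6 axis_def)
    ultimately show "x \<in> derived (pull D) v" using subspace_derived vec.subspace_add by metis
  qed
qed

lemma derived_iterate_pull:
  assumes "\<And>m. vec.subspace (D m)"
  shows "(derived ^^ k) (pull D) = pull ((derived ^^ k) D)"
proof (induction k)
  case (Suc k)
  have "vec.subspace ((derived ^^ k) D m)" for m
    using assms subspace_derived by (cases k) auto
  with Suc show ?case by (simp add: derived_pull)
qed simp

lemma linear_level_incl: "Vector_Spaces.linear (*s) (*s) (level_incl (0::'k::{real_normed_field, euclidean_space}))"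
  by unfold_locales (simp_all add: vec_eq_iff forall_6)

lemma dim_pull:
  assumes S: "vec.subspace (D (forget_s v))"
  shows "vec.dim (pull D v) = vec.dim (D (forget_s v)) + 1"
proof -
  let ?e = "axis 6 1 :: 'a^6" and ?L = "level_incl 0 ` D (forget_s v)"
  have e: "forget_s ?e = 0" by (simp add: vec_eq_iff forall_5 axis_def)
  have span_L: "vec.span ?L = ?L"
    unfolding module_hom.span_image[OF linear_level_incl[unfolded linear_iff_module_hom]] using S by (simp only: vec.span_eq_iff[THEN iffD2])
  have "pull D v = vec.span (insert ?e ?L)"
  proof (intro equalityI subsetI)
    fix x assume "x \<in> pull D v"
    moreover have "x - x $ 6 *s ?e = level_incl 0 (forget_s x)" by (simp add: vec_eq_iff forall_6 axis_def)
    ultimately show "x \<in> vec.span (insert ?e ?L)"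
      unfolding vec.span_insert span_L pull_def by auto
  next
    fix x assume "x \<in> vec.span (insert ?e ?L)"
    then obtain k where "x - k *s ?e \<in> ?L" unfolding vec.span_insert span_L by auto
    then have "forget_s (x - k *s ?e) \<in> D (forget_s v)" by auto
    moreover have "forget_s (x - k *s ?e) = forget_s x"
      by (simp add: vec_eq_iff forall_5 axis_def)
    ultimately show "x \<in> pull D v" by (simp add: pull_def)
  qed
  moreover have "?e \<notin> vec.span ?L" unfolding span_L by (auto simp: vec_eq_iff forall_6 axis_def)
  moreover have "vec.dim ?L = vec.dim (D (forget_s v))"
    by (rule vec.dim_image_eq[OF linear_level_incl]) (metis forget_s_level_incl inj_on_def)
  ultimately show ?thesis by (simp add: vec.dim_insert)
qed

lemma closure_vimage_forget_s:
  assumes "forget_s v \<in> closure S"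
  shows "v \<in> closure (forget_s -` S)"
proof -
  have "level_incl (v $ 6) ` closure S \<subseteq> closure (level_incl (v $ 6) ` S)"
    by (rule continuous_image_closure_subset[OF continuous_on_level_incl[of UNIV]]) simp
  then have "v \<in> closure (level_incl (v $ 6) ` S)"
    using assms by (metis image_eqI level_incl_forget_s subsetD)
  moreover have "level_incl (v $ 6) ` S \<subseteq> forget_s -` S" by auto
  ultimately show ?thesis using closure_mono by blast
qed

lemma has_growth_vector_pullI:
  assumes D: "\<And>m. vec.subspace (D m)" and g: "g \<noteq> []" "sorted_wrt (<) g" and M: "open M"
    and S: "open S" "\<And>v. v \<in> M \<Longrightarrow> forget_s v \<in> closure S"
    and dim: "\<And>m k. m \<in> S \<Longrightarrow> vec.dim ((derived ^^ k) D m) = g ! min k (length g - 1)"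
  shows "has_growth_vector M (pull D) (map Suc g)"
proof (rule has_growth_vectorI)
  show "open (M \<inter> forget_s -` S)" using M S(1) by (intro open_Int open_vimage continuous_on_forget_s)
  show "M \<subseteq> closure (M \<inter> forget_s -` S)"
    using open_Int_closure_subset[OF M, of "forget_s -` S"] closure_vimage_forget_s S(2) by blast
  show "sorted_wrt (<) (map Suc g)" using g by (simp add: sorted_wrt_map)
  fix v k assume v: "v \<in> M \<inter> forget_s -` S"
  have "vec.subspace ((derived ^^ k) D (forget_s v))" using D subspace_derived by (cases k) auto
  then show "vec.dim ((derived ^^ k) (pull D) v) = map Suc g ! min k (length (map Suc g) - 1)"
    using v dim g(1) by (simp add: derived_iterate_pull[OF D] dim_pull nth_map min.strict_coboundedI2 less_Suc_eq_le)
qed (use g in auto)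

text \<open>\<open>Z\<close> spans the kernel of the projection, and the projected \<open>X\<close> and \<open>Y\<close> do not depend on \<open>s\<close>.\<close>

lemma hat_dist_eq: "hat_dist b c \<mu> \<nu> s0 = pull (bar_dist b c \<mu> \<nu> s0)"
proof
  fix v :: "'a^6"
  let ?X = "X_field b \<mu> s0" and ?Y = "Y_field c \<nu> s0"
  have XY: "forget_s (?X (level_incl s0 (forget_s v))) = forget_s (?X v)"
    "forget_s (?Y (level_incl s0 (forget_s v))) = forget_s (?Y v)"
    unfolding vec_eq_iff forall_5 forget_s_nth X_field_def Y_field_def by simp_all
  have "x \<in> hat_dist b c \<mu> \<nu> s0 v \<longleftrightarrow> forget_s x \<in> bar_dist b c \<mu> \<nu> s0 (forget_s v)" for x
  proof -
    have "x \<in> hat_dist b c \<mu> \<nu> s0 v \<longleftrightarrow> (\<exists>k l r. x = k *s ?X v + l *s ?Y v + r *s Z_field v)"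
    proof -
      have "{?X v, ?Y v, Z_field v} = insert (Z_field v) {?X v, ?Y v}" by auto
      then show ?thesis
        unfolding hat_dist_def using vec.span_insert[of "Z_field v" "{?X v, ?Y v}"] unfolding span_2
        by (auto simp: image_iff) (metis add_diff_cancel_right' diff_add_cancel)+
    qed
    also have "\<dots> \<longleftrightarrow> (\<exists>k l. forget_s x = k *s forget_s (?X v) + l *s forget_s (?Y v))"
    proof (intro iffI; elim exE)
      fix k l r assume "x = k *s ?X v + l *s ?Y v + r *s Z_field v"
      then show "\<exists>k l. forget_s x = k *s forget_s (?X v) + l *s forget_s (?Y v)"
        by (intro exI[of _ k] exI[of _ l]) (simp add: vec_eq_iff forall_5 Z_field_def axis_def)
    next
      fix k l assume "forget_s x = k *s forget_s (?X v) + l *s forget_s (?Y v)"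
      then show "\<exists>k l r. x = k *s ?X v + l *s ?Y v + r *s Z_field v"
        by (intro exI[of _ k] exI[of _ l] exI[of _ "x $ 6"])
           (auto simp: vec_eq_iff forall_5 forall_6 Z_field_def axis_def X_field_def Y_field_def)
    qed
    also have "\<dots> \<longleftrightarrow> forget_s x \<in> bar_dist b c \<mu> \<nu> s0 (forget_s v)"
      unfolding bar_dist_def forget_s_span XY unfolding span_2 by (simp add: image_iff)
    finally show ?thesis .
  qed
  then show "hat_dist b c \<mu> \<nu> s0 v = pull (bar_dist b c \<mu> \<nu> s0) v" by (auto simp: pull_def)
qed


lemma M5_subset_B5: "M5 U s0 \<subseteq> B5 U"
  by (auto simp: M5_def M6_def B5_def)

lemma open_M6:
  assumes "open U"
  shows "open (M6 U)"
proof -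
  have "M6 U = forget_s -` B5 U \<inter> {v. (v$3, v$4, v$5, v$6) \<noteq> (0, 0, 0, 0)}"
    by (auto simp: M6_def B5_def)
  moreover have "open (forget_s -` B5 U)"
    using open_B5[OF assms] by (intro open_vimage continuous_on_forget_s)
  moreover have "open {v::'a^6. (v$3, v$4, v$5, v$6) \<noteq> (0, 0, 0, 0)}"
    by (intro open_Collect_neq continuous_intros)
  ultimately show ?thesis by auto
qed

lemma open_M5: "open U \<Longrightarrow> open (M5 U s0)"
proof -
  assume U: "open U"
  have "M5 U s0 = level_incl s0 -` M6 U" by (auto simp: M5_def)
  then show ?thesis using open_M6[OF U] by (auto intro: open_vimage continuous_on_level_incl)
qed

context smooth_system
begin

lemma smooth_hat_fields:
  "smooth_vec_on (M6 U) (X_field b \<mu> s0)" "smooth_vec_on (M6 U) (Y_field c \<nu> s0)" "smooth_vec_on (M6 U) Z_field"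
proof -
  have M: "open (M6 U)" by (rule open_M6[OF open_U])
  have *: "smooth_on (M6 U) (\<lambda>v. f (base v))" if "smooth_on U f" for f
  proof -
    have "smooth_on (forget_s -` B5 U) (\<lambda>v. f (base5 (forget_s v)))"
      by (rule smooth_on_compose_coordinate_map[OF coordinate_map_forget_s smooth_on_base5[OF that]])
    then have "smooth_on (forget_s -` B5 U) (\<lambda>v. f (base v))" by simp
    then show ?thesis by (rule smooth_on_subset) (auto simp: M6_def B5_def)
  qed
  show "smooth_vec_on (M6 U) (X_field b \<mu> s0)" "smooth_vec_on (M6 U) (Y_field c \<nu> s0)"
    unfolding smooth_vec_on_def forall_6 X_field_def Y_field_def vector_6
    by (intro conjI smooth_on_add smooth_on_mult smooth_on_coord smooth_on_const M
        smooth_coefficients[THEN *])+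
  show "smooth_vec_on (M6 U) Z_field" by (simp add: smooth_vec_on_def Z_field_def)
qed

lemma subspace_bar_dist: "vec.subspace (D m)"
  unfolding bar_dist_eq by (rule vec.subspace_span)

lemma hat_dist_distribution: "distribution_on 3 (M6 U) (hat_dist b c \<mu> \<nu> s0)"
proof -
  have "vec.dim (hat_dist b c \<mu> \<nu> s0 v) = 3" for v
    unfolding hat_dist_eq by (simp add: dim_pull subspace_bar_dist dim_bar_dist)
  then show ?thesis
    unfolding distribution_on_def
    using open_M6[OF open_U] smooth_hat_fields
    by (auto intro!: exI[of _ "M6 U"] exI[of _ "[X_field b \<mu> s0, Y_field c \<nu> s0, Z_field]"] simp: hat_dist_def)
qed

lemma bar_dist_distribution: "distribution_on 2 (M5 U s0) D"
  unfolding distribution_on_def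
proof (intro ballI exI[of _ "M5 U s0"] exI[of _ "[X, Y]"] conjI)
  show "open (M5 U s0)" by (rule open_M5[OF open_U])
  show "smooth_vec_on (M5 U s0) V" if "V \<in> set [X, Y]" for V
    using that smooth_fields smooth_vec_on_subset[OF _ M5_subset_B5] by auto
qed (auto simp: dim_bar_dist, auto simp: bar_dist_eq)

lemma Z_cauchy_characteristic: "cauchy_characteristic (M6 U) (hat_dist b c \<mu> \<nu> s0) Z_field"
  unfolding cauchy_characteristic_def
proof (intro conjI allI impI ballI)
  show "section_on (M6 U) (hat_dist b c \<mu> \<nu> s0) Z_field"
    using smooth_hat_fields by (auto simp: section_on_def hat_dist_def intro: vec.span_base)
  fix N W v assume N: "open N \<and> N \<subseteq> M6 U \<and> section_on N (hat_dist b c \<mu> \<nu> s0) W" and v: "v \<in> N"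
  have "bracket Z_field W v = pd_vec 6 W v"
  proof -
    have "dd (axis 6 1) f v = pd 6 f v" for f
      unfolding dd_def sum_6 by (simp add: axis_def)
    then show ?thesis by (simp add: vec_eq_iff bracket_nth Z_field_def pd_vec_def)
  qed
  moreover have "forget_s (pd_vec 6 W v) \<in> D (forget_s v)"
    by (rule pd_6_section_of_pull[of _ _ N]) (use N v in \<open>auto simp: hat_dist_eq subspace_bar_dist\<close>)
  ultimately show "bracket Z_field W v \<in> hat_dist b c \<mu> \<nu> s0 v"
    by (simp add: hat_dist_eq pull_def)
qed

lemma forget_s_hat_dist: "forget_s ` hat_dist b c \<mu> \<nu> s0 v = D (forget_s v)"
  unfolding hat_dist_eq pull_def
proof (intro equalityI subsetI)
  fix x assume "x \<in> D (forget_s v)"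
  then show "x \<in> forget_s ` {x. forget_s x \<in> D (forget_s v)}"
    by (intro image_eqI[of _ _ "level_incl 0 x"]) auto
qed auto

end

section \<open>The compatibility conditions\<close>

lemma pd_pd_commute_twice:
  assumes U: "open U" "m \<in> U" and z: "smooth_on U z"
  shows "pd j (pd j (pd i (pd i z))) m = pd i (pd i (pd j (pd j z))) m"
proof -
  have swap: "pd j (pd i f) q = pd i (pd j f) q" if "smooth_on U f" "q \<in> U" for f q
    using pd_commute[OF U(1) that(2,1)] by simp
  have "pd j (pd j (pd i (pd i z))) m = pd j (pd i (pd j (pd i z))) m"
    by (rule pd_cong[OF U]) (intro swap smooth_on_pd z)
  also have "\<dots> = pd i (pd j (pd j (pd i z))) m"
    by (intro swap smooth_on_pd z U)
  also have "\<dots> = pd i (pd i (pd j (pd j z))) m"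
  proof (rule pd_cong[OF U])
    fix q assume q: "q \<in> U"
    have "pd j (pd j (pd i z)) q = pd j (pd i (pd j z)) q"
      by (rule pd_cong[OF U(1) q]) (intro swap z)
    also have "\<dots> = pd i (pd j (pd j z)) q" by (intro swap smooth_on_pd z q)
    finally show "pd j (pd j (pd i z)) q = pd i (pd j (pd j z)) q" .
  qed
  finally show ?thesis .
qed

text \<open>\<open>z\<^sub>x\<^sub>x\<^sub>y\<^sub>y\<close> is computed from each of the two equations and reduced to \<open>z\<close>, \<open>z\<^sub>x\<close>, \<open>z\<^sub>y\<close> and \<open>z\<^sub>x\<^sub>y\<close>. Both results contain
  \<open>b c z\<^sub>x\<^sub>y\<close>, which cancels.\<close>

lemma cross_derivative_of_solution:
  assumes U: "open U" "m \<in> U"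
    and sm: "smooth_on U b" "smooth_on U c" "smooth_on U \<mu>" "smooth_on U \<nu>" "smooth_on U z"
    and xx: "\<And>q. q \<in> U \<Longrightarrow> pd 1 (pd 1 z) q = b q * pd 2 z q + \<mu> q * z q"
    and yy: "\<And>q. q \<in> U \<Longrightarrow> pd 2 (pd 2 z) q = c q * pd 1 z q + \<nu> q * z q"
  shows "(- 2 * pd 2 b m * \<nu> m - b m * pd 2 \<nu> m - pd 2 (pd 2 \<mu>) m + pd 1 \<mu> m * c m + 2 * \<mu> m * pd 1 c m
            + pd 1 (pd 1 \<nu>) m) * z m
       + (- 2 * pd 2 b m * c m - b m * pd 2 c m + pd 1 (pd 1 c) m + 2 * pd 1 \<nu> m) * pd 1 z m
       + (- 2 * pd 2 \<mu> m - pd 2 (pd 2 b) m + pd 1 b m * c m + 2 * b m * pd 1 c m) * pd 2 z m = 0"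
proof -
  note rules = pd_add[of U] pd_mult[of U]
  have 1: "pd 2 (pd 1 (pd 1 z)) q = pd 2 b q * pd 2 z q + b q * pd 2 (pd 2 z) q + (pd 2 \<mu> q * z q + \<mu> q * pd 2 z q)"
    if q: "q \<in> U" for q
  proof -
    have "pd 2 (pd 1 (pd 1 z)) q = pd 2 (\<lambda>q. b q * pd 2 z q + \<mu> q * z q) q"
      by (rule pd_cong[OF U(1) q]) (rule xx)
    then show ?thesis using U(1) sm q by (simp add: rules)
  qed
  have 2: "pd 1 (pd 2 (pd 2 z)) q = pd 1 c q * pd 1 z q + c q * pd 1 (pd 1 z) q + (pd 1 \<nu> q * z q + \<nu> q * pd 1 z q)"
    if q: "q \<in> U" for q
  proof -
    have "pd 1 (pd 2 (pd 2 z)) q = pd 1 (\<lambda>q. c q * pd 1 z q + \<nu> q * z q) q"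
      by (rule pd_cong[OF U(1) q]) (rule yy)
    then show ?thesis using U(1) sm q by (simp add: rules)
  qed
  have x: "pd 1 (pd 1 (pd 1 z)) m = pd 1 b m * pd 2 z m + b m * pd 1 (pd 2 z) m + (pd 1 \<mu> m * z m + \<mu> m * pd 1 z m)"
  proof -
    have "pd 1 (pd 1 (pd 1 z)) m = pd 1 (\<lambda>q. b q * pd 2 z q + \<mu> q * z q) m"
      by (rule pd_cong[OF U]) (rule xx)
    then show ?thesis using U sm by (simp add: rules)
  qed
  have y: "pd 2 (pd 2 (pd 2 z)) m = pd 2 c m * pd 1 z m + c m * pd 2 (pd 1 z) m + (pd 2 \<nu> m * z m + \<nu> m * pd 2 z m)"
  proof -
    have "pd 2 (pd 2 (pd 2 z)) m = pd 2 (\<lambda>q. c q * pd 1 z q + \<nu> q * z q) m"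
      by (rule pd_cong[OF U]) (rule yy)
    then show ?thesis using U sm by (simp add: rules)
  qed
  have "pd 2 (pd 2 (pd 1 (pd 1 z))) m
      = pd 2 (\<lambda>q. pd 2 b q * pd 2 z q + b q * pd 2 (pd 2 z) q + (pd 2 \<mu> q * z q + \<mu> q * pd 2 z q)) m"
    by (rule pd_cong[OF U]) (rule 1)
  also have "\<dots> = pd 2 (pd 2 b) m * pd 2 z m + pd 2 b m * pd 2 (pd 2 z) m
      + (pd 2 b m * pd 2 (pd 2 z) m + b m * pd 2 (pd 2 (pd 2 z)) m)
      + (pd 2 (pd 2 \<mu>) m * z m + pd 2 \<mu> m * pd 2 z m + (pd 2 \<mu> m * pd 2 z m + \<mu> m * pd 2 (pd 2 z) m))"
    using U sm by (simp add: rules)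
  finally have L: "pd 2 (pd 2 (pd 1 (pd 1 z))) m = \<dots>" .
  have "pd 1 (pd 1 (pd 2 (pd 2 z))) m
      = pd 1 (\<lambda>q. pd 1 c q * pd 1 z q + c q * pd 1 (pd 1 z) q + (pd 1 \<nu> q * z q + \<nu> q * pd 1 z q)) m"
    by (rule pd_cong[OF U]) (rule 2)
  also have "\<dots> = pd 1 (pd 1 c) m * pd 1 z m + pd 1 c m * pd 1 (pd 1 z) m
      + (pd 1 c m * pd 1 (pd 1 z) m + c m * pd 1 (pd 1 (pd 1 z)) m)
      + (pd 1 (pd 1 \<nu>) m * z m + pd 1 \<nu> m * pd 1 z m + (pd 1 \<nu> m * pd 1 z m + \<nu> m * pd 1 (pd 1 z) m))"
    using U sm by (simp add: rules)
  finally have "pd 1 (pd 1 (pd 2 (pd 2 z))) m = \<dots>" .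
  then show ?thesis
    using L pd_pd_commute_twice[OF U sm(5), of 2 1] pd_commute[OF U sm(5), of 2 1]
    unfolding x y xx[OF U(2)] yy[OF U(2)] by algebra
qed

lemma independent_if_dim_3:
  fixes u v w :: "'k::field^'n::finite"
  assumes dim: "vec.dim {u, v, w} = 3" and 0: "k *s u + l *s v + r *s w = 0"
  shows "k = 0 \<and> l = 0 \<and> r = 0"
proof -
  have "card {u, v, w} = 3"
    using vec.dim_le_card'[of "{u, v, w}"] dim card_insert_le_m1 card_length[of "[u, v, w]"] by simp
  then have distinct: "u \<noteq> v" "u \<noteq> w" "v \<noteq> w" by (auto simp: card_insert_if split: if_splits)
  have ind: "vec.independent {u, v, w}"
    by (rule vec.card_le_dim_spanning[where V = "vec.span {u, v, w}"])
       (use \<open>card {u, v, w} = 3\<close> dim in \<open>auto intro: vec.span_base\<close>)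
  define f where "f = (\<lambda>x. if x = u then k else if x = v then l else r)"
  have "(\<Sum>x\<in>{u, v, w}. f x *s x) = 0" using 0 distinct by (simp add: f_def add.assoc)
  then have "\<forall>x\<in>{u, v, w}. f x = 0"
    using ind vec.dependent_finite[of "{u, v, w}"] by auto
  then show ?thesis using distinct by (auto simp: f_def)
qed

lemma canonical_surfaceD:
  assumes "canonical_surface U \<sigma> b c \<mu> \<nu>"
  shows "open U" "smooth_on U b" "smooth_on U c" "smooth_on U \<mu>" "smooth_on U \<nu>"
  using assms unfolding canonical_surface_def asymptotic_surface_def by auto

text \<open>Each component of \<open>\<sigma>\<close> satisfies the relation between \<open>z\<close>, \<open>z\<^sub>x\<close> and \<open>z\<^sub>y\<close>, and \<open>\<sigma>\<close>, \<open>\<sigma>\<^sub>x\<close>, \<open>\<sigma>\<^sub>y\<close> are independent; so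
  the three coefficients vanish.\<close>

lemma canonical_surface_compatibility:
  assumes \<sigma>: "canonical_surface U \<sigma> b c \<mu> \<nu>" and m: "m \<in> U"
  shows "- 2 * pd 2 b m * \<nu> m - b m * pd 2 \<nu> m - pd 2 (pd 2 \<mu>) m + pd 1 \<mu> m * c m + 2 * \<mu> m * pd 1 c m
            + pd 1 (pd 1 \<nu>) m = 0" (is "?E1 = 0")
    "- 2 * pd 2 b m * c m - b m * pd 2 c m + pd 1 (pd 1 c) m + 2 * pd 1 \<nu> m = 0" (is "?E2 = 0")
    "- 2 * pd 2 \<mu> m - pd 2 (pd 2 b) m + pd 1 b m * c m + 2 * b m * pd 1 c m = 0" (is "?E3 = 0")
proof -
  note sm = canonical_surfaceD[OF \<sigma>]
  have 1: "vec.dim {\<sigma> m, pd_vec 1 \<sigma> m, pd_vec 2 \<sigma> m} = 3"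
    using \<sigma> m unfolding canonical_surface_def asymptotic_surface_def by auto
  have "?E1 *s \<sigma> m + ?E2 *s pd_vec 1 \<sigma> m + ?E3 *s pd_vec 2 \<sigma> m = 0"
    unfolding vec_eq_iff
  proof
    fix l
    have z: "smooth_on U (\<lambda>q. \<sigma> q $ l)"
      using \<sigma> unfolding canonical_surface_def asymptotic_surface_def smooth_vec_on_def by auto
    have sys: "pd_vec 1 (pd_vec 1 \<sigma>) q = b q *s pd_vec 2 \<sigma> q + \<mu> q *s \<sigma> q"
      "pd_vec 2 (pd_vec 2 \<sigma>) q = c q *s pd_vec 1 \<sigma> q + \<nu> q *s \<sigma> q" if "q \<in> U" for q
      using \<sigma> that unfolding canonical_surface_def by auto
    have xx: "pd 1 (pd 1 (\<lambda>q. \<sigma> q $ l)) q = b q * pd 2 (\<lambda>q. \<sigma> q $ l) q + \<mu> q * \<sigma> q $ l" if "q \<in> U" for q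
      using arg_cong[OF sys(1)[OF that], of "\<lambda>v. v $ l"] by (simp add: pd_vec_def)
    have yy: "pd 2 (pd 2 (\<lambda>q. \<sigma> q $ l)) q = c q * pd 1 (\<lambda>q. \<sigma> q $ l) q + \<nu> q * \<sigma> q $ l" if "q \<in> U" for q
      using arg_cong[OF sys(2)[OF that], of "\<lambda>v. v $ l"] by (simp add: pd_vec_def)
    show "(?E1 *s \<sigma> m + ?E2 *s pd_vec 1 \<sigma> m + ?E3 *s pd_vec 2 \<sigma> m) $ l = 0 $ l"
      using cross_derivative_of_solution[OF sm(1) m sm(2-5) z xx yy]
      unfolding vector_add_component vector_smult_component pd_vec_def vec_lambda_beta zero_index .
  qed
  from independent_if_dim_3[OF 1 this] show "?E1 = 0" "?E2 = 0" "?E3 = 0" by auto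
qed

section \<open>Genericity\<close>

type_synonym 'k jets = "'k jet2 \<times> 'k jet2 \<times> 'k jet2 \<times> 'k jet2"

definition jets ::
  "('k::{real_normed_field, euclidean_space}^2 \<Rightarrow> 'k) \<Rightarrow> ('k^2 \<Rightarrow> 'k) \<Rightarrow> ('k^2 \<Rightarrow> 'k) \<Rightarrow> ('k^2 \<Rightarrow> 'k) \<Rightarrow> 'k^2 \<Rightarrow> 'k jets" where
  "jets b c \<mu> \<nu> n = (jet2 b n, jet2 c n, jet2 \<mu> n, jet2 \<nu> n)"

lemma canonical_jets_iff:
  "((b, db, ddb), (c, dc, ddc), (\<mu>, d\<mu>, dd\<mu>), (\<nu>, d\<nu>, dd\<nu>)) \<in> canonical_jets \<longleftrightarrow>
     transpose ddb = ddb \<and> transpose ddc = ddc \<and> transpose dd\<mu> = dd\<mu> \<and> transpose dd\<nu> = dd\<nu> \<and>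
     - 2 * db$2 * \<nu> - b * d\<nu>$2 - dd\<mu>$2$2 + d\<mu>$1 * c + 2 * \<mu> * dc$1 + dd\<nu>$1$1 = 0 \<and>
     - 2 * db$2 * c - b * dc$2 + ddc$1$1 + 2 * d\<nu>$1 = 0 \<and>
     - 2 * d\<mu>$2 - ddb$2$2 + db$1 * c + 2 * b * dc$1 = 0"
  unfolding canonical_jets_def by auto

lemma jets_of_canonical_surface:
  assumes \<sigma>: "canonical_surface U \<sigma> b c \<mu> \<nu>" and m: "m \<in> U"
  shows "jets b c \<mu> \<nu> m \<in> canonical_jets"
proof -
  note sm = canonical_surfaceD[OF \<sigma>]
  have "transpose (\<chi> i j. pd i (pd j f) m) = (\<chi> i j. pd i (pd j f) m)" if "smooth_on U f" for f
    using pd_commute[OF sm(1) m that] by (simp add: transpose_def vec_eq_iff)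
  then show ?thesis
    unfolding jets_def jet2_def canonical_jets_iff
    using sm canonical_surface_compatibility[OF assms] by simp
qed


text \<open>Rows two and three of the curvature and their two partial derivatives, as functions of the
  2-jet of the coefficients. The first row of the curvature is zero.\<close>

definition curv_rows :: "'k::{real_normed_field, euclidean_space} jets \<Rightarrow> 'k^3^2" where
  "curv_rows = (\<lambda>((b, b', b''), (c, c', c''), (\<mu>, \<mu>', \<mu>''), (\<nu>, \<nu>', \<nu>'')).
     vector [vector [- \<mu>'$2 - b * \<nu>, - (b * c), - b'$2 - \<mu>], vector [\<nu>'$1 + c * \<mu>, c'$1 + \<nu>, b * c]])"

definition d_curv_rows :: "2 \<Rightarrow> 'k::{real_normed_field, euclidean_space} jets \<Rightarrow> 'k^3^2" where
  "d_curv_rows k = (\<lambda>((b, b', b''), (c, c', c''), (\<mu>, \<mu>', \<mu>''), (\<nu>, \<nu>', \<nu>'')).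
     vector [vector [- \<mu>''$k$2 - (b'$k * \<nu> + b * \<nu>'$k), - (b'$k * c + b * c'$k), - b''$k$2 - \<mu>'$k],
             vector [\<nu>''$k$1 + (c'$k * \<mu> + c * \<mu>'$k), c''$k$1 + \<nu>'$k, b'$k * c + b * c'$k]])"

text \<open>With \<open>T = (0, 0, 0, t\<^sub>p, t\<^sub>q)\<close> and \<open>w = (z, p, q)\<close>: \<open>jet_T 1\<close>, \<open>jet_T 2\<close> are \<open>t\<^sub>p\<close>, \<open>t\<^sub>q\<close>, and \<open>jet_dT k\<close> are their
  derivatives along \<open>X\<close> (\<open>k = 1\<close>) and \<open>Y\<close> (\<open>k = 2\<close>).\<close>

definition jet_T :: "2 \<Rightarrow> 'k::{real_normed_field, euclidean_space} jets \<Rightarrow> 'k^3 \<Rightarrow> 'k" where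
  "jet_T i J w = curv_rows J $ i $ 1 * w$1 + curv_rows J $ i $ 2 * w$2 + curv_rows J $ i $ 3 * w$3"

definition jet_dT :: "'k \<Rightarrow> 2 \<Rightarrow> 2 \<Rightarrow> 'k::{real_normed_field, euclidean_space} jets \<Rightarrow> 'k^3 \<Rightarrow> 'k" where
  "jet_dT s0 k i J w = d_curv_rows k J $ i $ 1 * w$1 + d_curv_rows k J $ i $ 2 * w$2 + d_curv_rows k J $ i $ 3 * w$3
     + (if k = 1
        then curv_rows J $ i $ 1 * w$2 + curv_rows J $ i $ 2 * (fst (fst J) * w$3 + fst (fst (snd (snd J))) * w$1)
          + curv_rows J $ i $ 3 * s0
        else curv_rows J $ i $ 1 * w$3 + curv_rows J $ i $ 2 * s0
          + curv_rows J $ i $ 3 * (fst (fst (snd J)) * w$2 + fst (snd (snd (snd J))) * w$1))"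

definition jet_det :: "'k \<Rightarrow> 'k::{real_normed_field, euclidean_space} jets \<Rightarrow> 'k^3 \<Rightarrow> 'k" where
  "jet_det s0 J w = (jet_T 1 J w)\<^sup>2 * (jet_dT s0 2 2 J w - fst (fst (snd J)) * jet_T 1 J w)
     - jet_T 1 J w * jet_T 2 J w * (jet_dT s0 2 1 J w + jet_dT s0 1 2 J w)
     + (jet_T 2 J w)\<^sup>2 * (jet_dT s0 1 1 J w - fst (fst J) * jet_T 2 J w)"

definition fibre5 :: "'k::{real_normed_field, euclidean_space}^5 \<Rightarrow> 'k^3" where
  "fibre5 m = vector [m$3, m$4, m$5]"

lemma (in smooth_system) curv_rows_jets:
  "curv_rows (jets b c \<mu> \<nu> n) $ 1 $ j = R 2 j n" "curv_rows (jets b c \<mu> \<nu> n) $ 2 $ j = R 3 j n"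
proof -
  have "\<forall>j. curv_rows (jets b c \<mu> \<nu> n) $ 1 $ j = R 2 j n \<and> curv_rows (jets b c \<mu> \<nu> n) $ 2 $ j = R 3 j n"
    unfolding forall_3 curv_entries by (simp add: curv_rows_def jets_def jet2_def)
  then show "curv_rows (jets b c \<mu> \<nu> n) $ 1 $ j = R 2 j n" "curv_rows (jets b c \<mu> \<nu> n) $ 2 $ j = R 3 j n"
    by blast+
qed

lemma (in smooth_system) d_curv_rows_jets:
  assumes n: "n \<in> U"
  shows "d_curv_rows k (jets b c \<mu> \<nu> n) $ 1 $ j = pd k (\<lambda>n. R 2 j n) n"
    "d_curv_rows k (jets b c \<mu> \<nu> n) $ 2 $ j = pd k (\<lambda>n. R 3 j n) n"
proof -
  have "\<forall>j. d_curv_rows k (jets b c \<mu> \<nu> n) $ 1 $ j = pd k (\<lambda>n. R 2 j n) n \<and>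
      d_curv_rows k (jets b c \<mu> \<nu> n) $ 2 $ j = pd k (\<lambda>n. R 3 j n) n"
    unfolding forall_3 curv_entries using open_U smooth_coefficients n
    by (simp add: d_curv_rows_def jets_def jet2_def pd_add[of U] pd_mult[of U] pd_diff[of U] pd_minus[of U])
  then show "d_curv_rows k (jets b c \<mu> \<nu> n) $ 1 $ j = pd k (\<lambda>n. R 2 j n) n"
    "d_curv_rows k (jets b c \<mu> \<nu> n) $ 2 $ j = pd k (\<lambda>n. R 3 j n) n"
    by blast+
qed

lemma (in smooth_system) bracket_det_eq_jet_det:
  assumes m: "m \<in> B5 U"
  shows "bracket_det m = jet_det s0 (jets b c \<mu> \<nu> (base5 m)) (fibre5 m)"
proof -
  have n: "base5 m \<in> U" using m by (simp add: B5_def)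
  have T: "tp m = jet_T 1 (jets b c \<mu> \<nu> (base5 m)) (fibre5 m)" "tq m = jet_T 2 (jets b c \<mu> \<nu> (base5 m)) (fibre5 m)"
    unfolding jet_T_def curv_rows_jets tp_def tq_def fibre5_def by simp_all
  have dT: "dd v (\<lambda>m. R i 1 (base5 m) * m$3 + R i 2 (base5 m) * m$4 + R i 3 (base5 m) * m$5) m
      = (v$1 * pd 1 (\<lambda>n. R i 1 n) (base5 m) + v$2 * pd 2 (\<lambda>n. R i 1 n) (base5 m)) * m$3
      + (v$1 * pd 1 (\<lambda>n. R i 2 n) (base5 m) + v$2 * pd 2 (\<lambda>n. R i 2 n) (base5 m)) * m$4
      + (v$1 * pd 1 (\<lambda>n. R i 3 n) (base5 m) + v$2 * pd 2 (\<lambda>n. R i 3 n) (base5 m)) * m$5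
      + (R i 1 (base5 m) * v$3 + R i 2 (base5 m) * v$4 + R i 3 (base5 m) * v$5)" for v i
    using m smooth_pulled_back
    by (simp add: dd_add[of "B5 U"] dd_mult[of "B5 U"] dd_base5[where f = "\<lambda>n. R _ _ n"] algebra_simps)
  have "dd (X m) tp m = jet_dT s0 1 1 (jets b c \<mu> \<nu> (base5 m)) (fibre5 m)"
    "dd (X m) tq m = jet_dT s0 1 2 (jets b c \<mu> \<nu> (base5 m)) (fibre5 m)"
    "dd (Y m) tp m = jet_dT s0 2 1 (jets b c \<mu> \<nu> (base5 m)) (fibre5 m)"
    "dd (Y m) tq m = jet_dT s0 2 2 (jets b c \<mu> \<nu> (base5 m)) (fibre5 m)"
    unfolding jet_dT_def curv_rows_jets d_curv_rows_jets[OF n] tp_def[abs_def] tq_def[abs_def] dT fibre5_def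
    by (simp_all add: jets_def jet2_def)
  then show ?thesis
    unfolding bracket_det_def jet_det_def T by (simp add: jets_def jet2_def)
qed

lemma continuous_on_curv_rows: "continuous_on UNIV (\<lambda>J. curv_rows J $ i $ j)"
  and continuous_on_d_curv_rows: "continuous_on UNIV (\<lambda>J. d_curv_rows k J $ i $ j)"
proof -
  have "\<forall>i j. continuous_on UNIV (\<lambda>J. curv_rows J $ i $ j)"
    unfolding forall_2 forall_3 curv_rows_def case_prod_unfold vector_2 vector_3 by (intro conjI continuous_intros)
  then show "continuous_on UNIV (\<lambda>J. curv_rows J $ i $ j)" by blast
  have "\<forall>i j. continuous_on UNIV (\<lambda>J. d_curv_rows k J $ i $ j)"
    unfolding forall_2 forall_3 d_curv_rows_def case_prod_unfold vector_2 vector_3 by (intro conjI continuous_intros)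
  then show "continuous_on UNIV (\<lambda>J. d_curv_rows k J $ i $ j)" by blast
qed

lemmas continuous_on_curv_rows' [continuous_intros] =
  continuous_on_compose2[OF continuous_on_curv_rows _ subset_UNIV]
  continuous_on_compose2[OF continuous_on_d_curv_rows _ subset_UNIV]

lemma continuous_on_jet_T [continuous_intros]:
  "continuous_on S f \<Longrightarrow> continuous_on S g \<Longrightarrow> continuous_on S (\<lambda>x. jet_T i (f x) (g x))"
  unfolding jet_T_def by (intro continuous_intros)

lemma continuous_on_jet_dT [continuous_intros]:
  "continuous_on S f \<Longrightarrow> continuous_on S g \<Longrightarrow> continuous_on S (\<lambda>x. jet_dT s0 k i (f x) (g x))"
  unfolding jet_dT_def by (cases "k = 1") (simp_all, (intro continuous_intros; assumption)+)

lemma continuous_on_jet_det [continuous_intros]: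
  "continuous_on S f \<Longrightarrow> continuous_on S g \<Longrightarrow> continuous_on S (\<lambda>x. jet_det s0 (f x) (g x))"
  unfolding jet_det_def by (intro continuous_intros)

lemma continuous_on_jets: "open U \<Longrightarrow> smooth_on U b \<Longrightarrow> smooth_on U c \<Longrightarrow> smooth_on U \<mu> \<Longrightarrow> smooth_on U \<nu> \<Longrightarrow>
    continuous_on U (jets b c \<mu> \<nu>)"
  unfolding jets_def[abs_def] jet2_def[abs_def]
  by (intro continuous_on_Pair continuous_on_vec_lambda smooth_on_imp_continuous_on smooth_on_pd)

text \<open>Along a line in the fibre, \<open>jet_det\<close> is a polynomial in the parameter.\<close>

lemma finite_zeros_jet_det_line:
  assumes "jet_det s0 J (w + v) \<noteq> 0"
  shows "finite {t. jet_det s0 J (w + t *s v) = 0}"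
proof -
  define L where "L f = [:f w, f (w + v) - f w:]" for f :: "'a^3 \<Rightarrow> 'a"
  have T: "poly (L (jet_T i J)) t = jet_T i J (w + t *s v)" for i t
    unfolding L_def jet_T_def by (simp add: algebra_simps)
  have dT: "poly (L (jet_dT s0 k i J)) t = jet_dT s0 k i J (w + t *s v)" for k i t
    unfolding L_def jet_dT_def by (simp add: algebra_simps)
  define P where "P = (L (jet_T 1 J))\<^sup>2 * (L (jet_dT s0 2 2 J) - smult (fst (fst (snd J))) (L (jet_T 1 J)))
     - L (jet_T 1 J) * L (jet_T 2 J) * (L (jet_dT s0 2 1 J) + L (jet_dT s0 1 2 J))
     + (L (jet_T 2 J))\<^sup>2 * (L (jet_dT s0 1 1 J) - smult (fst (fst J)) (L (jet_T 2 J)))"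
  have P: "poly P t = jet_det s0 J (w + t *s v)" for t
    unfolding P_def jet_det_def by (simp add: T dT)
  have "P \<noteq> 0" using P[of 1] assms by auto
  then show ?thesis using poly_roots_finite[of P] P by simp
qed

text \<open>The condition that the vertical parts of \<open>T\<close>, \<open>[X, T]\<close> and \<open>[Y, T]\<close> are independent somewhere on the fibre, hence on a
  dense subset of it.\<close>

definition generic_jets :: "'k \<Rightarrow> 'k::{real_normed_field, euclidean_space} jets set" where
  "generic_jets s0 = {J\<in>canonical_jets. \<exists>w. jet_det s0 J w \<noteq> 0}"

lemma openin_generic_jets: "openin (top_of_set canonical_jets) (generic_jets s0)"
proof -
  have "open {J. jet_det s0 J w \<noteq> 0}" for w
    by (intro open_Collect_neq continuous_intros)
  then have "open (\<Union>w. {J. jet_det s0 J w \<noteq> 0})" by blast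
  moreover have "generic_jets s0 = canonical_jets \<inter> (\<Union>w. {J. jet_det s0 J w \<noteq> 0})"
    by (auto simp: generic_jets_def)
  ultimately show ?thesis by (metis openin_open_Int)
qed

text \<open>The entry \<open>- b\<^sub>y - \<mu>\<close> of the curvature becomes nonzero when \<open>\<mu>\<close> is moved by \<open>t\<close>. Of the compatibility conditions only the
  first contains \<open>\<mu>\<close> itself, in \<open>2 \<mu> c\<^sub>x\<close>; the change is absorbed by \<open>\<nu>\<^sub>x\<^sub>x\<close>.\<close>

lemma canonical_jets_subset_closure_curv_23:
  fixes S :: "'k::{real_normed_field, euclidean_space} jets set"
  assumes S: "S = {J\<in>canonical_jets. curv_rows J $ 1 $ 3 \<noteq> 0}"
  shows "canonical_jets \<subseteq> closure S"
proof
  fix J :: "'k jets" assume J: "J \<in> canonical_jets"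
  obtain b b' b'' c c' c'' \<mu> \<mu>' \<mu>'' \<nu> \<nu>' \<nu>'' where J_eq: "J = ((b, b', b''), (c, c', c''), (\<mu>, \<mu>', \<mu>''), (\<nu>, \<nu>', \<nu>''))"
    by (metis prod.collapse)
  define \<gamma> where "\<gamma> t = ((b, b', b''), (c, c', c''), (\<mu> + t, \<mu>', \<mu>''), (\<nu>, \<nu>', \<nu>'' - axis 1 (axis 1 (2 * t * c'$1))))" for t :: 'k
  have "\<gamma> t \<in> canonical_jets" for t
    using J unfolding J_eq \<gamma>_def canonical_jets_iff
    by (auto simp: transpose_def vec_eq_iff axis_def algebra_simps)
  then have zero: "- b'$2 - (\<mu> + t) = 0" if "\<gamma> t \<notin> S" for t
    using that by (auto simp: S \<gamma>_def curv_rows_def)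
  have "t = - \<mu> - b'$2" if "\<gamma> t \<notin> S" for t
    using zero[OF that] by algebra
  then have "{t. \<gamma> t \<notin> S} \<subseteq> {- \<mu> - b'$2}" by auto
  then have "finite {t. \<gamma> t \<notin> S}" by (rule finite_subset) simp
  moreover have "continuous_on UNIV \<gamma>" unfolding \<gamma>_def[abs_def] by (intro continuous_intros)
  ultimately have "\<gamma> 0 \<in> closure S" by (intro curve_in_closure)
  then show "J \<in> closure S" by (simp add: \<gamma>_def J_eq)
qed

text \<open>No compatibility condition contains \<open>\<nu>\<^sub>x\<^sub>y\<close>. It enters the determinant only through \<open>Y(t\<^sub>q)\<close>, with coefficient
  \<open>z t\<^sub>p\<^sup>2\<close>. So the determinant can be made nonzero wherever this coefficient is not zero, and by the preceding lemma
  there is such a point after a small change of the jet.\<close>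

lemma canonical_jets_subset_closure_generic_jets: "canonical_jets \<subseteq> closure (generic_jets s0)"
proof -
  define S where "S = {J\<in>canonical_jets. curv_rows J $ 1 $ 3 \<noteq> (0::'a)}"
  have "S \<subseteq> closure (generic_jets s0)"
  proof
    fix J assume "J \<in> S"
    then have J: "J \<in> canonical_jets" "curv_rows J $ 1 $ 3 \<noteq> 0" by (auto simp: S_def)
    obtain b b' b'' c c' c'' \<mu> \<mu>' \<mu>'' \<nu> \<nu>' \<nu>'' where J_eq: "J = ((b, b', b''), (c, c', c''), (\<mu>, \<mu>', \<mu>''), (\<nu>, \<nu>', \<nu>''))"
      by (metis prod.collapse)
    define \<gamma> where "\<gamma> t = ((b, b', b''), (c, c', c''), (\<mu>, \<mu>', \<mu>''), (\<nu>, \<nu>', \<nu>'' + axis 1 (axis 2 t) + axis 2 (axis 1 t)))" for t :: 'a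
    \<comment> \<open>At \<open>p = 0\<close>, \<open>z = 1\<close> the component \<open>t\<^sub>p\<close> is affine in \<open>q\<close> with slope \<open>- b\<^sub>y - \<mu> \<noteq> 0\<close>; it cannot vanish at both \<open>q = 0\<close> and \<open>q = 1\<close>.\<close>
    define w :: "'a^3" where "w = vector [1, 0, if curv_rows J $ 1 $ 1 = 0 then 1 else 0]"
    have T: "jet_T 1 J w \<noteq> 0" using J(2) by (simp add: w_def jet_T_def)
    have rows: "curv_rows (\<gamma> t) = curv_rows J"
      "d_curv_rows k (\<gamma> t) $ i $ j = d_curv_rows k J $ i $ j + (if k = 2 \<and> i = 2 \<and> j = 1 then t else 0)" for t i j k
    proof -
      show "curv_rows (\<gamma> t) = curv_rows J" by (simp add: \<gamma>_def J_eq curv_rows_def)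
      have "\<forall>k i j. d_curv_rows k (\<gamma> t) $ i $ j = d_curv_rows k J $ i $ j + (if k = 2 \<and> i = 2 \<and> j = 1 then t else 0)"
        unfolding forall_2 forall_3 by (simp add: \<gamma>_def J_eq d_curv_rows_def axis_def)
      then show "d_curv_rows k (\<gamma> t) $ i $ j = d_curv_rows k J $ i $ j + (if k = 2 \<and> i = 2 \<and> j = 1 then t else 0)"
        by blast
    qed
    have det: "jet_det s0 (\<gamma> t) w = jet_det s0 J w + t * (jet_T 1 J w)\<^sup>2" for t
    proof -
      have "jet_T i (\<gamma> t) w = jet_T i J w" for i by (simp add: jet_T_def rows)
      moreover have "jet_dT s0 k i (\<gamma> t) w = jet_dT s0 k i J w + (if k = 2 \<and> i = 2 then t else 0)" for k i
        unfolding jet_dT_def rows by (simp add: \<gamma>_def J_eq w_def algebra_simps)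
      moreover have "fst (fst (\<gamma> t)) = fst (fst J)" "fst (fst (snd (\<gamma> t))) = fst (fst (snd J))"
        by (simp_all add: \<gamma>_def J_eq)
      ultimately show ?thesis unfolding jet_det_def by (simp add: algebra_simps)
    qed
    have "\<gamma> t \<in> canonical_jets" for t
      using J(1) unfolding J_eq \<gamma>_def canonical_jets_iff
      by (auto simp: transpose_def vec_eq_iff axis_def)
    then have zero: "jet_det s0 J w + t * (jet_T 1 J w)\<^sup>2 = 0" if "\<gamma> t \<notin> generic_jets s0" for t
      using that det by (metis (mono_tags, lifting) generic_jets_def mem_Collect_eq)
    have "t = - jet_det s0 J w / (jet_T 1 J w)\<^sup>2" if "\<gamma> t \<notin> generic_jets s0" for t
    proof -
      have "t * (jet_T 1 J w)\<^sup>2 = - jet_det s0 J w" using zero[OF that] by algebra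
      then show ?thesis using T by (metis nonzero_mult_div_cancel_right power_not_zero)
    qed
    then have "{t. \<gamma> t \<notin> generic_jets s0} \<subseteq> {- jet_det s0 J w / (jet_T 1 J w)\<^sup>2}" by auto
    then have "finite {t. \<gamma> t \<notin> generic_jets s0}" by (rule finite_subset) simp
    moreover have "continuous_on UNIV \<gamma>" unfolding \<gamma>_def[abs_def] by (intro continuous_intros)
    ultimately have "\<gamma> 0 \<in> closure (generic_jets s0)" by (intro curve_in_closure)
    then show "J \<in> closure (generic_jets s0)" by (simp add: \<gamma>_def J_eq)
  qed
  then have "closure S \<subseteq> closure (generic_jets s0)" by (simp add: closure_minimal)
  then show ?thesis using canonical_jets_subset_closure_curv_23[OF S_def] by blast
qed

lemma continuous_on_fibre5 [continuous_intros]: "continuous_on S fibre5"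
proof -
  have "continuous_on S (\<lambda>m. \<chi> i. fibre5 m $ i)"
  proof (rule continuous_on_vec_lambda)
    fix i :: 3
    show "continuous_on S (\<lambda>m. fibre5 m $ i)"
      using exhaust_3[of i] by (elim disjE; simp add: fibre5_def; intro continuous_intros)
  qed
  then show ?thesis by simp
qed

definition fibre_line :: "'k::{real_normed_field, euclidean_space}^5 \<Rightarrow> 'k^3 \<Rightarrow> 'k \<Rightarrow> 'k^5" where
  "fibre_line m v t = m + t *s vector [0, 0, v$1, v$2, v$3]"

lemma fibre_line [simp]:
  "base5 (fibre_line m v t) = base5 m" "fibre5 (fibre_line m v t) = fibre5 m + t *s v" "fibre_line m v 0 = m"
  by (simp_all add: fibre_line_def base5_def fibre5_def vec_eq_iff forall_2 forall_3)

lemma continuous_on_fibre_line: "continuous_on S (fibre_line m v)"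
proof -
  have "continuous_on S (\<lambda>t. \<chi> i. fibre_line m v t $ i)"
    unfolding fibre_line_def vector_add_component vector_smult_component
    by (intro continuous_on_vec_lambda continuous_intros)
  then show ?thesis by simp
qed

context smooth_system
begin

lemma generic_growth:
  assumes "\<And>n. n \<in> U \<Longrightarrow> jets b c \<mu> \<nu> n \<in> generic_jets s0"
  shows "has_growth_vector (M5 U s0) D [2, 3, 5]" "has_growth_vector (M6 U) (hat_dist b c \<mu> \<nu> s0) [3, 4, 6]"
proof -
  define S where "S = B5 U \<inter> (\<lambda>m. jet_det s0 (jets b c \<mu> \<nu> (base5 m)) (fibre5 m)) -` (- {0})"
  have "continuous_on (B5 U) (\<lambda>m. jets b c \<mu> \<nu> (base5 m))"
    by (rule continuous_on_compose2[OF continuous_on_jets[OF open_U smooth_coefficients]])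
       (auto simp: B5_def intro: continuous_intros)
  then have S: "open S"
    unfolding S_def by (intro continuous_open_preimage continuous_intros open_total) auto
  have dense: "B5 U \<subseteq> closure S"
  proof
    fix m assume m: "m \<in> B5 U"
    then have "jets b c \<mu> \<nu> (base5 m) \<in> generic_jets s0" using assms by (simp add: B5_def)
    then obtain w where w: "jet_det s0 (jets b c \<mu> \<nu> (base5 m)) w \<noteq> 0" by (auto simp: generic_jets_def)
    have "{t. fibre_line m (w - fibre5 m) t \<notin> S}
        = {t. jet_det s0 (jets b c \<mu> \<nu> (base5 m)) (fibre5 m + t *s (w - fibre5 m)) = 0}"
      using m by (auto simp: S_def B5_def)
    then have "finite {t. fibre_line m (w - fibre5 m) t \<notin> S}"
      using finite_zeros_jet_det_line[of s0 _ "fibre5 m" "w - fibre5 m"] w by simp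
    then show "m \<in> closure S"
      using curve_in_closure[OF continuous_on_fibre_line, of m "w - fibre5 m" S] by simp
  qed
  have dims: "vec.dim ((derived ^^ k) D m) = [2, 3, 5] ! min k (length [2, 3, 5::nat] - 1)" if "m \<in> S" for m k
    using dims_2_3_5[of m k] that bracket_det_eq_jet_det[of m] by (simp add: S_def numeral_2_eq_2)
  show "has_growth_vector (M5 U s0) D [2, 3, 5]"
  proof (rule has_growth_vectorI)
    show "open (M5 U s0 \<inter> S)" using S open_M5[OF open_U] by auto
    show "M5 U s0 \<subseteq> closure (M5 U s0 \<inter> S)"
      using open_Int_closure_subset[OF open_M5[OF open_U], of s0 S] dense M5_subset_B5[of U s0] by blast
  qed (use dims in auto)
  have "has_growth_vector (M6 U) (pull D) (map Suc [2, 3, 5])"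
  proof (rule has_growth_vector_pullI[OF subspace_bar_dist _ _ open_M6[OF open_U] S])
    fix v assume "v \<in> M6 U"
    then have "forget_s v \<in> B5 U" by (simp add: M6_def B5_def)
    then show "forget_s v \<in> closure S" using dense by blast
  qed (use dims in auto)
  then show "has_growth_vector (M6 U) (hat_dist b c \<mu> \<nu> s0) [3, 4, 6]" by (simp add: hat_dist_eq)
qed

end

section \<open>A surface with generic jets\<close>

definition tensor4 :: "('k::field \<Rightarrow> 'k) \<Rightarrow> ('k \<Rightarrow> 'k) \<Rightarrow> ('k \<Rightarrow> 'k) \<Rightarrow> ('k \<Rightarrow> 'k) \<Rightarrow> 'k^2 \<Rightarrow> 'k^4" where
  "tensor4 f1 f2 g1 g2 n =
     vector [f1 (n$1) * g1 (n$2), f1 (n$1) * g2 (n$2), f2 (n$1) * g1 (n$2), f2 (n$1) * g2 (n$2)]"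

lemma pd_1_product:
  assumes "(f has_field_derivative f') (at (n$1))"
  shows "pd 1 (\<lambda>q::'k::{real_normed_field, euclidean_space}^2. f (q$1) * g (q$2)) n = f' * g (n$2)"
proof (rule pd_eqI)
  have "((\<lambda>t. f (n$1 + t)) has_field_derivative f') (at 0)"
    using assms DERIV_shift[of f f' 0 "n$1"] by (simp add: add.commute)
  then show "((\<lambda>t. f ((n + axis 1 t)$1) * g ((n + axis 1 t)$2)) has_field_derivative f' * g (n$2)) (at 0)"
    by (auto simp: axis_def intro: DERIV_cmult_right)
qed

lemma pd_2_product:
  assumes "(g has_field_derivative g') (at (n$2))"
  shows "pd 2 (\<lambda>q::'k::{real_normed_field, euclidean_space}^2. f (q$1) * g (q$2)) n = f (n$1) * g'"
proof (rule pd_eqI)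
  have "((\<lambda>t. g (n$2 + t)) has_field_derivative g') (at 0)"
    using assms DERIV_shift[of g g' 0 "n$2"] by (simp add: add.commute)
  then show "((\<lambda>t. f ((n + axis 2 t)$1) * g ((n + axis 2 t)$2)) has_field_derivative f (n$1) * g') (at 0)"
    by (auto simp: axis_def intro: DERIV_cmult)
qed

lemma pd_vec_tensor4:
  fixes f1 f2 g1 g2 :: "'k::{real_normed_field, euclidean_space} \<Rightarrow> 'k"
  shows "(f1 has_field_derivative f1' (n$1)) (at (n$1)) \<Longrightarrow> (f2 has_field_derivative f2' (n$1)) (at (n$1)) \<Longrightarrow>
      pd_vec 1 (tensor4 f1 f2 g1 g2) n = tensor4 f1' f2' g1 g2 n"
    and "(g1 has_field_derivative g1' (n$2)) (at (n$2)) \<Longrightarrow> (g2 has_field_derivative g2' (n$2)) (at (n$2)) \<Longrightarrow>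
      pd_vec 2 (tensor4 f1 f2 g1 g2) n = tensor4 f1 f2 g1' g2' n"
  unfolding vec_eq_iff forall_4 tensor4_def pd_vec_def vec_lambda_beta vector_4
  by (simp_all add: pd_1_product pd_2_product)

lemma pd_vec_cong:
  "open U \<Longrightarrow> p \<in> U \<Longrightarrow> (\<And>q. q \<in> U \<Longrightarrow> f q = g q) \<Longrightarrow> pd_vec i f p = pd_vec i g p"
  unfolding pd_vec_def vec_eq_iff vec_lambda_beta by (intro allI pd_cong[of U]) auto

lemma pd_constant_direction:
  "pd 2 (\<lambda>q::'k::{real_normed_field, euclidean_space}^2. f (q$1)) = (\<lambda>q. 0)"
  "pd 1 (\<lambda>q::'k::{real_normed_field, euclidean_space}^2. f (q$2)) = (\<lambda>q. 0)"
  by (simp_all add: fun_eq_iff pd_def axis_def)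

definition example_domain :: "('k::{real_normed_field, euclidean_space}^2) set" where
  "example_domain = {n. n$1 \<noteq> 0 \<and> n$2 \<noteq> 0}"

text \<open>The products of the solutions \<open>x\<^sup>2\<close>, \<open>1/x\<close> of \<open>f'' = 2 f / x\<^sup>2\<close> with the same functions of \<open>y\<close>.\<close>

definition example_surface :: "'k::{real_normed_field, euclidean_space}^2 \<Rightarrow> 'k^4" where
  "example_surface = tensor4 (\<lambda>x. x\<^sup>2) inverse (\<lambda>y. y\<^sup>2) inverse"

definition two_over_square :: "'k::field \<Rightarrow> 'k" where
  "two_over_square x = 2 * (inverse x)\<^sup>2"

lemma open_example_domain: "open example_domain"
  unfolding example_domain_def by (intro open_Collect_conj open_Collect_neq continuous_intros)

lemma example_derivatives:
  fixes x :: "'k::{real_normed_field, euclidean_space}"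
  assumes "x \<noteq> 0"
  shows "((\<lambda>x. x\<^sup>2) has_field_derivative 2 * x) (at x)" "(inverse has_field_derivative - (inverse x)\<^sup>2) (at x)"
    "((\<lambda>x. 2 * x) has_field_derivative 2) (at x)"
    "((\<lambda>x. - (inverse x)\<^sup>2) has_field_derivative 2 * (inverse x)^3) (at x)"
    "(two_over_square has_field_derivative - 4 * (inverse x)^3) (at x)"
  unfolding two_over_square_def[abs_def]
  using assms by (auto intro!: derivative_eq_intros simp: field_simps eval_nat_numeral)

lemma example_partials:
  assumes "n \<in> example_domain"
  shows "pd_vec 1 example_surface n = tensor4 (\<lambda>x. 2 * x) (\<lambda>x. - (inverse x)\<^sup>2) (\<lambda>y. y\<^sup>2) inverse n"
    "pd_vec 2 example_surface n = tensor4 (\<lambda>x. x\<^sup>2) inverse (\<lambda>y. 2 * y) (\<lambda>y. - (inverse y)\<^sup>2) n"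
    "pd_vec 1 (pd_vec 1 example_surface) n = tensor4 (\<lambda>x. 2) (\<lambda>x. 2 * (inverse x)^3) (\<lambda>y. y\<^sup>2) inverse n"
    "pd_vec 2 (pd_vec 2 example_surface) n = tensor4 (\<lambda>x. x\<^sup>2) inverse (\<lambda>y. 2) (\<lambda>y. 2 * (inverse y)^3) n"
    "pd_vec 1 (pd_vec 2 example_surface) n
       = tensor4 (\<lambda>x. 2 * x) (\<lambda>x. - (inverse x)\<^sup>2) (\<lambda>y. 2 * y) (\<lambda>y. - (inverse y)\<^sup>2) n"
    "pd_vec 2 (pd_vec 1 example_surface) n
       = tensor4 (\<lambda>x. 2 * x) (\<lambda>x. - (inverse x)\<^sup>2) (\<lambda>y. 2 * y) (\<lambda>y. - (inverse y)\<^sup>2) n"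
proof -
  have d1: "pd_vec 1 example_surface n = tensor4 (\<lambda>x. 2 * x) (\<lambda>x. - (inverse x)\<^sup>2) (\<lambda>y. y\<^sup>2) inverse n"
    if "n \<in> example_domain" for n :: "'a^2"
    unfolding example_surface_def by (rule pd_vec_tensor4) (use that example_derivatives in \<open>auto simp: example_domain_def\<close>)
  have d2: "pd_vec 2 example_surface n = tensor4 (\<lambda>x. x\<^sup>2) inverse (\<lambda>y. 2 * y) (\<lambda>y. - (inverse y)\<^sup>2) n"
    if "n \<in> example_domain" for n :: "'a^2"
    unfolding example_surface_def by (rule pd_vec_tensor4) (use that example_derivatives in \<open>auto simp: example_domain_def\<close>)
  show "pd_vec 1 example_surface n = tensor4 (\<lambda>x. 2 * x) (\<lambda>x. - (inverse x)\<^sup>2) (\<lambda>y. y\<^sup>2) inverse n"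
    "pd_vec 2 example_surface n = tensor4 (\<lambda>x. x\<^sup>2) inverse (\<lambda>y. 2 * y) (\<lambda>y. - (inverse y)\<^sup>2) n"
    using assms d1 d2 by auto
  have *: "pd_vec i (pd_vec 1 example_surface) n
      = pd_vec i (tensor4 (\<lambda>x. 2 * x) (\<lambda>x. - (inverse x)\<^sup>2) (\<lambda>y. y\<^sup>2) inverse) n"
    "pd_vec i (pd_vec 2 example_surface) n
      = pd_vec i (tensor4 (\<lambda>x. x\<^sup>2) inverse (\<lambda>y. 2 * y) (\<lambda>y. - (inverse y)\<^sup>2)) n" for i
    by (rule pd_vec_cong[OF open_example_domain assms d1] pd_vec_cong[OF open_example_domain assms d2], assumption)+
  have n: "n$1 \<noteq> 0" "n$2 \<noteq> 0" using assms by (auto simp: example_domain_def)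
  show "pd_vec 1 (pd_vec 1 example_surface) n = tensor4 (\<lambda>x. 2) (\<lambda>x. 2 * (inverse x)^3) (\<lambda>y. y\<^sup>2) inverse n"
    "pd_vec 2 (pd_vec 2 example_surface) n = tensor4 (\<lambda>x. x\<^sup>2) inverse (\<lambda>y. 2) (\<lambda>y. 2 * (inverse y)^3) n"
    "pd_vec 1 (pd_vec 2 example_surface) n
       = tensor4 (\<lambda>x. 2 * x) (\<lambda>x. - (inverse x)\<^sup>2) (\<lambda>y. 2 * y) (\<lambda>y. - (inverse y)\<^sup>2) n"
    "pd_vec 2 (pd_vec 1 example_surface) n
       = tensor4 (\<lambda>x. 2 * x) (\<lambda>x. - (inverse x)\<^sup>2) (\<lambda>y. 2 * y) (\<lambda>y. - (inverse y)\<^sup>2) n"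
    unfolding *
       apply (rule pd_vec_tensor4(1)[where f1' = "\<lambda>x. 2" and f2' = "\<lambda>x. 2 * (inverse x)^3"]; rule example_derivatives, rule n)
      apply (rule pd_vec_tensor4(2)[where g1' = "\<lambda>x. 2" and g2' = "\<lambda>x. 2 * (inverse x)^3"]; rule example_derivatives, rule n)
     apply (rule pd_vec_tensor4(1)[where f1' = "\<lambda>x. 2 * x" and f2' = "\<lambda>x. - (inverse x)\<^sup>2"]; rule example_derivatives, rule n)
    apply (rule pd_vec_tensor4(2)[where g1' = "\<lambda>x. 2 * x" and g2' = "\<lambda>x. - (inverse x)\<^sup>2"]; rule example_derivatives, rule n)
    done
qed

lemma det_rows_nonzeroI:
  fixes u1 u2 u3 u4 :: "'k::field^4"
  assumes "\<And>a. (\<Sum>k\<in>UNIV. u1$k * a$k) = 0 \<Longrightarrow> (\<Sum>k\<in>UNIV. u2$k * a$k) = 0 \<Longrightarrow>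
     (\<Sum>k\<in>UNIV. u3$k * a$k) = 0 \<Longrightarrow> (\<Sum>k\<in>UNIV. u4$k * a$k) = 0 \<Longrightarrow> a = 0"
  shows "det (vector [u1, u2, u3, u4] :: 'k^4^4) \<noteq> 0"
proof -
  have "\<forall>a. (vector [u1, u2, u3, u4] :: 'k^4^4) *v a = 0 \<longrightarrow> a = 0"
  proof (intro allI impI)
    fix a assume "(vector [u1, u2, u3, u4] :: 'k^4^4) *v a = 0"
    then have "(\<Sum>k\<in>UNIV. (vector [u1, u2, u3, u4] :: 'k^4^4) $ i $ k * a $ k) = 0" for i
      by (simp add: vec_eq_iff matrix_vector_mult_def)
    from this[of 1] this[of 2] this[of 3] this[of 4] show "a = 0"
      unfolding vector_4 by (intro assms)
  qed
  then have "invertible (vector [u1, u2, u3, u4] :: 'k^4^4)"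
    using matrix_left_invertible_ker invertible_left_inverse by blast
  then show ?thesis by (simp add: invertible_det_nz)
qed

lemma det_proportional_rows: "det (vector [u, v, w, k *s u] :: 'k::field^4^4) = 0"
proof -
  let ?A = "vector [u, v, w, k *s u] :: 'k^4^4" and ?x = "vector [k, 0, 0, -1] :: 'k^4"
  have "?x v* ?A = 0"
    by (simp add: vec_eq_iff vector_matrix_mult_def sum_4)
  moreover have "?x \<noteq> 0" by (simp add: vec_eq_iff forall_4)
  ultimately have "\<not> invertible ?A"
    unfolding invertible_def by (metis vector_matrix_mul_assoc vector_matrix_mul_rid vector_matrix_mult_0)
  then show ?thesis by (simp add: invertible_det_nz)
qed

lemma example_canonical_surface:
  "canonical_surface example_domain example_surface (\<lambda>n. 0) (\<lambda>n. 0)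
     (\<lambda>n. two_over_square (n$1)) (\<lambda>n. two_over_square (n$2))"
proof -
  let ?U = "example_domain :: ('a::{real_normed_field, euclidean_space}^2) set"
  have coord: "smooth_on ?U (\<lambda>n. inverse (n$1))" "smooth_on ?U (\<lambda>n. inverse (n$2))"
    by (rule smooth_on_inverse[OF open_example_domain]; simp add: example_domain_def)+
  have "smooth_vec_on ?U example_surface"
    unfolding smooth_vec_on_def forall_4 example_surface_def tensor4_def vector_4
    by (intro conjI smooth_on_mult smooth_on_power smooth_on_coord open_example_domain coord)
  moreover have "smooth_on ?U (\<lambda>n. two_over_square (n$1))" "smooth_on ?U (\<lambda>n. two_over_square (n$2))"
    unfolding two_over_square_def
    by (intro smooth_on_mult smooth_on_power smooth_on_const open_example_domain coord)+
  moreover have sys: "pd_vec 1 (pd_vec 1 example_surface) n = two_over_square (n$1) *s example_surface n"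
    "pd_vec 2 (pd_vec 2 example_surface) n = two_over_square (n$2) *s example_surface n" if "n \<in> ?U" for n
    using that unfolding example_partials[OF that]
    by (simp_all add: vec_eq_iff forall_4 tensor4_def example_surface_def two_over_square_def example_domain_def
        field_simps eval_nat_numeral)
  moreover have "vec.dim {example_surface n, pd_vec 1 example_surface n, pd_vec 2 example_surface n} = 3
      \<and> det (second_form example_surface n) \<noteq> 0 \<and> second_form example_surface n $ 1 $ 1 = 0
      \<and> second_form example_surface n $ 2 $ 2 = 0" if n: "n \<in> ?U" for n
  proof -
    obtain x y where xy: "x = n$1" "y = n$2" "x \<noteq> 0" "y \<noteq> 0" using n by (auto simp: example_domain_def)
    let ?s = "example_surface n" and ?s1 = "pd_vec 1 example_surface n" and ?s2 = "pd_vec 2 example_surface n"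
    define i j where "i = inverse x" and "j = inverse y"
    have ij: "x * i = 1" "y * j = 1" using xy by (simp_all add: i_def j_def)
    note coords = tensor4_def xy(1,2)[symmetric] i_def[symmetric] j_def[symmetric]
    have "vec.dim (vec.span (set [?s, ?s1, ?s2])) = length [?s, ?s1, ?s2]"
    proof (rule dim_span_list)
      fix a :: "nat \<Rightarrow> 'a"
      assume "(\<Sum>i<length [?s, ?s1, ?s2]. a i *s [?s, ?s1, ?s2] ! i) = 0"
      then have "a 0 *s ?s + a 1 *s ?s1 + a 2 *s ?s2 = 0"
        by (simp add: lessThan_Suc eval_nat_numeral add_ac)
      then have comp: "a 0 * ?s $ i + a 1 * ?s1 $ i + a 2 * ?s2 $ i = 0" for i
        unfolding vec_eq_iff by simp
      have comp': "a 0 * (x\<^sup>2 * y\<^sup>2) + a 1 * (2 * x * y\<^sup>2) + a 2 * (x\<^sup>2 * (2 * y)) = 0"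
        "a 0 * (x\<^sup>2 * j) + a 1 * (2 * x * j) + a 2 * (x\<^sup>2 * - j\<^sup>2) = 0"
        "a 0 * (i * y\<^sup>2) + a 1 * (- i\<^sup>2 * y\<^sup>2) + a 2 * (i * (2 * y)) = 0"
        using comp[of 1] comp[of 2] comp[of 3] unfolding example_partials[OF n] unfolding example_surface_def coords vector_4 by simp_all
      \<comment> \<open>The first three components, multiplied by units so that they become linear in \<open>a 0 * x * y\<close>, \<open>a 1 * y\<close>, \<open>a 2 * x\<close>.\<close>
      have "a 0 * (x * y) + 2 * a 1 * y + 2 * a 2 * x
          = (i * j) * (a 0 * (x\<^sup>2 * y\<^sup>2) + a 1 * (2 * x * y\<^sup>2) + a 2 * (x\<^sup>2 * (2 * y)))"
        "a 0 * (x * y) + 2 * a 1 * y - a 2 * x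
          = (i * y\<^sup>2) * (a 0 * (x\<^sup>2 * j) + a 1 * (2 * x * j) + a 2 * (x\<^sup>2 * - j\<^sup>2))"
        "a 0 * (x * y) - a 1 * y + 2 * a 2 * x
          = (x\<^sup>2 * j) * (a 0 * (i * y\<^sup>2) + a 1 * (- i\<^sup>2 * y\<^sup>2) + a 2 * (i * (2 * y)))"
        using ij by algebra+
      then have "a 0 * (x * y) + 2 * a 1 * y + 2 * a 2 * x = 0" "a 0 * (x * y) + 2 * a 1 * y - a 2 * x = 0"
        "a 0 * (x * y) - a 1 * y + 2 * a 2 * x = 0"
        unfolding comp' by simp_all
      then have "3 * (a 2 * x) = 0" "3 * (a 1 * y) = 0" "3 * (a 0 * (x * y)) = 0" by algebra+
      then show "\<forall>i<length [?s, ?s1, ?s2]. a i = 0" using xy by (auto simp: less_Suc_eq eval_nat_numeral)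
    qed
    moreover have mixed: "det (vector [?s, ?s1, ?s2,
        tensor4 (\<lambda>x. 2 * x) (\<lambda>x. - (inverse x)\<^sup>2) (\<lambda>y. 2 * y) (\<lambda>y. - (inverse y)\<^sup>2) n] :: 'a^4^4) \<noteq> 0"
    proof (rule det_rows_nonzeroI)
      fix a :: "'a^4"
      assume *: "(\<Sum>k\<in>UNIV. ?s$k * a$k) = 0" "(\<Sum>k\<in>UNIV. ?s1$k * a$k) = 0" "(\<Sum>k\<in>UNIV. ?s2$k * a$k) = 0"
        "(\<Sum>k\<in>UNIV. tensor4 (\<lambda>x. 2 * x) (\<lambda>x. - (inverse x)\<^sup>2) (\<lambda>y. 2 * y) (\<lambda>y. - (inverse y)\<^sup>2) n $ k * a$k) = 0"
      \<comment> \<open>In these unknowns the matrix is the tensor square of \<open>((1, 1), (2, - 1))\<close>, of determinant 81.\<close>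
      define p q r where "p = x^3 * y^3 * a$1" and "q = x^3 * a$2" and "r = y^3 * a$3"
      have *: "x\<^sup>2 * y\<^sup>2 * a$1 + x\<^sup>2 * j * a$2 + i * y\<^sup>2 * a$3 + i * j * a$4 = 0"
        "2 * x * y\<^sup>2 * a$1 + 2 * x * j * a$2 + - i\<^sup>2 * y\<^sup>2 * a$3 + - i\<^sup>2 * j * a$4 = 0"
        "x\<^sup>2 * (2 * y) * a$1 + x\<^sup>2 * - j\<^sup>2 * a$2 + i * (2 * y) * a$3 + i * - j\<^sup>2 * a$4 = 0"
        "2 * x * (2 * y) * a$1 + 2 * x * - j\<^sup>2 * a$2 + - i\<^sup>2 * (2 * y) * a$3 + - i\<^sup>2 * - j\<^sup>2 * a$4 = 0"
        using * unfolding example_partials[OF n] unfolding example_surface_def coords sum_4 vector_4 .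
      have "p + q + r + a$4
          = x * y * (x\<^sup>2 * y\<^sup>2 * a$1 + x\<^sup>2 * j * a$2 + i * y\<^sup>2 * a$3 + i * j * a$4)"
        "2 * p + 2 * q - r - a$4
          = x\<^sup>2 * y * (2 * x * y\<^sup>2 * a$1 + 2 * x * j * a$2 + - i\<^sup>2 * y\<^sup>2 * a$3 + - i\<^sup>2 * j * a$4)"
        "2 * p - q + 2 * r - a$4
          = x * y\<^sup>2 * (x\<^sup>2 * (2 * y) * a$1 + x\<^sup>2 * - j\<^sup>2 * a$2 + i * (2 * y) * a$3 + i * - j\<^sup>2 * a$4)"
        "4 * p - 2 * q - 2 * r + a$4
          = x\<^sup>2 * y\<^sup>2 * (2 * x * (2 * y) * a$1 + 2 * x * - j\<^sup>2 * a$2 + - i\<^sup>2 * (2 * y) * a$3 + - i\<^sup>2 * - j\<^sup>2 * a$4)"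
        using ij unfolding p_def q_def r_def by algebra+
      then have "p + q + r + a$4 = 0" "2 * p + 2 * q - r - a$4 = 0" "2 * p - q + 2 * r - a$4 = 0"
        "4 * p - 2 * q - 2 * r + a$4 = 0"
        unfolding * by simp_all
      then have "9 * p = 0" "9 * q = 0" "9 * r = 0" "9 * a$4 = 0" by algebra+
      then show "a = 0" using xy by (simp add: vec_eq_iff forall_4 p_def q_def r_def)
    qed
    moreover have "second_form example_surface n $ 1 $ 1 = 0" "second_form example_surface n $ 2 $ 2 = 0"
    proof -
      note z = det_proportional_rows
      show "second_form example_surface n $ 1 $ 1 = 0" "second_form example_surface n $ 2 $ 2 = 0"
        unfolding second_form_def by (simp_all add: sys[OF n] z)
    qed
    ultimately show ?thesis
      by (simp add: det_2) (simp add: second_form_def example_partials[OF n])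
  qed
  ultimately show ?thesis
    unfolding canonical_surface_def asymptotic_surface_def using open_example_domain by auto
qed

text \<open>At \<open>w = (0, 1, q)\<close> the determinant is a quadratic polynomial in \<open>q\<close> whose linear coefficient is \<open>- \<nu>\<^sup>2 \<mu>\<^sub>x\<close>. This is not zero for any \<open>s\<^sub>0\<close>,
  and comparing \<open>q = 1\<close> with \<open>q = - 1\<close> isolates it.\<close>

lemma example_generic:
  assumes n: "n \<in> example_domain"
  shows "jets (\<lambda>n. 0) (\<lambda>n. 0) (\<lambda>n. two_over_square (n$1)) (\<lambda>n. two_over_square (n$2)) n \<in> generic_jets s0"
proof -
  let ?\<mu> = "\<lambda>n::'a^2. two_over_square (n$1)" and ?\<nu> = "\<lambda>n::'a^2. two_over_square (n$2)"
  let ?J = "jets (\<lambda>n. 0) (\<lambda>n. 0) ?\<mu> ?\<nu> n"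
  have zero: "pd 1 (\<lambda>n. 0) = (\<lambda>n::'a^2. 0)" "pd 2 (\<lambda>n. 0) = (\<lambda>n::'a^2. 0)" by (simp_all add: fun_eq_iff)
  have \<mu>1: "pd 1 ?\<mu> n = - 4 * (inverse (n$1))^3"
    using pd_1_product[OF example_derivatives(5), of n "\<lambda>y. 1"] n by (simp add: example_domain_def)
  have nz: "?\<mu> n \<noteq> 0" "?\<nu> n \<noteq> 0" "pd 1 ?\<mu> n \<noteq> 0"
    using n unfolding \<mu>1 by (auto simp: example_domain_def two_over_square_def)
  have det: "jet_det s0 ?J (vector [0, 1, q])
      = (?\<mu> n * q)\<^sup>2 * (pd 2 ?\<nu> n + ?\<nu> n * s0) - (?\<nu> n)\<^sup>2 * (pd 1 ?\<mu> n * q + ?\<mu> n * s0)" for q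
    unfolding jet_det_def jet_T_def jet_dT_def
    by (simp add: curv_rows_def d_curv_rows_def jets_def jet2_def pd_constant_direction zero power2_eq_square algebra_simps)
  have "jet_det s0 ?J (vector [0, 1, -1]) - jet_det s0 ?J (vector [0, 1, 1]) = 2 * (?\<nu> n)\<^sup>2 * pd 1 ?\<mu> n"
    unfolding det by (simp add: power2_eq_square algebra_simps)
  then have "jet_det s0 ?J (vector [0, 1, -1]) \<noteq> 0 \<or> jet_det s0 ?J (vector [0, 1, 1]) \<noteq> 0"
    using nz by auto
  then show ?thesis
    unfolding generic_jets_def using jets_of_canonical_surface[OF example_canonical_surface n] by blast
qed

lemma genericallyI:
  assumes "\<And>U b c \<mu> \<nu>. smooth_system U b c \<mu> \<nu> \<Longrightarrow> (\<And>n. n \<in> U \<Longrightarrow> jets b c \<mu> \<nu> n \<in> generic_jets s0) \<Longrightarrow> P U b c \<mu> \<nu>"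
  shows "generically P"
  unfolding generically_def
proof (intro exI[of _ "generic_jets s0"] conjI allI impI)
  fix U \<sigma> b c \<mu> \<nu>
  assume *: "canonical_surface U \<sigma> b c \<mu> \<nu> \<and> (\<forall>m\<in>U. (jet2 b m, jet2 c m, jet2 \<mu> m, jet2 \<nu> m) \<in> generic_jets s0)"
  then have "smooth_system U b c \<mu> \<nu>"
    unfolding smooth_system_def using canonical_surfaceD[of U \<sigma> b c \<mu> \<nu>] by blast
  then show "P U b c \<mu> \<nu>" by (rule assms) (use * in \<open>simp add: jets_def\<close>)
next
  have "(vector [1, 1] :: 'a^2) \<in> example_domain" by (simp add: example_domain_def)
  then have "example_domain \<noteq> ({} :: ('a^2) set)" by blast
  then show "\<exists>U \<sigma> b c \<mu> \<nu>. U \<noteq> {} \<and> canonical_surface U \<sigma> b c \<mu> \<nu> \<and>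
      (\<forall>m\<in>U. (jet2 b m, jet2 c m, jet2 \<mu> m, jet2 \<nu> m) \<in> generic_jets s0)"
    using example_canonical_surface example_generic[of _ s0] unfolding jets_def by blast
qed (rule openin_generic_jets canonical_jets_subset_closure_generic_jets)+

section \<open>Curvature with a parallel direction\<close>

text \<open>\<open>\<rho>\<close> is a nowhere zero section of the dual of \<open>B\<close> that annihilates the values of the curvature and whose covariant derivatives are
  multiples of itself, so that its kernel is a parallel subbundle of rank two.\<close>

definition recurrent_covector ::
  "('k::{real_normed_field, euclidean_space}^2 \<Rightarrow> 'k) \<Rightarrow> ('k^2 \<Rightarrow> 'k) \<Rightarrow> ('k^2 \<Rightarrow> 'k) \<Rightarrow> ('k^2 \<Rightarrow> 'k) \<Rightarrow>
    ('k^2) set \<Rightarrow> ('k^2 \<Rightarrow> 'k^3) \<Rightarrow> bool" where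
  "recurrent_covector b c \<mu> \<nu> N \<rho> \<longleftrightarrow> smooth_vec_on N \<rho> \<and>
     (\<forall>n\<in>N. \<rho> n \<noteq> 0 \<and> (\<forall>j. \<rho> n $ 2 * curv b c \<mu> \<nu> n $ 2 $ j + \<rho> n $ 3 * curv b c \<mu> \<nu> n $ 3 $ j = 0) \<and>
       (\<forall>k. \<exists>\<kappa>. \<forall>j. pd k (\<lambda>q. \<rho> q $ j) n + (\<Sum>i\<in>UNIV. \<rho> n $ i * conn b c \<mu> \<nu> k n $ i $ j) = \<kappa> * \<rho> n $ j))"

context smooth_system
begin

text \<open>The 1-form \<open>\<rho>(dw - X\<^sub>w dx - Y\<^sub>w dy)\<close>, where \<open>X\<^sub>w\<close> and \<open>Y\<^sub>w\<close> are the vertical parts of \<open>X\<close> and \<open>Y\<close>. Its kernel is spanned by \<open>X\<close>, \<open>Y\<close> and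
  the kernel of \<open>\<rho>\<close>.\<close>

definition \<theta> :: "('k^2 \<Rightarrow> 'k^3) \<Rightarrow> 'k^5 \<Rightarrow> 'k^5" where
  "\<theta> \<rho> m = vector [
     - (\<rho> (base5 m) $ 1 * X m $ 3 + \<rho> (base5 m) $ 2 * X m $ 4 + \<rho> (base5 m) $ 3 * X m $ 5),
     - (\<rho> (base5 m) $ 1 * Y m $ 3 + \<rho> (base5 m) $ 2 * Y m $ 4 + \<rho> (base5 m) $ 3 * Y m $ 5),
     \<rho> (base5 m) $ 1, \<rho> (base5 m) $ 2, \<rho> (base5 m) $ 3]"

text \<open>If \<open>\<nabla>\<rho> = \<kappa> \<rho>\<close>, then \<open>d\<theta>\<close> is \<open>\<kappa> \<and> \<theta>\<close> plus a multiple of \<open>\<rho>(R w) dx \<and> dy\<close>, and the latter vanishes. So \<open>d\<theta>\<close> vanishes on the kernel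
  of \<open>\<theta>\<close>, which is therefore integrable.\<close>

lemma \<theta>_bracket:
  assumes N: "open N" "N \<subseteq> U" and \<rho>: "recurrent_covector b c \<mu> \<nu> N \<rho>"
    and m: "m \<in> N'" and N': "open N'" "N' \<subseteq> B5 N"
    and V: "smooth_vec_on N' V" "\<And>q. q \<in> N' \<Longrightarrow> (\<Sum>i\<in>UNIV. \<theta> \<rho> q $ i * V q $ i) = 0"
    and W: "smooth_vec_on N' W" "\<And>q. q \<in> N' \<Longrightarrow> (\<Sum>i\<in>UNIV. \<theta> \<rho> q $ i * W q $ i) = 0"
  shows "(\<Sum>i\<in>UNIV. \<theta> \<rho> m $ i * bracket V W m $ i) = 0"
proof -
  have sm_N: "smooth_on N (\<lambda>q. \<rho> q $ i)" for i
    using \<rho> unfolding recurrent_covector_def smooth_vec_on_def by blast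
  have sm: "smooth_on N' (\<lambda>q. \<rho> (base5 q) $ i)" for i
    using smooth_on_subset[OF smooth_on_base5[OF sm_N] N'(2)] .
  have sm': "smooth_on N' (\<lambda>q. f (base5 q))" if "smooth_on U f" for f
    by (rule smooth_on_subset[OF smooth_on_base5[OF that]]) (use N N' in \<open>auto simp: B5_def\<close>)
  note sm'' = N'(1) sm smooth_coefficients[THEN sm']
  define n where "n = base5 m"
  have n: "n \<in> N" using m N' by (auto simp: n_def B5_def)
  have "smooth_vec_on N' (\<theta> \<rho>)"
    unfolding smooth_vec_on_def forall_5 \<theta>_def vector_5 XYT_nth
    by (intro conjI smooth_on_minus smooth_on_add smooth_on_mult smooth_on_coord smooth_on_const sm'')
  note bracket = annihilator_of_bracket[OF N'(1) m this V(1) W(1) V(2) W(2)]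
  have "\<forall>k. \<exists>\<kappa>. \<forall>j. pd k (\<lambda>q. \<rho> q $ j) n + (\<Sum>i\<in>UNIV. \<rho> n $ i * conn b c \<mu> \<nu> k n $ i $ j) = \<kappa> * \<rho> n $ j"
    using \<rho> n unfolding recurrent_covector_def by simp
  from choice[OF this] obtain \<kappa> where "\<forall>k j. pd k (\<lambda>q. \<rho> q $ j) n
      + (\<Sum>i\<in>UNIV. \<rho> n $ i * conn b c \<mu> \<nu> k n $ i $ j) = \<kappa> k * \<rho> n $ j"
    by (elim exE)
  note \<kappa> = this[rule_format]
  have pd_\<rho>: "pd 1 (\<lambda>q. \<rho> q $ 1) n = \<kappa> 1 * \<rho> n $ 1 - \<mu> n * \<rho> n $ 2"
    "pd 1 (\<lambda>q. \<rho> q $ 2) n = \<kappa> 1 * \<rho> n $ 2 - \<rho> n $ 1"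
    "pd 1 (\<lambda>q. \<rho> q $ 3) n = \<kappa> 1 * \<rho> n $ 3 - b n * \<rho> n $ 2"
    "pd 2 (\<lambda>q. \<rho> q $ 1) n = \<kappa> 2 * \<rho> n $ 1 - \<nu> n * \<rho> n $ 3"
    "pd 2 (\<lambda>q. \<rho> q $ 2) n = \<kappa> 2 * \<rho> n $ 2 - c n * \<rho> n $ 3"
    "pd 2 (\<lambda>q. \<rho> q $ 3) n = \<kappa> 2 * \<rho> n $ 3 - \<rho> n $ 1"
    using \<kappa>[of 1 1] \<kappa>[of 1 2] \<kappa>[of 1 3] \<kappa>[of 2 1] \<kappa>[of 2 2] \<kappa>[of 2 3]
    by (simp_all add: conn_def sum_3 eq_diff_eq mult.commute)
  have flat: "\<rho> n $ 2 * tp m + \<rho> n $ 3 * tq m = 0"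
  proof -
    have "\<rho> n $ 2 * R 2 j n + \<rho> n $ 3 * R 3 j n = 0" for j
      using \<rho> n unfolding recurrent_covector_def by blast
    from this[of 1] this[of 2] this[of 3] show ?thesis
      unfolding tp_def tq_def n_def[symmetric] by algebra
  qed
  note rules = dd_add[of N'] dd_diff[of N'] dd_mult[of N'] dd_minus[of N'] dd_base5 dd_base5[where f = "\<lambda>q. \<rho> q $ _"]
  define v w where "v = V m" and "w = W m"
  have dd_\<theta>: "dd u (\<lambda>q. \<theta> \<rho> q $ 3) m = u$1 * pd 1 (\<lambda>q. \<rho> q $ 1) n + u$2 * pd 2 (\<lambda>q. \<rho> q $ 1) n"
    "dd u (\<lambda>q. \<theta> \<rho> q $ 4) m = u$1 * pd 1 (\<lambda>q. \<rho> q $ 2) n + u$2 * pd 2 (\<lambda>q. \<rho> q $ 2) n"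
    "dd u (\<lambda>q. \<theta> \<rho> q $ 5) m = u$1 * pd 1 (\<lambda>q. \<rho> q $ 3) n + u$2 * pd 2 (\<lambda>q. \<rho> q $ 3) n"
    "dd u (\<lambda>q. \<theta> \<rho> q $ 1) m = - ((u$1 * pd 1 (\<lambda>q. \<rho> q $ 1) n + u$2 * pd 2 (\<lambda>q. \<rho> q $ 1) n) * m$4
       + \<rho> n $ 1 * u$4
       + ((u$1 * pd 1 (\<lambda>q. \<rho> q $ 2) n + u$2 * pd 2 (\<lambda>q. \<rho> q $ 2) n) * (b n * m$5 + \<mu> n * m$3)
       + \<rho> n $ 2 * ((u$1 * pd 1 b n + u$2 * pd 2 b n) * m$5 + b n * u$5 + ((u$1 * pd 1 \<mu> n + u$2 * pd 2 \<mu> n) * m$3 + \<mu> n * u$3)))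
       + (u$1 * pd 1 (\<lambda>q. \<rho> q $ 3) n + u$2 * pd 2 (\<lambda>q. \<rho> q $ 3) n) * s0)"
    "dd u (\<lambda>q. \<theta> \<rho> q $ 2) m = - ((u$1 * pd 1 (\<lambda>q. \<rho> q $ 1) n + u$2 * pd 2 (\<lambda>q. \<rho> q $ 1) n) * m$5
       + \<rho> n $ 1 * u$5
       + (u$1 * pd 1 (\<lambda>q. \<rho> q $ 2) n + u$2 * pd 2 (\<lambda>q. \<rho> q $ 2) n) * s0
       + ((u$1 * pd 1 (\<lambda>q. \<rho> q $ 3) n + u$2 * pd 2 (\<lambda>q. \<rho> q $ 3) n) * (c n * m$4 + \<nu> n * m$3)
       + \<rho> n $ 3 * ((u$1 * pd 1 c n + u$2 * pd 2 c n) * m$4 + c n * u$4 + ((u$1 * pd 1 \<nu> n + u$2 * pd 2 \<nu> n) * m$3 + \<nu> n * u$3))))"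
    for u
    unfolding \<theta>_def vector_5 XYT_nth using sm'' m by (simp_all add: rules n_def[symmetric])
  have "(\<Sum>i\<in>UNIV. dd w (\<lambda>q. \<theta> \<rho> q $ i) m * v $ i - dd v (\<lambda>q. \<theta> \<rho> q $ i) m * w $ i)
      = \<kappa> 1 * (w$1 * (\<Sum>i\<in>UNIV. \<theta> \<rho> m $ i * v $ i) - v$1 * (\<Sum>i\<in>UNIV. \<theta> \<rho> m $ i * w $ i))
      + \<kappa> 2 * (w$2 * (\<Sum>i\<in>UNIV. \<theta> \<rho> m $ i * v $ i) - v$2 * (\<Sum>i\<in>UNIV. \<theta> \<rho> m $ i * w $ i))
      + (v$1 * w$2 - v$2 * w$1) * (\<rho> n $ 2 * tp m + \<rho> n $ 3 * tq m)"
    unfolding sum_5 dd_\<theta> pd_\<rho> unfolding \<theta>_def vector_5 XYT_nth tp_def tq_def n_def[symmetric] curv_entries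
    by (simp add: algebra_simps)
  then show ?thesis
    using bracket V(2)[OF m] W(2)[OF m] flat unfolding v_def w_def by simp
qed

lemma dims_2_3_4:
  assumes N: "open N" "N \<subseteq> U" and \<rho>: "recurrent_covector b c \<mu> \<nu> N \<rho>"
    and m: "m \<in> B5 N" and T: "T m \<noteq> 0"
  shows "vec.dim ((derived ^^ k) D m) = [2, 3, 4] ! min k 2"
proof -
  define E where "E m = {v. (\<Sum>i\<in>UNIV. \<theta> \<rho> m $ i * v $ i) = 0}" for m
  have m': "m \<in> B5 U" using m N by (auto simp: B5_def)
  have E: "vec.subspace (E q)" for q
    unfolding E_def
    by (rule vec.subspaceI)
       (simp_all add: distrib_left sum.distrib mult.left_commute[of _ "_::'k" "_ $ _"] sum_distrib_left[symmetric])
  have DE: "D q \<subseteq> E q" for q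
    unfolding bar_dist_eq by (rule vec.span_minimal[OF _ E]) (simp add: E_def sum_5 \<theta>_def)
  have involutive: "derived E q \<subseteq> E q" if q: "q \<in> B5 N" for q
  proof (rule derived_least[OF E order_refl])
    fix N' V W assume N': "open N'" "q \<in> N'" and VW: "section_on N' E V" "section_on N' E W"
    have "section_on (N' \<inter> B5 N) E V" "section_on (N' \<inter> B5 N) E W"
      using VW by (auto intro: section_on_subset)
    then have "(\<Sum>i\<in>UNIV. \<theta> \<rho> q $ i * bracket V W q $ i) = 0"
      by (intro \<theta>_bracket[OF N \<rho>, of q "N' \<inter> B5 N"])
         (use N' q open_B5[OF N(1)] in \<open>auto simp: section_on_def E_def\<close>)
    then show "bracket V W q \<in> E q" by (simp add: E_def)
  qed
  have upper: "vec.dim ((derived ^^ k) D m) \<le> 4" for k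
  proof -
    have "(derived ^^ k) D m \<subseteq> E m"
      by (rule derived_iterate_subset_involutive[OF open_B5[OF N(1)] DE involutive m])
    then have "vec.dim ((derived ^^ k) D m) \<le> vec.dim (E m)" by (rule vec.dim_subset)
    moreover have "vec.dim (E m) < vec.dim (UNIV :: ('k^5) set)"
    proof (rule vec.dim_psubset)
      have "\<rho> (base5 m) \<noteq> 0" using \<rho> m unfolding recurrent_covector_def B5_def by auto
      then obtain i where "\<theta> \<rho> m $ i \<noteq> 0"
        by (auto simp: vec_eq_iff forall_3 \<theta>_def) (metis vector_5)+
      then have "axis i 1 \<notin> E m" by (simp add: E_def axis_def if_distrib cong: if_cong)
      then show "vec.span (E m) \<subset> vec.span UNIV"
        using E by (auto simp: vec.span_eq_iff[THEN iffD2])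
    qed
    ultimately show ?thesis unfolding vec_dim_card by simp
  qed
  consider "k = 0" | "k = 1" | "2 \<le> k" by linarith
  then show ?thesis
  proof cases
    case 3
    then have "vec.dim ((derived ^^ 2) D m) \<le> vec.dim ((derived ^^ k) D m)"
      by (intro vec.dim_subset derived_iterate_superset)
    then show ?thesis using 3 upper[of k] dim_second_derived_ge_4[OF m' T] by (simp add: eval_nat_numeral)
  qed (use dim_bar_dist dim_derived_bar_dist[OF m' T] in auto)
qed


text \<open>The rows of the curvature are sections of the dual of \<open>B\<close>, and this is their covariant derivative;
  it differs from the rows of \<open>\<nabla>R\<close> by the term \<open>\<Gamma>\<^sub>k R\<close>.\<close>

abbreviation row_deriv where
  "row_deriv k i j n \<equiv> pd k (\<lambda>n. R i j n) n + (\<Sum>l\<in>UNIV. R i l n * conn b c \<mu> \<nu> k n $ l $ j)"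

text \<open>The first rows of \<open>\<Gamma>\<^sub>1\<close> and \<open>\<Gamma>\<^sub>2\<close> are the second and third unit covector. Therefore the first row of
  \<open>\<nabla>R\<close> consists of the second and third row of \<open>R\<close> up to sign, and conditions on \<open>\<nabla>R\<close> become conditions on \<open>R\<close>.\<close>

lemma nabla_curv_entries:
  "nabla_curv b c \<mu> \<nu> n $ 1 $ 1 $ j = - R 2 j n"
  "nabla_curv b c \<mu> \<nu> n $ 2 $ 1 $ j = - R 3 j n"
  "nabla_curv b c \<mu> \<nu> n $ 1 $ 2 $ j = row_deriv 1 2 j n - b n * R 3 j n"
  "nabla_curv b c \<mu> \<nu> n $ 1 $ 3 $ j = row_deriv 1 3 j n"
  "nabla_curv b c \<mu> \<nu> n $ 2 $ 2 $ j = row_deriv 2 2 j n"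
  "nabla_curv b c \<mu> \<nu> n $ 2 $ 3 $ j = row_deriv 2 3 j n - c n * R 2 j n"
proof -
  have row1: "R 1 j n = 0" for j n
    using exhaust_3[of j] curv_entries(1-3) by auto
  show "nabla_curv b c \<mu> \<nu> n $ 1 $ 1 $ j = - R 2 j n"
    "nabla_curv b c \<mu> \<nu> n $ 2 $ 1 $ j = - R 3 j n"
    "nabla_curv b c \<mu> \<nu> n $ 1 $ 2 $ j = row_deriv 1 2 j n - b n * R 3 j n"
    "nabla_curv b c \<mu> \<nu> n $ 1 $ 3 $ j = row_deriv 1 3 j n"
    "nabla_curv b c \<mu> \<nu> n $ 2 $ 2 $ j = row_deriv 2 2 j n"
    "nabla_curv b c \<mu> \<nu> n $ 2 $ 3 $ j = row_deriv 2 3 j n - c n * R 2 j n"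
    by (simp_all add: nabla_curv_def pd_mat_def pd_vec_def commutator_def matrix_matrix_mult_def row1 sum_3,
        simp_all add: conn_def)
qed

lemma curv_zero_iff: "curv b c \<mu> \<nu> n = 0 \<longleftrightarrow> (\<forall>j. R 2 j n = 0 \<and> R 3 j n = 0)"
  using curv_entries(1-3)[of n] by (auto simp: vec_eq_iff forall_3)

lemma open_nonzero_curv: "open N \<Longrightarrow> N \<subseteq> U \<Longrightarrow> open {n\<in>N. R i j n \<noteq> 0}"
  using continuous_open_preimage[of N "\<lambda>n. R i j n" "- {0}"]
    continuous_on_subset[OF smooth_on_imp_continuous_on[OF smooth_curv[of i j]]]
  by (auto simp: vimage_def Int_def)

text \<open>The compatibility conditions in invariant form: the second row of \<open>R\<close>, with its sign reversed, and the third row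
  are the coefficients of \<open>\<sigma>\<^sub>x\<^sub>x\<^sub>y\<close> and \<open>\<sigma>\<^sub>x\<^sub>y\<^sub>y\<close> with respect to \<open>\<sigma>\<close>, \<open>\<sigma>\<^sub>x\<close>, \<open>\<sigma>\<^sub>y\<close>.\<close>

lemma compatibility_of_rows:
  assumes n: "n \<in> U"
    and "- 2 * pd 2 b n * \<nu> n - b n * pd 2 \<nu> n - pd 2 (pd 2 \<mu>) n + pd 1 \<mu> n * c n + 2 * \<mu> n * pd 1 c n
            + pd 1 (pd 1 \<nu>) n = 0"
    "- 2 * pd 2 b n * c n - b n * pd 2 c n + pd 1 (pd 1 c) n + 2 * pd 1 \<nu> n = 0"
    "- 2 * pd 2 \<mu> n - pd 2 (pd 2 b) n + pd 1 b n * c n + 2 * b n * pd 1 c n = 0"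
  shows "row_deriv 1 3 j n + row_deriv 2 2 j n = 0"
proof -
  have "\<forall>j. row_deriv 1 3 j n + row_deriv 2 2 j n = 0"
    unfolding forall_3 sum_3 curv_entries using open_U smooth_coefficients n assms(2-4)
    by (simp add: conn_def pd_add[of U] pd_mult[of U] pd_diff[of U] pd_minus[of U]) (intro conjI; algebra)
  then show ?thesis by blast
qed

end

text \<open>Being dense in \<open>U\<close> lifts to the bundle, because every point of it lies on a continuous section.\<close>

lemma closure_B5:
  fixes m :: "'k::{real_normed_field, euclidean_space}^5"
  assumes "base5 m \<in> closure G"
  shows "m \<in> closure (B5 G)"
proof -
  define f where "f n = (vector [n$1, n$2, m$3, m$4, m$5] :: 'k^5)" for n :: "'k^2"
  have "continuous_on UNIV (\<lambda>n. \<chi> i. f n $ i)"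
  proof (rule continuous_on_vec_lambda)
    fix i :: 5
    show "continuous_on UNIV (\<lambda>n. f n $ i)"
      using exhaust_5[of i] by (elim disjE; simp add: f_def; intro continuous_intros)
  qed
  then have "f ` closure G \<subseteq> closure (f ` G)"
    by (intro continuous_image_closure_subset[of UNIV]) auto
  moreover have "f (base5 m) = m" by (simp add: f_def base5_def vec_eq_iff forall_5)
  moreover have "f ` G \<subseteq> B5 G" by (auto simp: f_def B5_def base5_def vec_eq_iff forall_2)
  ultimately show ?thesis using assms closure_mono by (metis imageI subsetD)
qed

context smooth_system
begin

text \<open>The first row of \<open>\<nabla>\<^sub>W R = 0\<close> makes the second row of \<open>R\<close> a multiple \<open>a \<rho>\<close> of the third row \<open>\<rho>\<close>, with \<open>a = - W\<^sub>2 / W\<^sub>1\<close>. Its third row and the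
  compatibility conditions express \<open>\<nabla>\<^sub>x \<rho> - a \<nabla>\<^sub>y \<rho>\<close> and \<open>\<nabla>\<^sub>x \<rho> + a \<nabla>\<^sub>y \<rho>\<close> as multiples of \<open>\<rho>\<close>; since \<open>a \<noteq> 0\<close>, both derivatives are multiples of \<open>\<rho>\<close>.
  Finally \<open>\<rho> R = (a \<rho>\<^sub>2 + \<rho>\<^sub>3) \<rho>\<close>, and the factor is the trace of \<open>R\<close>, which is zero.\<close>

lemma recurrent_covector_row_3:
  assumes N: "open N" "N \<subseteq> U"
    and compat: "\<And>n j. n \<in> N \<Longrightarrow> row_deriv 1 3 j n + row_deriv 2 2 j n = 0"
    and W: "smooth_vec_on N W" "\<And>n. n \<in> N \<Longrightarrow> W n $ 1 \<noteq> 0 \<and> W n $ 2 \<noteq> 0"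
    and curv: "\<And>n. n \<in> N \<Longrightarrow> curv b c \<mu> \<nu> n \<noteq> 0"
    and along: "\<And>n. n \<in> N \<Longrightarrow> nabla_curv_along b c \<mu> \<nu> W n = 0"
  shows "recurrent_covector b c \<mu> \<nu> N (\<lambda>n. curv b c \<mu> \<nu> n $ 3)"
proof -
  have along': "W n $ 1 * nabla_curv b c \<mu> \<nu> n $ 1 $ i $ j + W n $ 2 * nabla_curv b c \<mu> \<nu> n $ 2 $ i $ j = 0"
    if "n \<in> N" for n i j
    using along[OF that] by (simp add: nabla_curv_along_def vec_eq_iff sum_2)
  define a where "a n = - W n $ 2 / W n $ 1" for n
  have a_smooth: "smooth_on N a"
    unfolding a_def[abs_def] by (intro smooth_on_divide smooth_on_minus N)
      (use W in \<open>auto simp: smooth_vec_on_def\<close>)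
  have R_smooth: "smooth_on N (\<lambda>n. R i j n)" for i j
    by (rule smooth_on_subset[OF smooth_curv N(2)])
  have a: "W n $ 2 = - (a n * W n $ 1)" "a n \<noteq> 0" if "n \<in> N" for n
    using W(2)[OF that] by (auto simp: a_def)
  have row2: "R 2 j n = a n * R 3 j n" if n: "n \<in> N" for n j
  proof -
    have "W n $ 1 * (R 2 j n - a n * R 3 j n) = 0"
      using along'[OF n, of 1 j] unfolding nabla_curv_entries a(1)[OF n] by algebra
    then show ?thesis using W(2)[OF n] by simp
  qed
  have recurrent: "\<exists>\<kappa>. \<forall>j. row_deriv k 3 j n = \<kappa> * R 3 j n"
    if n: "n \<in> N" for n k
  proof -
    define P where "P k j = row_deriv k 3 j n" for k j
    have 1: "P 1 j + (pd 2 a n * R 3 j n + a n * P 2 j) = 0" for j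
    proof -
      have "pd 2 (\<lambda>n. R 2 j n) n = pd 2 (\<lambda>n. a n * R 3 j n) n"
        by (rule pd_cong[OF N(1) n]) (rule row2)
      also have "\<dots> = pd 2 a n * R 3 j n + a n * pd 2 (\<lambda>n. R 3 j n) n"
        by (rule pd_mult[OF a_smooth R_smooth n])
      finally show ?thesis
        using compat[OF n, of j] by (simp add: P_def row2[OF n] sum_distrib_left algebra_simps)
    qed
    have 2: "P 1 j - a n * (P 2 j - c n * (a n * R 3 j n)) = 0" for j
    proof -
      have "W n $ 1 * (P 1 j - a n * (P 2 j - c n * (a n * R 3 j n))) = 0"
        using along'[OF n, of 3 j]
        unfolding nabla_curv_entries P_def[symmetric] row2[OF n] a(1)[OF n] by algebra
      then show ?thesis using W(2)[OF n] by simp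
    qed
    define l where "l = (c n * (a n)\<^sup>2 - pd 2 a n) / (2 * a n)"
    have l: "2 * a n * l = c n * (a n)\<^sup>2 - pd 2 a n" using a(2)[OF n] by (simp add: l_def)
    have P2: "P 2 j = l * R 3 j n" for j
    proof -
      have "2 * a n * (P 2 j - l * R 3 j n) = 0"
        using 1[of j] 2[of j] l by algebra
      then show ?thesis using a(2)[OF n] by simp
    qed
    have P1: "P 1 j = (- pd 2 a n - a n * l) * R 3 j n" for j
      using 1[of j] unfolding P2 by algebra
    show ?thesis
      using exhaust_2[of k] P1 P2 unfolding P_def by blast
  qed
  have "R 3 2 n * R 2 j n + R 3 3 n * R 3 j n = 0" if n: "n \<in> N" for n j
  proof -
    have "a n * R 3 2 n + R 3 3 n = 0"
      using row2[OF n, of 2] by (simp add: curv_entries(5,9)) algebra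
    then show ?thesis unfolding row2[OF n] by algebra
  qed
  moreover have "curv b c \<mu> \<nu> n $ 3 \<noteq> 0" if n: "n \<in> N" for n
  proof
    assume "curv b c \<mu> \<nu> n $ 3 = 0"
    then have "curv b c \<mu> \<nu> n = 0" unfolding curv_zero_iff row2[OF n] by simp
    then show False using curv[OF n] by simp
  qed
  ultimately show ?thesis
    unfolding recurrent_covector_def smooth_vec_on_def using R_smooth recurrent by auto
qed

text \<open>For \<open>W\<close> along \<open>\<partial>\<^sub>x\<close> the second row of \<open>R\<close> vanishes, and the second row of \<open>\<nabla>\<^sub>x R = 0\<close> forces \<open>b = 0\<close>, hence \<open>\<mu> = 0\<close>: the surface is
  ruled by the \<open>x\<close>-curves. Then the second rows of \<open>\<Gamma>\<^sub>1\<close>, \<open>\<Gamma>\<^sub>2\<close> are zero, so \<open>dp\<close> is parallel.\<close>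

lemma recurrent_covector_dp:
  assumes N: "open N" "N \<subseteq> U"
    and W: "\<And>n. n \<in> N \<Longrightarrow> W n $ 1 \<noteq> 0 \<and> W n $ 2 = 0"
    and curv: "\<And>n. n \<in> N \<Longrightarrow> curv b c \<mu> \<nu> n \<noteq> 0"
    and along: "\<And>n. n \<in> N \<Longrightarrow> nabla_curv_along b c \<mu> \<nu> W n = 0"
  shows "recurrent_covector b c \<mu> \<nu> N (\<lambda>n. vector [0, 1, 0])"
proof -
  have along': "nabla_curv b c \<mu> \<nu> n $ 1 $ i $ j = 0" if "n \<in> N" for n i j
    using along[OF that] W[OF that] by (auto simp: nabla_curv_along_def vec_eq_iff sum_2)
  have row2: "R 2 j n = 0" if n: "n \<in> N" for n j
    using along'[OF n, of 1 j] unfolding nabla_curv_entries by simp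
  have b: "b n = 0" if n: "n \<in> N" for n
  proof -
    obtain j where j: "R 3 j n \<noteq> 0" using curv[OF n] row2[OF n] unfolding curv_zero_iff by blast
    have "pd 1 (\<lambda>n. R 2 j n) n = pd 1 (\<lambda>n. 0) n" by (rule pd_cong[OF N(1) n]) (rule row2)
    then show ?thesis using along'[OF n, of 2 j] j unfolding nabla_curv_entries by (simp add: row2[OF n])
  qed
  have \<mu>: "\<mu> n = 0" if n: "n \<in> N" for n
  proof -
    have "pd 2 b n = pd 2 (\<lambda>n. 0) n" by (rule pd_cong[OF N(1) n]) (rule b)
    then show ?thesis using row2[OF n, of 3] by (simp add: curv_entries)
  qed
  have zero: "(\<Sum>i\<in>UNIV. (vector [0, 1, 0] :: 'k^3) $ i * conn b c \<mu> \<nu> k n $ i $ j) = 0" if "n \<in> N" for n k j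
  proof -
    have "\<forall>k j. conn b c \<mu> \<nu> k n $ 2 $ j = 0"
      unfolding forall_2 forall_3 by (simp add: conn_def b \<mu> that)
    then show ?thesis by (simp add: sum_3)
  qed
  have ne: "(vector [0, 1, 0] :: 'k^3) \<noteq> 0" by (simp add: vec_eq_iff forall_3)
  show ?thesis
    unfolding recurrent_covector_def smooth_vec_on_def using zero ne
    by (auto simp: row2 intro!: exI[of _ 0])
qed

text \<open>For \<open>W\<close> along \<open>\<partial>\<^sub>y\<close> the surface is ruled by the \<open>y\<close>-curves, and \<open>dq\<close> is parallel.\<close>

lemma recurrent_covector_dq:
  assumes N: "open N" "N \<subseteq> U"
    and W: "\<And>n. n \<in> N \<Longrightarrow> W n $ 1 = 0 \<and> W n $ 2 \<noteq> 0"
    and curv: "\<And>n. n \<in> N \<Longrightarrow> curv b c \<mu> \<nu> n \<noteq> 0"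
    and along: "\<And>n. n \<in> N \<Longrightarrow> nabla_curv_along b c \<mu> \<nu> W n = 0"
  shows "recurrent_covector b c \<mu> \<nu> N (\<lambda>n. vector [0, 0, 1])"
proof -
  have along': "nabla_curv b c \<mu> \<nu> n $ 2 $ i $ j = 0" if "n \<in> N" for n i j
    using along[OF that] W[OF that] by (auto simp: nabla_curv_along_def vec_eq_iff sum_2)
  have row3: "R 3 j n = 0" if n: "n \<in> N" for n j
    using along'[OF n, of 1 j] unfolding nabla_curv_entries by simp
  have c: "c n = 0" if n: "n \<in> N" for n
  proof -
    obtain j where j: "R 2 j n \<noteq> 0" using curv[OF n] row3[OF n] unfolding curv_zero_iff by blast
    have "pd 2 (\<lambda>n. R 3 j n) n = pd 2 (\<lambda>n. 0) n" by (rule pd_cong[OF N(1) n]) (rule row3)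
    then show ?thesis using along'[OF n, of 3 j] j unfolding nabla_curv_entries by (simp add: row3[OF n])
  qed
  have \<nu>: "\<nu> n = 0" if n: "n \<in> N" for n
  proof -
    have "pd 1 c n = pd 1 (\<lambda>n. 0) n" by (rule pd_cong[OF N(1) n]) (rule c)
    then show ?thesis using row3[OF n, of 2] by (simp add: curv_entries)
  qed
  have zero: "(\<Sum>i\<in>UNIV. (vector [0, 0, 1] :: 'k^3) $ i * conn b c \<mu> \<nu> k n $ i $ j) = 0" if "n \<in> N" for n k j
  proof -
    have "\<forall>k j. conn b c \<mu> \<nu> k n $ 3 $ j = 0"
      unfolding forall_2 forall_3 by (simp add: conn_def c \<nu> that)
    then show ?thesis by (simp add: sum_3)
  qed
  have ne: "(vector [0, 0, 1] :: 'k^3) \<noteq> 0" by (simp add: vec_eq_iff forall_3)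
  show ?thesis
    unfolding recurrent_covector_def smooth_vec_on_def using zero ne
    by (auto simp: row3 intro!: exI[of _ 0])
qed

lemma curv_nonzero_somewhere:
  assumes N: "open N" "N \<subseteq> U" "N \<noteq> {}" and nabla: "nonzero_section_on U (nabla_curv b c \<mu> \<nu>)"
  shows "\<exists>n\<in>N. curv b c \<mu> \<nu> n \<noteq> 0"
proof (rule ccontr)
  assume "\<not> ?thesis"
  then have flat: "curv b c \<mu> \<nu> n = 0" if "n \<in> N" for n using that by blast
  have "nabla_curv b c \<mu> \<nu> n = 0" if n: "n \<in> N" for n
  proof -
    have "pd k (\<lambda>q. R i j q) n = pd k (\<lambda>q. 0) n" for k i j
      by (rule pd_cong[OF N(1) n]) (simp add: flat)
    then show ?thesis
      by (simp add: nabla_curv_def pd_mat_def pd_vec_def commutator_def flat[OF n] vec_eq_iff matrix_matrix_mult_def)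
  qed
  then show False using nabla N unfolding nonzero_section_on_def by blast
qed

text \<open>After shrinking the open set, either no component of \<open>W\<close> has a zero on it, or one component vanishes identically and
  the other one nowhere. Each of these three cases has its own covector.\<close>

lemma recurrent_covector_somewhere:
  assumes N: "open N" "N \<subseteq> U" "N \<noteq> {}"
    and compat: "\<And>n j. n \<in> U \<Longrightarrow> row_deriv 1 3 j n + row_deriv 2 2 j n = 0"
    and W: "smooth_vec_on U W" "nonzero_section_on U W"
    and nabla: "nonzero_section_on U (nabla_curv b c \<mu> \<nu>)"
    and along: "\<And>n. n \<in> U \<Longrightarrow> nabla_curv_along b c \<mu> \<nu> W n = 0"
  shows "\<exists>N' \<rho>. open N' \<and> N' \<subseteq> N \<and> N' \<noteq> {} \<and> recurrent_covector b c \<mu> \<nu> N' \<rho> \<and> (\<forall>n\<in>N'. curv b c \<mu> \<nu> n \<noteq> 0)"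
proof -
  obtain n0 i j where n0: "n0 \<in> N" "R i j n0 \<noteq> 0"
    using curv_nonzero_somewhere[OF N nabla] by (auto simp: vec_eq_iff)
  define N1 where "N1 = {n\<in>N. R i j n \<noteq> 0}"
  have N1: "open N1" "N1 \<subseteq> N" "N1 \<noteq> {}" and curv: "\<And>n. n \<in> N1 \<Longrightarrow> curv b c \<mu> \<nu> n \<noteq> 0"
    using open_nonzero_curv[OF N(1,2)] n0 by (auto simp: N1_def)
  have "N1 \<subseteq> U" using N1(2) N(2) by blast
  then obtain n1 where n1: "n1 \<in> N1" "W n1 \<noteq> 0" using W(2) N1 unfolding nonzero_section_on_def by blast
  have open_W: "open {n\<in>A. W n $ l \<noteq> 0}" if "open A" "A \<subseteq> N1" for A l
  proof -
    have "smooth_on U (\<lambda>n. W n $ l)" using W(1) unfolding smooth_vec_on_def by blast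
    then have "continuous_on A (\<lambda>n. W n $ l)"
      by (rule continuous_on_subset[OF smooth_on_imp_continuous_on]) (use that \<open>N1 \<subseteq> U\<close> in blast)
    then have "open (A \<inter> (\<lambda>n. W n $ l) -` (- {0}))" using that by (intro continuous_open_preimage) auto
    then show ?thesis by (simp add: vimage_def Int_def)
  qed
  define N2 where "N2 l = {n\<in>N1. W n $ l \<noteq> 0}" for l
  have N2: "open (N2 l)" "N2 l \<subseteq> N1" for l
    using open_W[OF N1(1)] by (auto simp: N2_def)
  have sub: "A \<subseteq> U" "A \<subseteq> N" "\<And>n. n \<in> A \<Longrightarrow> curv b c \<mu> \<nu> n \<noteq> 0"
    "\<And>n. n \<in> A \<Longrightarrow> nabla_curv_along b c \<mu> \<nu> W n = 0" "smooth_vec_on A W" if "A \<subseteq> N1" for A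
    using that \<open>N1 \<subseteq> U\<close> N1(2) curv along smooth_vec_on_subset[OF W(1), of A] by blast+
  consider "N2 1 \<inter> N2 2 \<noteq> {}" | "N2 1 \<noteq> {}" "N2 1 \<inter> N2 2 = {}" | "N2 2 \<noteq> {}" "N2 1 \<inter> N2 2 = {}"
    using n1 by (auto simp: N2_def vec_eq_iff forall_2)
  then show ?thesis
  proof cases
    case 1
    have "N2 1 \<inter> N2 2 \<subseteq> N1" using N2 by blast
    note sub = sub[OF this]
    have "recurrent_covector b c \<mu> \<nu> (N2 1 \<inter> N2 2) (\<lambda>n. curv b c \<mu> \<nu> n $ 3)"
      by (rule recurrent_covector_row_3[where W = W])
         (use N2 sub compat in \<open>auto simp: N2_def\<close>)
    then show ?thesis using 1 N2 sub by (intro exI[of _ "N2 1 \<inter> N2 2"]) blast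
  next
    case 2
    note sub = sub[OF N2(2)[of 1]]
    have "recurrent_covector b c \<mu> \<nu> (N2 1) (\<lambda>n. vector [0, 1, 0])"
      by (rule recurrent_covector_dp[where W = W])
         (use 2 N2[of 1] sub in \<open>auto simp: N2_def\<close>)
    then show ?thesis using 2 N2[of 1] sub by (intro exI[of _ "N2 1"]) blast
  next
    case 3
    note sub = sub[OF N2(2)[of 2]]
    have "recurrent_covector b c \<mu> \<nu> (N2 2) (\<lambda>n. vector [0, 0, 1])"
      by (rule recurrent_covector_dq[where W = W])
         (use 3 N2[of 2] sub in \<open>auto simp: N2_def\<close>)
    then show ?thesis using 3 N2[of 2] sub by (intro exI[of _ "N2 2"]) blast
  qed
qed

lemma open_T_nonzero: "open {m\<in>B5 U. T m \<noteq> 0}"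
proof -
  have "open (B5 U \<inter> tp -` (- {0}))" "open (B5 U \<inter> tq -` (- {0}))"
    by (intro continuous_open_preimage smooth_on_imp_continuous_on smooth_tp smooth_tq open_total open_Compl closed_singleton)+
  then have "open (B5 U \<inter> tp -` (- {0}) \<union> B5 U \<inter> tq -` (- {0}))" by (rule open_Un)
  moreover have "B5 U \<inter> tp -` (- {0}) \<union> B5 U \<inter> tq -` (- {0}) = {m\<in>B5 U. T m \<noteq> 0}"
    by (auto simp: vec_eq_iff forall_5)
  ultimately show ?thesis by simp
qed

text \<open>\<open>R w\<close> is linear in \<open>w\<close>: along a line in a direction that \<open>R\<close> does not kill it vanishes for at most one parameter.\<close>

lemma T_nonzero_dense_in_fibre:
  assumes m: "m \<in> B5 U" "curv b c \<mu> \<nu> (base5 m) \<noteq> 0"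
  shows "m \<in> closure {m'. base5 m' = base5 m \<and> T m' \<noteq> 0}"
proof -
  obtain j where j: "R 2 j (base5 m) \<noteq> 0 \<or> R 3 j (base5 m) \<noteq> 0"
    using m(2) unfolding curv_zero_iff by blast
  define v where "v = (axis j 1 :: 'k^3)"
  have line: "tp (fibre_line m v t) = tp m + t * R 2 j (base5 m)" "tq (fibre_line m v t) = tq m + t * R 3 j (base5 m)" for t
  proof -
    have "tp (fibre_line m v t) = tp m + t * (R 2 1 (base5 m) * v$1 + R 2 2 (base5 m) * v$2 + R 2 3 (base5 m) * v$3)"
      "tq (fibre_line m v t) = tq m + t * (R 3 1 (base5 m) * v$1 + R 3 2 (base5 m) * v$2 + R 3 3 (base5 m) * v$3)"
      unfolding tp_def tq_def fibre_line(1) by (simp_all add: fibre_line_def algebra_simps)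
    moreover have "R i 1 (base5 m) * v$1 + R i 2 (base5 m) * v$2 + R i 3 (base5 m) * v$3 = R i j (base5 m)" for i
      using exhaust_3[of j] by (auto simp: v_def axis_def)
    ultimately show "tp (fibre_line m v t) = tp m + t * R 2 j (base5 m)"
      "tq (fibre_line m v t) = tq m + t * R 3 j (base5 m)" by simp_all
  qed
  have one_zero: "finite {t::'k. x + t * y = 0}" if "y \<noteq> 0" for x y
  proof -
    have "t = - x / y" if "x + t * y = 0" for t
      using that \<open>y \<noteq> 0\<close> by (metis add_eq_0_iff nonzero_mult_div_cancel_right)
    then have "{t. x + t * y = 0} \<subseteq> {- x / y}" by auto
    then show ?thesis by (rule finite_subset) simp
  qed
  have "finite {t. fibre_line m v t \<notin> {m'. base5 m' = base5 m \<and> T m' \<noteq> 0}}"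
  proof -
    have "{t. fibre_line m v t \<notin> {m'. base5 m' = base5 m \<and> T m' \<noteq> 0}}
        = {t. tp m + t * R 2 j (base5 m) = 0} \<inter> {t. tq m + t * R 3 j (base5 m) = 0}"
      by (auto simp: vec_eq_iff forall_5 line)
    then show ?thesis using one_zero j by auto
  qed
  from curve_in_closure[OF continuous_on_fibre_line this] show ?thesis by simp
qed

lemma growth_2_3_4:
  assumes "\<And>n j. n \<in> U \<Longrightarrow> row_deriv 1 3 j n + row_deriv 2 2 j n = 0"
    "smooth_vec_on U W" "nonzero_section_on U W" "nonzero_section_on U (nabla_curv b c \<mu> \<nu>)"
    "\<And>n. n \<in> U \<Longrightarrow> nabla_curv_along b c \<mu> \<nu> W n = 0"
  shows "has_growth_vector (M5 U s0) D [2, 3, 4]"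
proof (rule has_growth_vectorI)
  define good where "good N \<longleftrightarrow> open N \<and> N \<subseteq> U \<and> (\<exists>\<rho>. recurrent_covector b c \<mu> \<nu> N \<rho>) \<and> (\<forall>n\<in>N. curv b c \<mu> \<nu> n \<noteq> 0)" for N
  define G where "G = \<Union> (Collect good)"
  have G: "open G" "G \<subseteq> U" by (auto simp: G_def good_def)
  have dense_G: "U \<subseteq> closure G"
  proof
    fix n assume n: "n \<in> U"
    have "\<exists>y\<in>G. y \<in> A" if A: "n \<in> A" "open A" for A
    proof -
      have "open (A \<inter> U)" "A \<inter> U \<subseteq> U" "A \<inter> U \<noteq> {}" using A n open_U by auto
      from recurrent_covector_somewhere[OF this assms] obtain N' \<rho> where
        N': "open N'" "N' \<subseteq> A \<inter> U" "N' \<noteq> {}" "recurrent_covector b c \<mu> \<nu> N' \<rho>" "\<forall>n\<in>N'. curv b c \<mu> \<nu> n \<noteq> 0"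
        by blast
      then have "good N'" by (auto simp: good_def)
      then show ?thesis using N'(2,3) by (auto simp: G_def)
    qed
    then show "n \<in> closure G" unfolding closure_iff_nhds_not_empty by blast
  qed
  \<comment> \<open>The ranks are 2, 3, 4 where \<open>R w \<noteq> 0\<close> over base points that have a recurrent covector nearby.\<close>
  define S where "S = B5 G \<inter> {m\<in>B5 U. T m \<noteq> 0}"
  have S: "open S" unfolding S_def by (intro open_Int open_B5 G open_T_nonzero)
  have "B5 G \<subseteq> closure S"
  proof
    fix m assume m: "m \<in> B5 G"
    then have "base5 m \<in> G" by (simp add: B5_def)
    then have "curv b c \<mu> \<nu> (base5 m) \<noteq> 0" "m \<in> B5 U" using G by (auto simp: G_def good_def B5_def)
    then have "m \<in> closure {m'. base5 m' = base5 m \<and> T m' \<noteq> 0}" by (intro T_nonzero_dense_in_fibre)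
    moreover have "{m'. base5 m' = base5 m \<and> T m' \<noteq> 0} \<subseteq> S"
      using \<open>base5 m \<in> G\<close> G(2) by (auto simp: S_def B5_def)
    ultimately show "m \<in> closure S" using closure_mono by blast
  qed
  then have "closure (B5 G) \<subseteq> closure S" by (simp add: closure_minimal)
  moreover have "B5 U \<subseteq> closure (B5 G)" using closure_B5 dense_G by (auto simp: B5_def)
  ultimately have dense: "B5 U \<subseteq> closure S" by (rule order_trans[rotated])
  show "open (M5 U s0 \<inter> S)" using S open_M5[OF open_U] by auto
  show "M5 U s0 \<subseteq> closure (M5 U s0 \<inter> S)"
    using open_Int_closure_subset[OF open_M5[OF open_U], of s0 S] dense M5_subset_B5[of U s0] by blast
  fix m k assume m: "m \<in> M5 U s0 \<inter> S"
  then obtain N \<rho> where "open N" "N \<subseteq> U" "recurrent_covector b c \<mu> \<nu> N \<rho>" "m \<in> B5 N" "T m \<noteq> 0"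
    by (auto simp: S_def G_def good_def B5_def)
  then show "vec.dim ((derived ^^ k) D m) = [2, 3, 4] ! min k (length [2, 3, 4::nat] - 1)"
    using dims_2_3_4 by (simp add: numeral_2_eq_2)
qed auto

lemma flat_integrable:
  assumes "\<And>n. n \<in> U \<Longrightarrow> curv b c \<mu> \<nu> n = 0"
  shows "integrable_dist_on (M5 U s0) D"
  unfolding integrable_dist_on_def
proof
  fix m assume "m \<in> M5 U s0"
  then have m: "m \<in> B5 U" using M5_subset_B5 by blast
  then have "curv b c \<mu> \<nu> (base5 m) = 0" using assms by (simp add: B5_def)
  then have T: "T m = 0" by (simp add: vec_eq_iff forall_5 tp_def tq_def)
  have "{X m, Y m, 0} = insert 0 {X m, Y m}" by auto
  then show "derived D m = D m"
    unfolding derived_bar_dist[OF m] bar_dist_eq T using vec.span_insert_0 by metis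
qed

text \<open>The first row of \<open>\<nabla>R\<close> contains the other two rows of \<open>R\<close>.\<close>

lemma parallel_curvature_zero:
  assumes "\<And>n. n \<in> U \<Longrightarrow> nabla_curv b c \<mu> \<nu> n = 0" "n \<in> U"
  shows "curv b c \<mu> \<nu> n = 0"
proof -
  have "R 2 j n = 0" "R 3 j n = 0" for j
    using nabla_curv_entries(1,2)[of n j] assms by simp_all
  then show ?thesis by (simp add: curv_zero_iff)
qed

end

theorem lemma4p4:
  fixes U :: "('k::{real_normed_field, euclidean_space}^2) set"
    and \<sigma> :: "'k^2 \<Rightarrow> 'k^4"
    and b c \<mu> \<nu> :: "'k^2 \<Rightarrow> 'k"
    and s0 :: 'k
  assumes "canonical_surface U \<sigma> b c \<mu> \<nu>"
  shows
    "(distribution_on 3 (M6 U) (hat_dist b c \<mu> \<nu> s0) \<and>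
      generically (\<lambda>U' b' c' \<mu>' \<nu>'. has_growth_vector (M6 U') (hat_dist b' c' \<mu>' \<nu>' s0) [3, 4, 6]) \<and>
      cauchy_characteristic (M6 U) (hat_dist b c \<mu> \<nu> s0) Z_field)
     \<and>
     ((\<forall>v\<in>M6 U. forget_s ` hat_dist b c \<mu> \<nu> s0 v = bar_dist b c \<mu> \<nu> s0 (forget_s v)) \<and>
      distribution_on 2 (M5 U s0) (bar_dist b c \<mu> \<nu> s0) \<and>
      generically (\<lambda>U' b' c' \<mu>' \<nu>'. has_growth_vector (M5 U' s0) (bar_dist b' c' \<mu>' \<nu>' s0) [2, 3, 5]))
     \<and>
     (((\<forall>m\<in>U. curv b c \<mu> \<nu> m = 0) \<longrightarrow> integrable_dist_on (M5 U s0) (bar_dist b c \<mu> \<nu> s0)) \<and>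
      (nonzero_section_on U (curv b c \<mu> \<nu>) \<and> (\<forall>m\<in>U. nabla_curv b c \<mu> \<nu> m = 0) \<longrightarrow>
         has_growth_vector (M5 U s0) (bar_dist b c \<mu> \<nu> s0) [2, 3]) \<and>
      (\<forall>V W. open V \<and> V \<subseteq> U \<and> smooth_vec_on V W \<and> nonzero_section_on V W \<and>
         nonzero_section_on V (nabla_curv b c \<mu> \<nu>) \<and>
         (\<forall>m\<in>V. nabla_curv_along b c \<mu> \<nu> W m = 0) \<longrightarrow>
         has_growth_vector (M5 V s0) (bar_dist b c \<mu> \<nu> s0) [2, 3, 4]))"
proof -
  interpret smooth_system U b c \<mu> \<nu> s0
    unfolding smooth_system_def using canonical_surfaceD[OF assms] by blast
  have "has_growth_vector (M5 U s0) D [2, 3]"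
    if "nonzero_section_on U (curv b c \<mu> \<nu>)" "\<forall>m\<in>U. nabla_curv b c \<mu> \<nu> m = 0"
  proof -
    have "U = {}"
      using that parallel_curvature_zero open_U unfolding nonzero_section_on_def by blast
    then have "M5 U s0 = {}" by (simp add: M5_def M6_def)
    then show ?thesis by (simp add: has_growth_vector_def regular_points_def)
  qed
  moreover have "has_growth_vector (M5 V s0) D [2, 3, 4]"
    if V: "open V" "V \<subseteq> U" "smooth_vec_on V W" "nonzero_section_on V W"
      "nonzero_section_on V (nabla_curv b c \<mu> \<nu>)" "\<forall>m\<in>V. nabla_curv_along b c \<mu> \<nu> W m = 0" for V W
  proof -
    interpret V: smooth_system V b c \<mu> \<nu> s0
      using V(1,2) smooth_coefficients smooth_on_subset by unfold_locales blast+
    show ?thesis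
      by (rule V.growth_2_3_4[where W = W])
         (use V compatibility_of_rows canonical_surface_compatibility[OF assms] in auto)
  qed
  moreover have "generically (\<lambda>U' b' c' \<mu>' \<nu>'. has_growth_vector (M6 U') (hat_dist b' c' \<mu>' \<nu>' s0) [3, 4, 6])"
    "generically (\<lambda>U' b' c' \<mu>' \<nu>'. has_growth_vector (M5 U' s0) (bar_dist b' c' \<mu>' \<nu>' s0) [2, 3, 5])"
    by (rule genericallyI[of s0], rule smooth_system.generic_growth, assumption+)+
  ultimately show ?thesis
    using hat_dist_distribution Z_cauchy_characteristic forget_s_hat_dist bar_dist_distribution flat_integrable
    by blast
qed

end
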